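(* Let $\rho_\star$ be a direction state (in $\mathbb R^m$) satisfying $\widehat{\mathcal J}_{\rm PW}(\rho_\star)=0$. Assume that, in a neighborhood of $\rho_\star$, the active graph rank is constant, $A(\rho)$ is uniformly invertible, and there is a smooth residual coordinate map $R$ with $$\widehat{\mathcal J}_{\rm PW}(\rho)=\|R(\rho)\|_2^2$$ whose Jacobian $DR(\rho_\star)$ has full column rank. Then there are constants $c_0,C_0,C_U>0$ such that $$c_0\,\operatorname{dist}(\rho,\mathcal O(\rho_\star))^2\le \widehat{\mathcal J}_{\rm PW}(\rho)\le C_0\,\operatorname{dist}(\rho,\mathcal O(\rho_\star))^2$$ and $$\|U(\rho)-U(\rho_\star)\|_{\mathcal G,h}\le C_U\,\operatorname{dist}(\rho,\mathcal O(\rho_\star))$$ for all $\rho$ sufficiently close to $\rho_\star$. Consequently, standard Gauss--Newton or trust-region/Levenberg--Marquardt iteration (applied to minimizing $\|R(\rho)\|_2^2$) is locally convergent, with the usual quadratic zero-residual Gauss--Newton behavior once the full-rank neighborhood is entered.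
   Context: **Model problem.** $\Omega\subset\mathbb R^2$ is a bounded Lipschitz domain with $\partial\Omega=\Gamma_D\,\dot\cup\,\Gamma_R$ (either part, e.g. $\Gamma_R$, may be empty), outward unit normal $n$, wavenumber $\kappa>0$ and Dirichlet data $g$ on $\Gamma_D$. The problem is $\Delta u+\kappa^2u=0$ in $\Omega$, $u=g$ on $\Gamma_D$, $\partial_nu+i\kappa u=0$ on $\Gamma_R$. $\mathcal T_h$ is a mesh of $\Omega$, $\mathcal E_h^{\rm I}$ its set of interior edges, and $\nabla_h$ the elementwise gradient. **Jumps and averages.** On an interior edge $e=\partial K^+\cap\partial K^-$ with outward normals $n^\pm$: for scalar traces $\{\!\{v\}\!\}=\frac12(v^++v^-)$ and $[\![v]\!]=v^+n^++v^-n^-$ (vector valued); for vector traces $\{\!\{\tau\}\!\}=\frac12(\tau^++\tau^-)$ and $[\![\tau]\!]_n=\tau^+\cdot n^++\tau^-\cdot n^-$ (scalar valued). The parameters satisfy $\alpha,\beta>0$ and $0<\delta\le 1/2$; the edge scale is $\xi_e=\kappa$ for constant wavenumber. (For piecewise-constant wavenumber with $\Gamma_R=\varnothing$ one uses instead $\xi_e=\frac12(\kappa_{K^+}+\kappa_{K^-})$ on interior edges in all forms below, with interior weights $\alpha\xi_e$, $\beta/\xi_e$.) **Plane-wave spaces.** For an element $K$ with reference point $x_K$ and local wavenumber $\kappa_K$, and a complex angle $z=\theta+i\eta\in\mathbb C$, set $q_K(z)=\kappa_K(\cos z,\sin z)$ and $\phi_{K,z}(x)=\exp(iq_K(z)\cdot(x-x_K))$,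 with the bilinear dot product. Given local angles $Z_K=(z_{K,1},\dots,z_{K,r_K})$, $V_K(Z_K)=\operatorname{span}\{\phi_{K,z_{K,j}}\}_{j=1}^{r_K}$ and $V_h(Z)=\prod_{K\in\mathcal T_h}V_K(Z_K)$. Fix an ordering $\varphi_1(Z),\dots,\varphi_{N_h}(Z)$ of the active local basis functions and write $v_h(c,Z)=\sum_jc_j\varphi_j(Z)$. **PWDG system.** With the form linear in the first and conjugate-linear in the second argument, $$\begin{aligned}a_h(u,v)=&\sum_{e\in\mathcal E_h^{\rm I}}\int_e\Big(\{\!\{u\}\!\}[\![\nabla_h\overline v]\!]_n-[\![\overline v]\!]\cdot\{\!\{\nabla_hu\}\!\}+i\tfrac{\beta}{\xi_e}[\![\nabla_hu]\!]_n[\![\nabla_h\overline v]\!]_n+i\alpha\xi_e[\![u]\!]\cdot[\![\overline v]\!]\Big)ds\\&+\int_{\Gamma_D}\big(-\partial_nu\,\overline v+i\alpha\kappa u\overline v\big)ds\\&+\int_{\Gamma_R}\Big((1-\delta)i\kappa u\overline v+(1-\delta)u\,\partial_n\overline v-\delta\,\partial_nu\,\overline v-\delta(i\kappa)^{-1}\partial_nu\,\partial_n\overline v\Big)ds,\end{aligned}$$ $$F_h(v)=\int_{\Gamma_D}g\,(i\alpha\kappa\overline v-\partial_n\overline v)\,ds.$$ Put $A_{ij}(Z)=a_h(\varphi_j(Z),\varphi_i(Z))$, $f_i(Z)=F_h(\varphi_i(Z))$, and let $c_{\rm PW}(Z)$ be the solution of $A(Z)c_{\rm PW}(Z)=f(Z)$.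 **Graph norm and active rank.** $$\begin{aligned}\mathcal G_h(u,v)=&\sum_{e\in\mathcal E_h^{\rm I}}\Big[\alpha\xi_e\int_e[\![u]\!]\cdot\overline{[\![v]\!]}\,ds+\frac{\beta}{\xi_e}\int_e[\![\nabla_hu]\!]_n\overline{[\![\nabla_hv]\!]_n}\,ds\Big]+\alpha\kappa\int_{\Gamma_D}u\overline v\,ds\\&+\int_{\Gamma_R}\Big[(1-\delta)\kappa u\overline v+\frac{\delta}{\kappa}\partial_nu\,\overline{\partial_nv}\Big]ds,\end{aligned}$$ and $\|v\|_{\mathcal G,h}=\mathcal G_h(v,v)^{1/2}$. The graph Gram matrix is $G_{ij}=\mathcal G_h(\varphi_j,\varphi_i)$, and the active graph rank is the rank of $G$, i.e. the dimension of the retained (active) Trefftz space modulo redundant traces. On a neighborhood where the rank is constant, the active basis (the selection, or fixed linear combinations, of the plane waves that are retained) is kept fixed. **Residual.** $$\begin{aligned}\mathcal J(c,Z)=&\sum_{e\in\mathcal E_h^{\rm I}}\int_e\Big[\alpha\kappa\,|[\![v_h]\!]|^2+\frac{\beta}{\kappa}|[\![\nabla_hv_h]\!]_n|^2\Big]ds+\alpha\kappa\int_{\Gamma_D}|v_h-g|^2ds\\&+\frac1{2\kappa}\int_{\Gamma_R}|\partial_nv_h+i\kappa v_h|^2ds,\qquad v_h=v_h(c,Z).\end{aligned}$$ **Direction variables.** $\rho\in\mathbb R^m$ collects the free real direction coordinates (real and imaginary parts $\theta,\eta$ of the free complex angles), and functions of $Z$ are regarded as functions of $\rho$. The reduced objective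 is $\widehat{\mathcal J}_{\rm PW}(\rho)=\mathcal J(c_{\rm PW}(\rho),\rho)$ and $U(\rho)=v_h(c_{\rm PW}(\rho),\rho)$. $\mathcal O(\rho_\star)$ is the finite orbit of $\rho_\star$ under permutations of the rays (angles) within each element, which leave the local Trefftz spaces unchanged; $\operatorname{dist}$ is Euclidean distance to this set. *)

theory Defs
  imports "HOL-Analysis.Analysis"
begin

text \<open>
  One-dimensional Hausdorff measure in the plane; it gives the arc length element
  \<open>ds\<close> on edges and boundaries. The covering sets are required to be bounded
  because the library leaves the diameter of an unbounded set unspecified.
\<close>

definition hausdorff1_outer :: "(real^2) set \<Rightarrow> ennreal" where
  "hausdorff1_outer A =
    (SUP \<delta>\<in>{0::real<..}.
      INF C\<in>{C :: nat \<Rightarrow> (real^2) set.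
              A \<subseteq> (\<Union>i. C i) \<and> (\<forall>i. bounded (C i) \<and> diameter (C i) \<le> \<delta>)}.
        (\<Sum>i. ennreal (diameter (C i))))"

definition hausdorff1 :: "(real^2) measure" where
  "hausdorff1 = measure_of UNIV (sets borel) hausdorff1_outer"

definition lipschitz_boundary :: "(real^2) set \<Rightarrow> bool" where
  "lipschitz_boundary S \<longleftrightarrow>
    (\<forall>p\<in>frontier S. \<exists>a b r h L \<gamma>.
       norm a = 1 \<and> norm b = 1 \<and> a \<bullet> b = 0 \<and> r > 0 \<and> h > 0 \<and>
       L-lipschitz_on (UNIV :: real set) (\<gamma> :: real \<Rightarrow> real) \<and>
       (\<forall>x. \<bar>(x - p) \<bullet> a\<bar> < r \<and> \<bar>(x - p) \<bullet> b\<bar> < h \<longrightarrow>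
            (x \<in> S \<longleftrightarrow> (x - p) \<bullet> b < \<gamma> ((x - p) \<bullet> a))))"

definition bounded_lipschitz_domain :: "(real^2) set \<Rightarrow> bool" where
  "bounded_lipschitz_domain S \<longleftrightarrow>
    S \<noteq> {} \<and> open S \<and> connected S \<and> bounded S \<and> lipschitz_boundary S"

text \<open>
  \<open>n\<close> is the outward unit normal of \<open>S\<close> at \<open>x\<close> if, seen from \<open>x\<close>, the set \<open>S\<close> blows
  up to the half plane with outward normal \<open>n\<close>. Such an \<open>n\<close> is unique, and on the
  boundary of a Lipschitz domain it exists at almost every point with respect to length.
\<close>

definition is_outer_normal :: "(real^2) set \<Rightarrow> real^2 \<Rightarrow> real^2 \<Rightarrow> bool" where
  "is_outer_normal S x n \<longleftrightarrow> norm n = 1 \<and>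
    (\<forall>\<epsilon>>0. \<exists>r>0. \<forall>y. dist y x < r \<longrightarrow>
       (n \<bullet> (y - x) < - \<epsilon> * norm (y - x) \<longrightarrow> y \<in> S) \<and>
       (n \<bullet> (y - x) > \<epsilon> * norm (y - x) \<longrightarrow> y \<notin> S))"

definition outer_normal :: "(real^2) set \<Rightarrow> real^2 \<Rightarrow> real^2" where
  "outer_normal S x = (THE n. is_outer_normal S x n)"

type_synonym elem = "(real^2) set"

text \<open>Functions on the mesh with one branch per element, so that two-sided traces make sense.\<close>

type_synonym 'v broken = "elem \<Rightarrow> real^2 \<Rightarrow> 'v"

definition is_mesh :: "(real^2) set \<Rightarrow> elem set \<Rightarrow> bool" where
  "is_mesh \<Omega> T \<longleftrightarrow> finite T \<and> disjoint T \<and>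
    (\<forall>K\<in>T. bounded_lipschitz_domain K \<and> K \<subseteq> \<Omega>) \<and>
    closure \<Omega> = (\<Union>K\<in>T. closure K)"

text \<open>
  An interior edge is stored as the ordered pair \<open>(K\<^sup>+, K\<^sup>-)\<close> of its two elements; the
  set \<open>E\<close> contains each pair of neighbours in exactly one of the two orders. The labelling
  is arbitrary.
\<close>

definition edge_set :: "elem \<times> elem \<Rightarrow> (real^2) set" where
  "edge_set e = frontier (fst e) \<inter> frontier (snd e)"

definition interior_edges :: "elem set \<Rightarrow> (elem \<times> elem) set \<Rightarrow> bool" where
  "interior_edges T E \<longleftrightarrow>
    (\<forall>(K, L)\<in>E. K \<in> T \<and> L \<in> T \<and> K \<noteq> L \<and> emeasure hausdorff1 (edge_set (K, L)) > 0 \<and>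
        (L, K) \<notin> E) \<and>
    (\<forall>K\<in>T. \<forall>L\<in>T. K \<noteq> L \<and> emeasure hausdorff1 (edge_set (K, L)) > 0 \<longrightarrow>
        (K, L) \<in> E \<or> (L, K) \<in> E)"

record pwdg =
  Dom :: "(real^2) set"
  GamD :: "(real^2) set"
  GamR :: "(real^2) set"
  Mesh :: "elem set"
  Edges :: "(elem \<times> elem) set"
  wavenum :: "elem \<Rightarrow> real"
  alpha :: real
  beta :: real
  delta :: real
  bdata :: "real^2 \<Rightarrow> complex"
  refpt :: "elem \<Rightarrow> real^2"
  nrays :: "elem \<Rightarrow> nat"

text \<open>
  The wavenumber is constant, or piecewise constant when there is no impedance boundary.
  In the latter case the wavenumber occurring in the Dirichlet boundary terms below is its
  trace, that is the value on the adjacent element.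
\<close>

definition pwdg_setting :: "pwdg \<Rightarrow> bool" where
  "pwdg_setting P \<longleftrightarrow>
    bounded_lipschitz_domain (Dom P) \<and>
    GamD P \<in> sets borel \<and> GamR P \<in> sets borel \<and>
    GamD P \<inter> GamR P = {} \<and> GamD P \<union> GamR P = frontier (Dom P) \<and>
    is_mesh (Dom P) (Mesh P) \<and> interior_edges (Mesh P) (Edges P) \<and>
    (\<forall>K\<in>Mesh P. wavenum P K > 0) \<and>
    ((\<exists>\<kappa>. \<forall>K\<in>Mesh P. wavenum P K = \<kappa>) \<or> GamR P = {}) \<and>
    alpha P > 0 \<and> beta P > 0 \<and> 0 < delta P \<and> delta P \<le> 1/2 \<and>
    set_borel_measurable hausdorff1 (GamD P) (bdata P) \<and>
    set_integrable hausdorff1 (GamD P) (\<lambda>x. (norm (bdata P x))\<^sup>2)"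

text \<open>For a constant wavenumber this is the wavenumber itself.\<close>

definition edge_scale :: "pwdg \<Rightarrow> elem \<times> elem \<Rightarrow> real" where
  "edge_scale P e = (wavenum P (fst e) + wavenum P (snd e)) / 2"

definition cvec :: "real^2 \<Rightarrow> complex^2" where
  "cvec n = (\<chi> i. complex_of_real (n $ i))"

text \<open>The bilinear (not Hermitian) dot product.\<close>

definition cdot :: "complex^2 \<Rightarrow> complex^2 \<Rightarrow> complex" where
  "cdot a b = (\<Sum>i\<in>UNIV. a $ i * b $ i)"

definition vcnj :: "complex^2 \<Rightarrow> complex^2" where
  "vcnj a = (\<chi> i. cnj (a $ i))"

definition gradh :: "complex broken \<Rightarrow> (complex^2) broken" where
  "gradh v = (\<lambda>K x. \<chi> i. frechet_derivative (v K) (at x) (axis i 1))"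

definition conjh :: "complex broken \<Rightarrow> complex broken" where
  "conjh v = (\<lambda>K x. cnj (v K x))"

definition avg :: "elem \<times> elem \<Rightarrow> ('v::real_vector) broken \<Rightarrow> real^2 \<Rightarrow> 'v" where
  "avg e v x = (1/2) *\<^sub>R (v (fst e) x + v (snd e) x)"

definition jump :: "elem \<times> elem \<Rightarrow> complex broken \<Rightarrow> real^2 \<Rightarrow> complex^2" where
  "jump e v x = v (fst e) x *s cvec (outer_normal (fst e) x)
              + v (snd e) x *s cvec (outer_normal (snd e) x)"

definition njump :: "elem \<times> elem \<Rightarrow> (complex^2) broken \<Rightarrow> real^2 \<Rightarrow> complex" where
  "njump e \<tau> x = cdot (\<tau> (fst e) x) (cvec (outer_normal (fst e) x))
               + cdot (\<tau> (snd e) x) (cvec (outer_normal (snd e) x))"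

definition dnorm :: "pwdg \<Rightarrow> complex broken \<Rightarrow> elem \<Rightarrow> real^2 \<Rightarrow> complex" where
  "dnorm P v K x = cdot (gradh v K x) (cvec (outer_normal (Dom P) x))"

definition edge_int :: "elem \<times> elem \<Rightarrow> (real^2 \<Rightarrow> 'b::{banach, second_countable_topology}) \<Rightarrow> 'b"
  where "edge_int e f = (LINT x:edge_set e|hausdorff1. f x)"

text \<open>
  Integral over a part \<open>\<Gamma>\<close> of the boundary. On \<open>\<partial>K \<inter> \<Gamma>\<close> the trace is taken from \<open>K\<close>, so
  the integrand may depend on the element.
\<close>

definition bdry_int ::
  "pwdg \<Rightarrow> (real^2) set \<Rightarrow> (elem \<Rightarrow> real^2 \<Rightarrow> 'b::{banach, second_countable_topology}) \<Rightarrow> 'b"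
  where "bdry_int P \<Gamma> f = (\<Sum>K\<in>Mesh P. LINT x:(frontier K \<inter> \<Gamma>)|hausdorff1. f K x)"

definition a_h :: "pwdg \<Rightarrow> complex broken \<Rightarrow> complex broken \<Rightarrow> complex" where
  "a_h P u v =
    (\<Sum>e\<in>Edges P. edge_int e (\<lambda>x.
        avg e u x * njump e (gradh (conjh v)) x
      - cdot (jump e (conjh v) x) (avg e (gradh u) x)
      + \<i> * of_real (beta P / edge_scale P e) * njump e (gradh u) x * njump e (gradh (conjh v)) x
      + \<i> * of_real (alpha P * edge_scale P e) * cdot (jump e u x) (jump e (conjh v) x)))
  + bdry_int P (GamD P) (\<lambda>K x.
      - dnorm P u K x * conjh v K x
      + \<i> * of_real (alpha P * wavenum P K) * u K x * conjh v K x)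
  + bdry_int P (GamR P) (\<lambda>K x.
      of_real (1 - delta P) * \<i> * of_real (wavenum P K) * u K x * conjh v K x
      + of_real (1 - delta P) * u K x * dnorm P (conjh v) K x
      - of_real (delta P) * dnorm P u K x * conjh v K x
      - of_real (delta P) * inverse (\<i> * of_real (wavenum P K))
          * dnorm P u K x * dnorm P (conjh v) K x)"

definition F_h :: "pwdg \<Rightarrow> complex broken \<Rightarrow> complex" where
  "F_h P v = bdry_int P (GamD P) (\<lambda>K x.
      bdata P x * (\<i> * of_real (alpha P * wavenum P K) * conjh v K x - dnorm P (conjh v) K x))"

definition G_h :: "pwdg \<Rightarrow> complex broken \<Rightarrow> complex broken \<Rightarrow> complex" where
  "G_h P u v =
    (\<Sum>e\<in>Edges P.
        of_real (alpha P * edge_scale P e)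
          * edge_int e (\<lambda>x. cdot (jump e u x) (vcnj (jump e v x)))
      + of_real (beta P / edge_scale P e)
          * edge_int e (\<lambda>x. njump e (gradh u) x * cnj (njump e (gradh v) x)))
  + bdry_int P (GamD P) (\<lambda>K x. of_real (alpha P * wavenum P K) * u K x * cnj (v K x))
  + bdry_int P (GamR P) (\<lambda>K x.
      of_real ((1 - delta P) * wavenum P K) * u K x * cnj (v K x)
      + of_real (delta P / wavenum P K) * dnorm P u K x * cnj (dnorm P v K x))"

definition graph_norm :: "pwdg \<Rightarrow> complex broken \<Rightarrow> real" where
  "graph_norm P v = sqrt (Re (G_h P v v))"

definition residual :: "pwdg \<Rightarrow> complex broken \<Rightarrow> real" where
  "residual P v =
    (\<Sum>e\<in>Edges P. edge_int e (\<lambda>x.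
        alpha P * edge_scale P e * (norm (jump e v x))\<^sup>2
      + beta P / edge_scale P e * (norm (njump e (gradh v) x))\<^sup>2))
  + bdry_int P (GamD P) (\<lambda>K x. alpha P * wavenum P K * (norm (v K x - bdata P x))\<^sup>2)
  + bdry_int P (GamR P) (\<lambda>K x.
      1 / (2 * wavenum P K) * (norm (dnorm P v K x + \<i> * of_real (wavenum P K) * v K x))\<^sup>2)"

definition plane_wave :: "pwdg \<Rightarrow> elem \<Rightarrow> complex \<Rightarrow> real^2 \<Rightarrow> complex" where
  "plane_wave P K z x =
    exp (\<i> * cdot (of_real (wavenum P K) *s vector [cos z, sin z]) (cvec (x - refpt P K)))"

datatype angle_part = Theta | Eta

text \<open>
  The slot \<open>(K, j, p)\<close> is the real or imaginary part of the \<open>j\<close>-th angle of element \<open>K\<close>.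
  The free coordinates \<open>\<rho>\<close> fill the slots \<open>free i\<close>; all other slots keep the value
  given by \<open>fixed\<close>. The coefficients \<open>basis i K j\<close> express the \<open>i\<close>-th active basis function
  through the plane waves and do not depend on \<open>\<rho>\<close>; the selection of
  a single plane wave is the case of one coefficient 1 and all others 0.
\<close>

type_synonym slot = "elem \<times> nat \<times> angle_part"

record ('m, 'n) directions =
  free :: "'m \<Rightarrow> slot"
  fixed :: "slot \<Rightarrow> real"
  basis :: "'n \<Rightarrow> elem \<Rightarrow> nat \<Rightarrow> complex"

definition directions_setting :: "pwdg \<Rightarrow> ('m, 'n) directions \<Rightarrow> bool" where
  "directions_setting P D \<longleftrightarrow>
    inj (free D) \<and> (\<forall>i. \<exists>K j p. free D i = (K, j, p) \<and> K \<in> Mesh P \<and> j < nrays P K)"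

definition slot_val :: "('m::finite, 'n) directions \<Rightarrow> real^'m \<Rightarrow> slot \<Rightarrow> real" where
  "slot_val D \<rho> s = (if s \<in> range (free D) then \<rho> $ (inv (free D) s) else fixed D s)"

definition angle :: "('m::finite, 'n) directions \<Rightarrow> real^'m \<Rightarrow> elem \<Rightarrow> nat \<Rightarrow> complex" where
  "angle D \<rho> K j = Complex (slot_val D \<rho> (K, j, Theta)) (slot_val D \<rho> (K, j, Eta))"

definition active_basis ::
  "pwdg \<Rightarrow> ('m::finite, 'n) directions \<Rightarrow> real^'m \<Rightarrow> 'n \<Rightarrow> complex broken" where
  "active_basis P D \<rho> i = (\<lambda>K x. \<Sum>j<nrays P K. basis D i K j * plane_wave P K (angle D \<rho> K j) x)"

definition v_h ::
  "pwdg \<Rightarrow> ('m::finite, 'n::finite) directions \<Rightarrow> complex^'n \<Rightarrow> real^'m \<Rightarrow> complex broken" where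
  "v_h P D c \<rho> = (\<lambda>K x. \<Sum>j\<in>UNIV. c $ j * active_basis P D \<rho> j K x)"

definition A_mat ::
  "pwdg \<Rightarrow> ('m::finite, 'n::finite) directions \<Rightarrow> real^'m \<Rightarrow> complex^'n^'n" where
  "A_mat P D \<rho> = (\<chi> i j. a_h P (active_basis P D \<rho> j) (active_basis P D \<rho> i))"

definition f_vec ::
  "pwdg \<Rightarrow> ('m::finite, 'n::finite) directions \<Rightarrow> real^'m \<Rightarrow> complex^'n" where
  "f_vec P D \<rho> = (\<chi> i. F_h P (active_basis P D \<rho> i))"

definition G_mat ::
  "pwdg \<Rightarrow> ('m::finite, 'n::finite) directions \<Rightarrow> real^'m \<Rightarrow> complex^'n^'n" where
  "G_mat P D \<rho> = (\<chi> i j. G_h P (active_basis P D \<rho> j) (active_basis P D \<rho> i))"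

definition c_PW ::
  "pwdg \<Rightarrow> ('m::finite, 'n::finite) directions \<Rightarrow> real^'m \<Rightarrow> complex^'n" where
  "c_PW P D \<rho> = (THE c. A_mat P D \<rho> *v c = f_vec P D \<rho>)"

definition U_PW ::
  "pwdg \<Rightarrow> ('m::finite, 'n::finite) directions \<Rightarrow> real^'m \<Rightarrow> complex broken" where
  "U_PW P D \<rho> = v_h P D (c_PW P D \<rho>) \<rho>"

definition J_PW :: "pwdg \<Rightarrow> ('m::finite, 'n::finite) directions \<Rightarrow> real^'m \<Rightarrow> real" where
  "J_PW P D \<rho> = residual P (U_PW P D \<rho>)"

text \<open>States whose angles in every element are a permutation of those of the given state.\<close>

definition ray_orbit :: "pwdg \<Rightarrow> ('m::finite, 'n) directions \<Rightarrow> real^'m \<Rightarrow> (real^'m) set" where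
  "ray_orbit P D \<rho> = {\<rho>'. \<exists>\<pi>. \<forall>K\<in>Mesh P. \<pi> K permutes {..<nrays P K} \<and>
      (\<forall>j<nrays P K. angle D \<rho>' K j = angle D \<rho> K (\<pi> K j))}"

fun Ck_on :: "nat \<Rightarrow> 'a set \<Rightarrow> ('a::real_normed_vector \<Rightarrow> 'b::real_normed_vector) \<Rightarrow> bool" where
  "Ck_on 0 S f = continuous_on S f"
| "Ck_on (Suc k) S f =
    ((\<forall>x\<in>S. f differentiable (at x)) \<and> (\<forall>v. Ck_on k S (\<lambda>x. frechet_derivative f (at x) v)))"

definition smooth_on :: "'a set \<Rightarrow> ('a::real_normed_vector \<Rightarrow> 'b::real_normed_vector) \<Rightarrow> bool" where
  "smooth_on S f \<longleftrightarrow> (\<forall>k. Ck_on k S f)"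

definition lm_step :: "(real^'m \<Rightarrow> real^'p) \<Rightarrow> real \<Rightarrow> real^'m \<Rightarrow> real^'m" where
  "lm_step R \<mu> \<rho> = (let J = jacobian R (at \<rho>) in
     \<rho> - matrix_inv (transpose J ** J + \<mu> *\<^sub>R mat 1) *v (transpose J *v R \<rho>))"

definition gn_step :: "(real^'m \<Rightarrow> real^'p) \<Rightarrow> real^'m \<Rightarrow> real^'m" where
  "gn_step R \<rho> = (let J = jacobian R (at \<rho>) in
     \<rho> - matrix_inv (transpose J ** J) *v (transpose J *v R \<rho>))"

text \<open>
  The trust-region iteration with exact solution of the Gauss--Newton subproblem, gain ratio
  test and the textbook constants 1/4, 3/4, 1/4, 2 for the radius update. A run consists of
  the iterates \<open>X\<close> and the radii \<open>\<Delta>\<close>.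
\<close>

definition tr_solution :: "(real^'m \<Rightarrow> real^'p) \<Rightarrow> real^'m \<Rightarrow> real \<Rightarrow> real^'m \<Rightarrow> bool" where
  "tr_solution R \<rho> r s \<longleftrightarrow> norm s \<le> r \<and>
    (\<forall>t. norm t \<le> r \<longrightarrow>
       norm (R \<rho> + jacobian R (at \<rho>) *v s) \<le> norm (R \<rho> + jacobian R (at \<rho>) *v t))"

definition gain_ratio :: "(real^'m \<Rightarrow> real^'p) \<Rightarrow> real^'m \<Rightarrow> real^'m \<Rightarrow> real" where
  "gain_ratio R \<rho> s =
    ((norm (R \<rho>))\<^sup>2 - (norm (R (\<rho> + s)))\<^sup>2) /
    ((norm (R \<rho>))\<^sup>2 - (norm (R \<rho> + jacobian R (at \<rho>) *v s))\<^sup>2)"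

definition tr_run ::
  "(real^'m \<Rightarrow> real^'p) \<Rightarrow> real \<Rightarrow> real \<Rightarrow> (nat \<Rightarrow> real^'m) \<Rightarrow> (nat \<Rightarrow> real) \<Rightarrow> bool" where
  "tr_run R \<eta> \<Delta>max X \<Delta> \<longleftrightarrow>
    (\<forall>k. \<exists>s. tr_solution R (X k) (\<Delta> k) s \<and>
      X (Suc k) = (if gain_ratio R (X k) s > \<eta> then X k + s else X k) \<and>
      \<Delta> (Suc k) =
        (if gain_ratio R (X k) s < 1/4 then \<Delta> k / 4
         else if gain_ratio R (X k) s > 3/4 \<and> norm s = \<Delta> k then min (2 * \<Delta> k) \<Delta>max
         else \<Delta> k))"

definition lm_run ::
  "(real^'m \<Rightarrow> real^'p) \<Rightarrow> (nat \<Rightarrow> real^'m) \<Rightarrow> (nat \<Rightarrow> real) \<Rightarrow> bool" where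
  "lm_run R X \<mu> \<longleftrightarrow> (\<forall>k. X (Suc k) = lm_step R (\<mu> k) (X k))"

definition gn_run :: "(real^'m \<Rightarrow> real^'p) \<Rightarrow> (nat \<Rightarrow> real^'m) \<Rightarrow> bool" where
  "gn_run R X \<longleftrightarrow> (\<forall>k. X (Suc k) = gn_step R (X k))"

end

theory Submission
  imports Defs
begin

text \<open>
  Since \<open>R\<close> is smooth, vanishes at \<open>\<rho>s\<close> and has an injective Jacobian there, \<open>norm (R \<rho>)\<close> is
  comparable to \<open>norm (\<rho> - \<rho>s)\<close> near \<open>\<rho>s\<close>. The ray orbit is finite and contains \<open>\<rho>s\<close>, so close to
  \<open>\<rho>s\<close> the distance to the orbit is the distance to \<open>\<rho>s\<close>. This gives the two bounds on
  \<open>J_PW\<close> (\<open>residual_lower\<close>, \<open>residual_upper\<close>, \<open>finite_ray_orbit\<close>).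

  The graph norm estimate is a statement about the dependence of the discrete solution on the
  directions. Plane waves and their gradients depend Lipschitz continuously on their angles,
  uniformly on the bounded mesh skeleton. Integration over the skeleton keeps this property,
  because the skeleton has finite length (\<open>lipschitz_boundary_finite_length\<close>) and the normals are
  bounded Borel functions (\<open>borel_measurable_outer_normal\<close>). So the entries of the system matrix
  and of the load vector are Lipschitz in \<open>\<rho>\<close>, and the uniform bound on the inverse matrices
  carries this over to the coefficients (\<open>lip_family_linear_solve\<close>). The graph norm is the square
  root of a quadratic form in traces of size \<open>O(dist \<rho> \<rho>s)\<close> (\<open>graph_norm_increment_le\<close>).

  The three iterations are studied for an abstract nondegenerate zero \<open>z\<close> of a map \<open>R\<close>, in the
  locale \<open>regular_zero\<close>. With \<open>e = x - z\<close> and \<open>J\<close> the Jacobian at \<open>x\<close>, the Taylor remainder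
  \<open>R x - J e\<close> is of order \<open>norm e ^ 2\<close>. A Levenberg--Marquardt step solves
  \<open>H e' = \<mu> e - J\<^sup>T (R x - J e)\<close> with \<open>H = J\<^sup>T J + \<mu>\<close>, and \<open>H\<close> is bounded below by
  \<open>\<sigma>\<^sup>2 + \<mu>\<close>; this contracts for every \<open>\<mu> \<ge> 0\<close> and is quadratic if \<open>\<mu> = O(norm (R x))\<close>. Gauss--Newton is
  the case \<open>\<mu> = 0\<close>. For the trust-region method the predicted reduction is at least
  \<open>norm (J s) ^ 2\<close>, which close to \<open>z\<close> dwarfs the model error. So every step is accepted, the radius
  never shrinks before \<open>z\<close> is reached (\<open>tr_step_decrease\<close>), and sooner or later the trust region
  contains \<open>- e\<close>. From then on comparison with \<open>- e\<close> gives quadratic convergence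
  (\<open>tr_step_quadratic\<close>).
\<close>

section \<open>Length of Lipschitz boundaries\<close>

lemma sets_hausdorff1 [simp, measurable_cong]: "sets hausdorff1 = sets borel"
  unfolding hausdorff1_def by (simp add: sets_measure_of_conv sets.sigma_sets_eq[of borel, simplified])

text \<open>
  \<open>measure_of\<close> yields the outer measure on Borel sets if it is additive there, and the zero measure
  otherwise. So lengths can be bounded through explicit coverings in either case.
\<close>

lemma emeasure_hausdorff1_le_outer: "emeasure hausdorff1 A \<le> hausdorff1_outer A"
  unfolding hausdorff1_def by (simp add: emeasure_measure_of_conv)

lemma hausdorff1_outer_mono: "A \<subseteq> B \<Longrightarrow> hausdorff1_outer A \<le> hausdorff1_outer B"
  unfolding hausdorff1_outer_def by (intro SUP_mono' INF_superset_mono) auto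

text \<open>
  Cutting the parameter interval into \<open>n\<close> equal pieces covers the curve by \<open>n\<close> sets of diameter
  at most \<open>L (t - s) / n\<close>. Their sum does not depend on \<open>n\<close>, so \<open>n\<close> can be taken large enough for any
  restriction on the diameters.
\<close>

lemma hausdorff1_outer_lipschitz_curve:
  fixes f :: "real \<Rightarrow> real^2"
  assumes "L-lipschitz_on {s..t} f" "s \<le> t"
  shows "hausdorff1_outer (f ` {s..t}) \<le> ennreal (L * (t - s))"
  unfolding hausdorff1_outer_def
proof (rule SUP_least)
  fix \<delta> :: real assume "\<delta> \<in> {0<..}"
  then have \<delta>: "\<delta> > 0" by simp
  have L: "L \<ge> 0" using assms(1) lipschitz_on_nonneg by blast
  define w where "w = t - s"
  have w: "w \<ge> 0" using assms unfolding w_def by simp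
  obtain n :: nat where n: "L * w / \<delta> < real n" using reals_Archimedean2 by blast
  have n0: "n > 0"
  proof (rule ccontr)
    assume "\<not> n > 0"
    with n have "L * w / \<delta> < 0" by simp
    moreover have "L * w / \<delta> \<ge> 0" using L w \<delta> by simp
    ultimately show False by simp
  qed
  define h where "h = w / real n"
  have h: "h \<ge> 0" unfolding h_def using w by simp
  have Lh: "L * h \<le> \<delta>" using n n0 \<delta> unfolding h_def by (simp add: field_simps)
  define I where "I i = {s + real i * h .. s + real (Suc i) * h}" for i
  define C where "C i = (if i < n then f ` (I i \<inter> {s..t}) else {})" for i
  have diam: "diameter (C i) \<le> L * h" for i
  proof (rule diameter_le)
    show "C i \<noteq> {} \<or> 0 \<le> L * h" using L h by simp
    fix x y assume "x \<in> C i" "y \<in> C i"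
    then obtain a b where ab: "x = f a" "y = f b" "a \<in> I i" "b \<in> I i" "a \<in> {s..t}" "b \<in> {s..t}"
      unfolding C_def by (auto split: if_splits)
    have "dist x y \<le> L * dist a b" using lipschitz_onD[OF assms(1)] ab by blast
    also have "dist a b \<le> h" using ab(3,4) unfolding I_def by (auto simp: dist_real_def algebra_simps)
    finally show "norm (x - y) \<le> L * h" using L by (simp add: dist_norm mult_left_mono)
  qed
  have bdd: "bounded (C i)" for i
  proof -
    have "compact (f ` {s..t})"
      using assms(1) lipschitz_on_continuous_on compact_continuous_image compact_Icc by blast
    then show ?thesis unfolding C_def
      by (auto intro: bounded_subset[OF compact_imp_bounded])
  qed
  have cov: "f ` {s..t} \<subseteq> (\<Union>i. C i)"
  proof
    fix y assume "y \<in> f ` {s..t}"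
    then obtain u where u: "y = f u" "s \<le> u" "u \<le> t" by auto
    have "\<exists>i<n. u \<in> I i"
    proof (cases "u = t")
      case True
      have "s + real n * h = t" using n0 unfolding h_def w_def by simp
      then show ?thesis using n0 True h unfolding I_def
        by (intro exI[of _ "n - 1"]) (auto simp: algebra_simps of_nat_diff)
    next
      case False
      then have ut: "u < t" using u by simp
      then have h0: "h > 0" using u n0 unfolding h_def w_def by simp
      define i where "i = nat \<lfloor>(u - s) / h\<rfloor>"
      have q: "(u - s) / h \<ge> 0" using u h by simp
      have i: "real i \<le> (u - s) / h" "(u - s) / h < real i + 1"
        unfolding i_def using q by linarith+
      have "(u - s) / h < real n" using ut h0 n0 unfolding h_def w_def by (simp add: field_simps)
      then have "i < n" using i by linarith
      moreover have "u \<in> I i" using i h0 unfolding I_def by (auto simp: field_simps)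
      ultimately show ?thesis by blast
    qed
    then show "y \<in> (\<Union>i. C i)" using u unfolding C_def by fastforce
  qed
  have "(INF C\<in>{C :: nat \<Rightarrow> (real^2) set.
              f ` {s..t} \<subseteq> (\<Union>i. C i) \<and> (\<forall>i. bounded (C i) \<and> diameter (C i) \<le> \<delta>)}.
        (\<Sum>i. ennreal (diameter (C i)))) \<le> (\<Sum>i. ennreal (diameter (C i)))"
    using cov bdd order_trans[OF diam Lh] by (intro INF_lower) auto
  also have "\<dots> = (\<Sum>i<n. ennreal (diameter (C i)))"
    by (rule suminf_finite) (auto simp: C_def)
  also have "\<dots> \<le> (\<Sum>i<n. ennreal (L * h))"
    by (intro sum_mono ennreal_leI diam)
  also have "\<dots> = ennreal (real n * (L * h))"
    using L h by (simp add: ennreal_mult ennreal_of_nat_eq_real_of_nat)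
  also have "real n * (L * h) = L * (t - s)" using n0 unfolding h_def w_def by simp
  finally show "(INF C\<in>{C :: nat \<Rightarrow> (real^2) set.
              f ` {s..t} \<subseteq> (\<Union>i. C i) \<and> (\<forall>i. bounded (C i) \<and> diameter (C i) \<le> \<delta>)}.
        (\<Sum>i. ennreal (diameter (C i)))) \<le> ennreal (L * (t - s))" .
qed

text \<open>
  Two orthonormal vectors span the plane, so the defect is orthogonal to itself.
\<close>

lemma orthonormal_expansion_plane:
  fixes a b x :: "real^2"
  assumes "norm a = 1" "norm b = 1" "a \<bullet> b = 0"
  shows "x = (x \<bullet> a) *\<^sub>R a + (x \<bullet> b) *\<^sub>R b"
proof -
  have aa: "a \<bullet> a = 1" and bb: "b \<bullet> b = 1" using assms by (simp_all add: norm_eq_1)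
  have ab: "a \<noteq> b" using aa assms(3) by auto
  have "pairwise orthogonal {a, b}"
    using assms(3) by (auto simp: pairwise_def orthogonal_def inner_commute)
  moreover have "0 \<notin> {a, b}" using aa bb by auto
  ultimately have "independent {a, b}" by (rule pairwise_orthogonal_independent)
  then have sp: "span {a, b} = UNIV"
    using card_ge_dim_independent[of "{a,b}" UNIV] ab by auto
  define w where "w = x - ((x \<bullet> a) *\<^sub>R a + (x \<bullet> b) *\<^sub>R b)"
  have "orthogonal w w"
  proof (rule orthogonal_to_span)
    show "w \<in> span {a, b}" using sp by simp
    fix y assume "y \<in> {a, b}"
    then show "orthogonal w y"
      using aa bb assms(3) inner_commute[of a b]
      by (auto simp: orthogonal_def w_def inner_diff_left inner_add_left)
  qed
  then show ?thesis unfolding w_def orthogonal_def by simp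
qed

text \<open>
  A point of the rectangle strictly below or above the graph has a neighbourhood inside \<open>S\<close> or
  inside the complement of \<open>S\<close>, hence is no frontier point.
\<close>

lemma frontier_locally_graph:
  fixes S :: "(real^2) set"
  assumes box: "\<And>x. \<bar>(x - p) \<bullet> a\<bar> < r \<and> \<bar>(x - p) \<bullet> b\<bar> < h \<Longrightarrow>
            (x \<in> S \<longleftrightarrow> (x - p) \<bullet> b < \<gamma> ((x - p) \<bullet> a))"
    and cont: "continuous_on UNIV (\<gamma> :: real \<Rightarrow> real)"
    and x: "x \<in> frontier S" "\<bar>(x - p) \<bullet> a\<bar> < r" "\<bar>(x - p) \<bullet> b\<bar> < h"
  shows "(x - p) \<bullet> b = \<gamma> ((x - p) \<bullet> a)"
proof (rule ccontr)
  define W where "W = {y. \<bar>(y - p) \<bullet> a\<bar> < r \<and> \<bar>(y - p) \<bullet> b\<bar> < h}"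
  have \<gamma>: "continuous_on UNIV (\<lambda>y. \<gamma> ((y - p) \<bullet> a))"
    by (rule continuous_on_compose2[OF cont]) (auto intro!: continuous_intros)
  have "open W" unfolding W_def
    by (intro open_Collect_conj open_Collect_less continuous_intros)
  then have below: "open (W \<inter> {y. (y - p) \<bullet> b < \<gamma> ((y - p) \<bullet> a)})"
    and above: "open (W \<inter> {y. \<gamma> ((y - p) \<bullet> a) < (y - p) \<bullet> b})"
    by (intro open_Int open_Collect_less \<gamma> continuous_intros; assumption)+
  assume "(x - p) \<bullet> b \<noteq> \<gamma> ((x - p) \<bullet> a)"
  then consider "(x - p) \<bullet> b < \<gamma> ((x - p) \<bullet> a)" | "\<gamma> ((x - p) \<bullet> a) < (x - p) \<bullet> b" by linarith
  then show False
  proof cases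
    case 1
    have "W \<inter> {y. (y - p) \<bullet> b < \<gamma> ((y - p) \<bullet> a)} \<subseteq> S" using box unfolding W_def by blast
    then have "x \<in> interior S" using below 1 x unfolding W_def by (intro interiorI[of "W \<inter> {y. (y - p) \<bullet> b < \<gamma> ((y - p) \<bullet> a)}"]) (auto simp: W_def)
    then show False using x by (simp add: frontier_def)
  next
    case 2
    have "W \<inter> {y. \<gamma> ((y - p) \<bullet> a) < (y - p) \<bullet> b} \<subseteq> - S" using box unfolding W_def by force
    then have "x \<in> interior (- S)" using above 2 x by (intro interiorI[of "W \<inter> {y. \<gamma> ((y - p) \<bullet> a) < (y - p) \<bullet> b}"]) (auto simp: W_def)
    then show False using x by (simp add: frontier_def interior_complement)
  qed
qed

text \<open>
  Compactness leaves finitely many rectangles, and in each of them the frontier lies on a Lipschitz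
  curve. With this, bounded Borel functions are integrable over the mesh skeleton.
\<close>

lemma lipschitz_boundary_finite_length:
  assumes "lipschitz_boundary S" "bounded S"
  shows "emeasure hausdorff1 (frontier S) < \<infinity>"
proof -
  have "\<exists>V. open V \<and> p \<in> V \<and> emeasure hausdorff1 (frontier S \<inter> V) < \<infinity>" if "p \<in> frontier S" for p
  proof -
    note p = that
    obtain a b r h L \<gamma> where ab: "norm a = 1" "norm b = 1" "a \<bullet> b = 0" and rh: "r > 0" "h > 0"
      and \<gamma>: "L-lipschitz_on (UNIV :: real set) (\<gamma> :: real \<Rightarrow> real)"
      and box: "\<forall>x. \<bar>(x - p) \<bullet> a\<bar> < r \<and> \<bar>(x - p) \<bullet> b\<bar> < h \<longrightarrow>
            (x \<in> S \<longleftrightarrow> (x - p) \<bullet> b < \<gamma> ((x - p) \<bullet> a))"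
      using bspec[OF assms(1)[unfolded lipschitz_boundary_def] p] by (elim exE conjE) (rule that)
    define V where "V = {y. \<bar>(y - p) \<bullet> a\<bar> < r \<and> \<bar>(y - p) \<bullet> b\<bar> < h}"
    have V: "open V" "p \<in> V" unfolding V_def using rh
      by (auto intro!: open_Collect_conj open_Collect_less continuous_intros)
    define f where "f u = p + u *\<^sub>R a + \<gamma> u *\<^sub>R b" for u
    have lip: "(1 + L)-lipschitz_on {-r..r} f"
    proof (rule lipschitz_onI)
      fix u v :: real
      have "dist (f u) (f v) = norm ((u - v) *\<^sub>R a + (\<gamma> u - \<gamma> v) *\<^sub>R b)"
        unfolding f_def dist_norm by (simp add: algebra_simps)
      also have "\<dots> \<le> \<bar>u - v\<bar> + \<bar>\<gamma> u - \<gamma> v\<bar>"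
        by (rule order_trans[OF norm_triangle_ineq]) (simp add: ab)
      also have "\<bar>\<gamma> u - \<gamma> v\<bar> \<le> L * \<bar>u - v\<bar>"
        using lipschitz_onD[OF \<gamma>, of u v] by (simp add: dist_real_def)
      finally show "dist (f u) (f v) \<le> (1 + L) * dist u v"
        by (simp add: dist_real_def algebra_simps)
    qed (use lipschitz_on_nonneg[OF \<gamma>] in simp)
    have "frontier S \<inter> V \<subseteq> f ` {-r..r}"
    proof
      fix x assume "x \<in> frontier S \<inter> V"
      then have x: "x \<in> frontier S" "\<bar>(x - p) \<bullet> a\<bar> < r" "\<bar>(x - p) \<bullet> b\<bar> < h" unfolding V_def by auto
      have "(x - p) \<bullet> b = \<gamma> ((x - p) \<bullet> a)"
        by (rule frontier_locally_graph[OF box[rule_format] lipschitz_on_continuous_on[OF \<gamma>] x])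
      moreover have "x = p + (((x - p) \<bullet> a) *\<^sub>R a + ((x - p) \<bullet> b) *\<^sub>R b)"
        using orthonormal_expansion_plane[OF ab, of "x - p"] by (simp add: algebra_simps)
      ultimately have "x = f ((x - p) \<bullet> a)" unfolding f_def by (simp add: add.assoc)
      then show "x \<in> f ` {-r..r}" using x(2) by (intro image_eqI[of _ _ "(x - p) \<bullet> a"]) auto
    qed
    then have "emeasure hausdorff1 (frontier S \<inter> V) \<le> hausdorff1_outer (f ` {-r..r})"
      by (intro order_trans[OF emeasure_hausdorff1_le_outer hausdorff1_outer_mono])
    also have "\<dots> \<le> ennreal ((1 + L) * (r - - r))"
      using rh by (intro hausdorff1_outer_lipschitz_curve lip) auto
    also have "\<dots> < \<infinity>" by simp
    finally show ?thesis using V by (intro exI[of _ V]) simp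
  qed
  then obtain V where V: "\<And>p. p \<in> frontier S \<Longrightarrow>
      open (V p) \<and> p \<in> V p \<and> emeasure hausdorff1 (frontier S \<inter> V p) < \<infinity>" by metis
  have "compact (frontier S)" using assms(2) by (rule compact_frontier_bounded)
  then obtain T where T: "T \<subseteq> frontier S" "finite T" "frontier S \<subseteq> (\<Union>p\<in>T. V p)"
    using V by (elim compactE_image[of "frontier S" "frontier S" V]) auto
  have "emeasure hausdorff1 (frontier S) = emeasure hausdorff1 (\<Union>p\<in>T. frontier S \<inter> V p)"
    using T by (intro arg_cong[of _ _ "emeasure hausdorff1"]) auto
  also have "\<dots> \<le> (\<Sum>p\<in>T. emeasure hausdorff1 (frontier S \<inter> V p))"
  proof (rule emeasure_subadditive_finite[OF T(2)], clarify)
    fix p assume "p \<in> T"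
    then show "frontier S \<inter> V p \<in> sets hausdorff1"
      using T(1) V[of p] by (simp add: subset_iff borel_open borel_closed sets.Int)
  qed
  also have "\<dots> < \<infinity>" using T V by (auto simp: less_top subset_iff)
  finally show ?thesis .
qed

section \<open>Measurability of the outer normal\<close>

text \<open>
  If \<open>n \<noteq> m\<close>, the direction \<open>m - n\<close> points strictly into \<open>S\<close> according to \<open>n\<close> and strictly out of
  \<open>S\<close> according to \<open>m\<close>.
\<close>

lemma is_outer_normal_unique:
  assumes "is_outer_normal S x n" "is_outer_normal S x m"
  shows "n = m"
proof (rule ccontr)
  assume ne: "n \<noteq> m"
  have n1: "norm n = 1" "norm m = 1" using assms unfolding is_outer_normal_def by auto
  define d where "d = m - n"
  have nn: "n \<bullet> n = 1" "m \<bullet> m = 1" using n1 by (simp_all add: norm_eq_1)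
  have "d \<bullet> d > 0" using ne unfolding d_def by simp
  moreover have "d \<bullet> d = 2 * (1 - n \<bullet> m)"
    unfolding d_def using nn by (simp add: inner_diff_left inner_diff_right inner_commute)
  ultimately have c: "n \<bullet> m < 1" by simp
  have dn: "norm d > 0" using ne unfolding d_def by simp
  \<comment> \<open>Along \<open>d\<close> both normal slopes have modulus \<open>1 - n \<bullet> m\<close>; half of it is a tolerance that both exceed.\<close>
  define \<epsilon> where "\<epsilon> = (1 - n \<bullet> m) / (2 * norm d)"
  have \<epsilon>: "\<epsilon> > 0" using c dn unfolding \<epsilon>_def by simp
  obtain r1 where r1: "r1 > 0" "\<And>y. dist y x < r1 \<Longrightarrow> n \<bullet> (y - x) < - \<epsilon> * norm (y - x) \<Longrightarrow> y \<in> S"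
    using assms(1) \<epsilon> unfolding is_outer_normal_def by meson
  obtain r2 where r2: "r2 > 0" "\<And>y. dist y x < r2 \<Longrightarrow> m \<bullet> (y - x) > \<epsilon> * norm (y - x) \<Longrightarrow> y \<notin> S"
    using assms(2) \<epsilon> unfolding is_outer_normal_def by meson
  define t where "t = min r1 r2 / (2 * norm d)"
  have t: "t > 0" using r1 r2 dn unfolding t_def by simp
  define y where "y = x + t *\<^sub>R d"
  have nt: "norm (t *\<^sub>R d) = min r1 r2 / 2" using t dn r1(1) r2(1) unfolding t_def by simp
  have dy: "dist y x < r1" "dist y x < r2"
    using nt r1(1) r2(1) by (simp_all add: y_def dist_norm) 
  have e: "\<epsilon> * norm (t *\<^sub>R d) = t * ((1 - n \<bullet> m) / 2)" using t dn unfolding \<epsilon>_def by simp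
  have "n \<bullet> (t *\<^sub>R d) = - (t * (1 - n \<bullet> m))" "m \<bullet> (t *\<^sub>R d) = t * (1 - n \<bullet> m)"
    unfolding d_def using nn by (simp_all add: inner_diff_right inner_commute algebra_simps)
  moreover have "t * ((1 - n \<bullet> m) / 2) < t * (1 - n \<bullet> m)" using t c by simp
  ultimately have "n \<bullet> (y - x) < - \<epsilon> * norm (y - x)" "m \<bullet> (y - x) > \<epsilon> * norm (y - x)"
    using e unfolding y_def by (simp_all only: add_diff_cancel_left' mult_minus_left)
  then show False using r1(2) r2(2) dy by blast
qed

text \<open>
  The condition in \<open>is_outer_normal\<close> for one tolerance and one radius, as a set of pairs with the
  direction first, so that limits and projections along the direction can be taken.
\<close>

definition cone_test :: "(real^2) set \<Rightarrow> real \<Rightarrow> real \<Rightarrow> ((real^2) \<times> (real^2)) set" where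
  "cone_test S \<epsilon> r = {(n, x). \<forall>y. dist y x < r \<longrightarrow>
       (n \<bullet> (y - x) < - \<epsilon> * norm (y - x) \<longrightarrow> y \<in> S) \<and>
       (n \<bullet> (y - x) > \<epsilon> * norm (y - x) \<longrightarrow> y \<notin> S)}"

text \<open>
  A violation of the test is witnessed by one \<open>y\<close> and strict inequalities that are continuous in the
  direction and the point. So violations form an open set.
\<close>

lemma closed_cone_test: "closed (cone_test S \<epsilon> r)"
proof -
  have "cone_test S \<epsilon> r = 
    (\<Inter>y\<in>-S. - {p. dist y (snd p) < r \<and> fst p \<bullet> (y - snd p) < - \<epsilon> * norm (y - snd p)}) \<inter>
    (\<Inter>y\<in>S. - {p. dist y (snd p) < r \<and> fst p \<bullet> (y - snd p) > \<epsilon> * norm (y - snd p)})"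
    unfolding cone_test_def by fastforce
  moreover have "closed \<dots>"
    by (intro closed_Int closed_INT ballI closed_Compl open_Collect_conj open_Collect_less continuous_intros)
  ultimately show ?thesis by simp
qed

text \<open>
  Turning the direction from \<open>n'\<close> to \<open>n\<close> changes its product with \<open>y - x\<close> by at most
  \<open>norm (n - n') * norm (y - x)\<close>, which the larger tolerance absorbs.
\<close>

lemma cone_test_weaken:
  assumes "(n', x) \<in> cone_test S \<epsilon>' r'" "\<epsilon>' + norm (n - n') \<le> \<epsilon>" "r \<le> r'"
  shows "(n, x) \<in> cone_test S \<epsilon> r"
  unfolding cone_test_def
proof (clarify)
  fix y assume y: "dist y x < r"
  have "\<bar>(n - n') \<bullet> (y - x)\<bar> \<le> norm (n - n') * norm (y - x)" by (rule Cauchy_Schwarz_ineq2)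
  also have "\<dots> \<le> (\<epsilon> - \<epsilon>') * norm (y - x)" using assms(2) by (intro mult_right_mono) auto
  finally have *: "\<bar>n \<bullet> (y - x) - n' \<bullet> (y - x)\<bar> \<le> \<epsilon> * norm (y - x) - \<epsilon>' * norm (y - x)"
    by (simp add: inner_diff_left left_diff_distrib)
  have y': "dist y x < r'" using y assms(3) by simp
  have c: "n' \<bullet> (y - x) < - \<epsilon>' * norm (y - x) \<Longrightarrow> y \<in> S"
    "n' \<bullet> (y - x) > \<epsilon>' * norm (y - x) \<Longrightarrow> y \<notin> S"
    using assms(1) y' unfolding cone_test_def by auto
  show "(n \<bullet> (y - x) < - \<epsilon> * norm (y - x) \<longrightarrow> y \<in> S) \<and> (n \<bullet> (y - x) > \<epsilon> * norm (y - x) \<longrightarrow> y \<notin> S)"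
  proof (intro conjI impI)
    assume "n \<bullet> (y - x) < - \<epsilon> * norm (y - x)"
    then have "n' \<bullet> (y - x) < - \<epsilon>' * norm (y - x)" using * by linarith
    then show "y \<in> S" by (rule c)
  next
    assume "n \<bullet> (y - x) > \<epsilon> * norm (y - x)"
    then have "n' \<bullet> (y - x) > \<epsilon>' * norm (y - x)" using * by linarith
    then show "y \<notin> S" by (rule c)
  qed
qed

lemma is_outer_normal_iff_cone_test:
  "is_outer_normal S x n \<longleftrightarrow> norm n = 1 \<and> (\<forall>\<epsilon>>0. \<exists>r>0. (n, x) \<in> cone_test S \<epsilon> r)"
  unfolding is_outer_normal_def cone_test_def by simp

text \<open>
  The right-hand side allows a different direction for each tolerance. By compactness of the circle
  these directions accumulate at some \<open>l\<close>, and \<open>l\<close> passes every test with a slightly larger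
  tolerance. The gain is that only countable quantifiers now stand outside a condition which is closed
  in \<open>x\<close>.
\<close>

lemma ex_outer_normal_in_closed_iff:
  assumes "closed F"
  shows "(\<exists>n\<in>F. is_outer_normal S x n) \<longleftrightarrow>
    (\<forall>k. \<exists>j. \<exists>n. n \<in> F \<inter> sphere 0 1 \<and> (n, x) \<in> cone_test S (1 / real (Suc k)) (1 / real (Suc j)))"
  (is "?l \<longleftrightarrow> ?r")
proof
  assume ?l
  then obtain n where n: "n \<in> F" "is_outer_normal S x n" by blast
  show ?r
  proof
    fix k
    obtain r where r: "r > 0" "(n, x) \<in> cone_test S (1 / real (Suc k)) r"
      using n(2) unfolding is_outer_normal_iff_cone_test by (metis divide_pos_pos of_nat_0_less_iff zero_less_Suc zero_less_one)
    obtain j where j: "1 / real (Suc j) < r" using r(1) nat_approx_posE by blast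
    have "(n, x) \<in> cone_test S (1 / real (Suc k)) (1 / real (Suc j))"
      by (rule cone_test_weaken[OF r(2)]) (use j in auto)
    then show "\<exists>j. \<exists>n. n \<in> F \<inter> sphere 0 1 \<and> (n, x) \<in> cone_test S (1 / real (Suc k)) (1 / real (Suc j))"
      using n unfolding is_outer_normal_def by (intro exI[of _ j] exI[of _ n]) (auto)
  qed
next
  assume ?r
  then obtain j n where n: "\<And>k. n k \<in> F \<inter> sphere 0 1"
    "\<And>k. (n k, x) \<in> cone_test S (1 / real (Suc k)) (1 / real (Suc (j k)))" by metis
  have "compact (F \<inter> sphere 0 1)" using assms by (simp add: closed_Int_compact)
  then obtain l \<sigma> where l: "l \<in> F \<inter> sphere 0 1" "strict_mono (\<sigma> :: nat \<Rightarrow> nat)" "(n \<circ> \<sigma>) \<longlonglongrightarrow> l"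
    using n(1) unfolding compact_def by metis
  have "is_outer_normal S x l"
    unfolding is_outer_normal_iff_cone_test
  proof (intro conjI allI impI)
    show "norm l = 1" using l by simp
    fix \<epsilon> :: real assume \<epsilon>: "\<epsilon> > 0"
    have ev: "\<forall>\<^sub>F i in sequentially. dist ((n \<circ> \<sigma>) i) l < \<epsilon> / 2"
      using tendstoD[OF l(3), of "\<epsilon> / 2"] \<epsilon> by simp
    obtain k where k: "1 / real (Suc k) < \<epsilon> / 2" using \<epsilon> nat_approx_posE[of "\<epsilon>/2"] by auto
    have "\<forall>\<^sub>F i in sequentially. dist ((n \<circ> \<sigma>) i) l < \<epsilon> / 2 \<and> i \<ge> k"
      by (intro eventually_conj ev eventually_ge_at_top)
    then obtain i where "dist ((n \<circ> \<sigma>) i) l < \<epsilon> / 2 \<and> i \<ge> k"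
      using eventually_happens'[OF sequentially_bot] by blast
    then have i: "dist (n (\<sigma> i)) l < \<epsilon> / 2" "i \<ge> k" by simp_all
    have "\<sigma> i \<ge> k" using i(2) seq_suble[OF l(2), of i] by linarith
    then have "1 / real (Suc (\<sigma> i)) \<le> 1 / real (Suc k)" by (simp add: frac_le)
    then have "(l, x) \<in> cone_test S \<epsilon> (1 / real (Suc (j (\<sigma> i))))"
      using i(1) k by (intro cone_test_weaken[OF n(2)[of "\<sigma> i"]]) (auto simp: dist_norm norm_minus_commute)
    then show "\<exists>r>0. (l, x) \<in> cone_test S \<epsilon> r"
      by (intro exI[of _ "1 / real (Suc (j (\<sigma> i)))"]) simp
  qed
  then show ?l using l by blast
qed

lemma outer_normal_in_borel:
  assumes "closed F"
  shows "{x. \<exists>n\<in>F. is_outer_normal S x n} \<in> sets borel"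
proof -
  have "{x. \<exists>n\<in>F. is_outer_normal S x n} =
    (\<Inter>k. \<Union>j. {x. \<exists>n. n \<in> F \<inter> sphere 0 1 \<and> (n, x) \<in> cone_test S (1 / real (Suc k)) (1 / real (Suc j))})"
    unfolding ex_outer_normal_in_closed_iff[OF assms] by blast
  also have "\<dots> \<in> sets borel"
    by (intro sets.countable_INT'' sets.countable_UN image_subsetI borel_closed
        closed_compact_projection closed_cone_test closed_Int_compact assms compact_sphere) simp_all
  finally show ?thesis .
qed

lemma outer_normal_eq: "is_outer_normal S x n \<Longrightarrow> outer_normal S x = n"
  unfolding outer_normal_def by (blast intro: is_outer_normal_unique)

lemma outer_normal_undefined:
  "\<not> (\<exists>n. is_outer_normal S x n) \<Longrightarrow> outer_normal S x = (THE n. False)"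
  unfolding outer_normal_def by (intro arg_cong[of _ _ The]) auto

text \<open>
  Without measurable normals the Bochner integrals in the forms could jump to the default value
  0 as the directions vary. At points without a normal, \<open>outer_normal\<close> takes one fixed default
  value, so these points add at most one Borel set to each preimage.
\<close>

lemma borel_measurable_outer_normal [measurable]: "outer_normal S \<in> borel_measurable borel"
proof (rule borel_measurableI)
  fix G :: "(real^2) set" assume "open G"
  then have cl: "closed (- G)" by (rule closed_Compl)
  let ?D = "{x. \<exists>n\<in>UNIV. is_outer_normal S x n}"
  let ?B = "{x. \<exists>n\<in>- G. is_outer_normal S x n}"
  have eq: "outer_normal S x = (THE n. False)" if "x \<notin> ?D" for x
    using that by (intro outer_normal_undefined) simp
  have "outer_normal S -` G = (?D - ?B) \<union> (if (THE n. False) \<in> G then - ?D else {})" (is "?l = ?r")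
  proof (rule set_eqI)
    fix x
    show "x \<in> ?l \<longleftrightarrow> x \<in> ?r"
    proof (cases "x \<in> ?D")
      case True
      then obtain n where n: "is_outer_normal S x n" by blast
      then have on: "outer_normal S x = n" by (rule outer_normal_eq)
      have "x \<in> ?B \<longleftrightarrow> n \<notin> G" using n is_outer_normal_unique[OF n] by blast
      then show ?thesis using on True by simp
    next
      case False
      then show ?thesis using eq[OF False] by simp
    qed
  qed
  moreover have "?D \<in> sets borel" "?B \<in> sets borel"
    using outer_normal_in_borel[OF closed_UNIV] outer_normal_in_borel[OF cl] by auto
  ultimately show "outer_normal S -` G \<inter> space borel \<in> sets borel" by auto
qed

lemma bounded_range_outer_normal: "bounded (range (outer_normal S))"
proof -
  have "norm (outer_normal S x) \<le> max 1 (norm (THE n :: real^2. False))" for x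
  proof (cases "\<exists>n. is_outer_normal S x n")
    case True
    then obtain n where "is_outer_normal S x n" by blast
    then show ?thesis using outer_normal_eq[of S x n] by (simp add: is_outer_normal_def)
  next
    case False
    then show ?thesis using outer_normal_undefined[of S x] by simp
  qed
  then show ?thesis unfolding bounded_iff by blast
qed

section \<open>Lipschitz dependence on parameters\<close>

text \<open>
  \<open>\<Phi> t x = O(\<omega> t)\<close> uniformly in \<open>x\<close>. Uniform boundedness is the case \<open>\<omega> = 1\<close>; Lipschitz continuity in
  the parameter is the case where the parameter is a pair, \<open>\<omega>\<close> its distance and \<open>\<Phi>\<close> an increment.
\<close>

definition dominated ::
  "'a set \<Rightarrow> 'b set \<Rightarrow> ('a \<Rightarrow> real) \<Rightarrow> ('a \<Rightarrow> 'b \<Rightarrow> 'c::real_normed_vector) \<Rightarrow> bool" where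
  "dominated T X \<omega> \<Phi> \<longleftrightarrow> (\<exists>C\<ge>0. \<forall>t\<in>T. \<forall>x\<in>X. norm (\<Phi> t x) \<le> C * \<omega> t)"

lemma dominatedI:
  assumes "\<And>t x. t \<in> T \<Longrightarrow> x \<in> X \<Longrightarrow> norm (\<Phi> t x) \<le> C * \<omega> t" "C \<ge> 0"
  shows "dominated T X \<omega> \<Phi>"
  using assms unfolding dominated_def by blast

lemma dominatedE:
  assumes "dominated T X \<omega> \<Phi>"
  obtains C where "C \<ge> 0" "\<And>t x. t \<in> T \<Longrightarrow> x \<in> X \<Longrightarrow> norm (\<Phi> t x) \<le> C * \<omega> t"
  using assms unfolding dominated_def by blast

lemma dominated_cong:
  assumes "\<And>t x. t \<in> T \<Longrightarrow> x \<in> X \<Longrightarrow> \<Phi> t x = \<Psi> t x"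
  shows "dominated T X \<omega> \<Phi> \<longleftrightarrow> dominated T X \<omega> \<Psi>"
  using assms unfolding dominated_def by simp

lemma dominated_zero: "dominated T X \<omega> (\<lambda>t x. 0)"
  by (rule dominatedI[where C = 0]) auto

lemma dominated_add:
  assumes "dominated T X \<omega> \<Phi>" "dominated T X \<omega> \<Psi>"
  shows "dominated T X \<omega> (\<lambda>t x. \<Phi> t x + \<Psi> t x)"
proof -
  obtain C where C: "C \<ge> 0" "\<And>t x. t \<in> T \<Longrightarrow> x \<in> X \<Longrightarrow> norm (\<Phi> t x) \<le> C * \<omega> t"
    using assms(1) by (rule dominatedE) blast
  obtain E where E: "E \<ge> 0" "\<And>t x. t \<in> T \<Longrightarrow> x \<in> X \<Longrightarrow> norm (\<Psi> t x) \<le> E * \<omega> t"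
    using assms(2) by (rule dominatedE) blast
  show ?thesis
  proof (rule dominatedI[where C = "C + E"])
    fix t x assume "t \<in> T" "x \<in> X"
    then show "norm (\<Phi> t x + \<Psi> t x) \<le> (C + E) * \<omega> t"
      using norm_triangle_ineq[of "\<Phi> t x" "\<Psi> t x"] C(2)[of t x] E(2)[of t x]
      by (simp add: distrib_right)
  qed (use C E in simp)
qed

lemma dominated_uminus: "dominated T X \<omega> \<Phi> \<Longrightarrow> dominated T X \<omega> (\<lambda>t x. - \<Phi> t x)"
  unfolding dominated_def by simp

lemma dominated_diff:
  assumes "dominated T X \<omega> \<Phi>" "dominated T X \<omega> \<Psi>"
  shows "dominated T X \<omega> (\<lambda>t x. \<Phi> t x - \<Psi> t x)"
  using dominated_add[OF assms(1) dominated_uminus[OF assms(2)]] by simp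

lemma dominated_sum:
  assumes "\<And>i. i \<in> I \<Longrightarrow> dominated T X \<omega> (\<Phi> i)"
  shows "dominated T X \<omega> (\<lambda>t x. \<Sum>i\<in>I. \<Phi> i t x)"
  using assms
  by (induction I rule: infinite_finite_induct) (auto intro: dominated_zero dominated_add)

lemma dominated_mult:
  fixes \<Phi> \<Psi> :: "'a \<Rightarrow> 'b \<Rightarrow> 'c::real_normed_algebra"
  assumes "dominated T X \<omega>1 \<Phi>" "dominated T X \<omega>2 \<Psi>"
    and "\<And>t. t \<in> T \<Longrightarrow> \<omega> t = \<omega>1 t * \<omega>2 t"
  shows "dominated T X \<omega> (\<lambda>t x. \<Phi> t x * \<Psi> t x)"
proof -
  obtain C where C: "C \<ge> 0" "\<And>t x. t \<in> T \<Longrightarrow> x \<in> X \<Longrightarrow> norm (\<Phi> t x) \<le> C * \<omega>1 t"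
    using assms(1) by (rule dominatedE) blast
  obtain E where E: "E \<ge> 0" "\<And>t x. t \<in> T \<Longrightarrow> x \<in> X \<Longrightarrow> norm (\<Psi> t x) \<le> E * \<omega>2 t"
    using assms(2) by (rule dominatedE) blast
  show ?thesis
  proof (rule dominatedI[where C = "C * E"])
    fix t x assume tx: "t \<in> T" "x \<in> X"
    have "norm (\<Phi> t x * \<Psi> t x) \<le> norm (\<Phi> t x) * norm (\<Psi> t x)" by (rule norm_mult_ineq)
    also have "\<dots> \<le> (C * \<omega>1 t) * (E * \<omega>2 t)"
      using C(2)[OF tx] E(2)[OF tx] by (intro mult_mono') auto
    finally show "norm (\<Phi> t x * \<Psi> t x) \<le> (C * E) * \<omega> t"
      using assms(3)[OF tx(1)] by (simp add: mult_ac)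
  qed (use C E in simp)
qed

lemma dominated_const:
  assumes "\<And>x. x \<in> X \<Longrightarrow> norm (f x) \<le> B"
  shows "dominated T X (\<lambda>_. 1) (\<lambda>t x. f x)"
  using assms by (intro dominatedI[where C = "max B 0"]) (auto simp: le_max_iff_disj)

lemma dominated_cnj: "dominated T X \<omega> \<Phi> \<Longrightarrow> dominated T X \<omega> (\<lambda>t x. cnj (\<Phi> t x))"
  unfolding dominated_def by simp

text \<open>
  If the product is not integrable, its integral is 0 and the bound is trivial.
\<close>

lemma norm_set_integral_mult_le:
  fixes g \<Psi> :: "'b \<Rightarrow> complex"
  assumes "set_integrable M S g" "\<And>x. x \<in> S \<Longrightarrow> norm (\<Psi> x) \<le> b" "b \<ge> 0"
  shows "norm (LINT x:S|M. g x * \<Psi> x) \<le> b * (LINT x:S|M. norm (g x))"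
proof -
  have int: "integrable M (\<lambda>x. b * (indicat_real S x *\<^sub>R norm (g x)))"
    using integrable_norm[OF assms(1)[unfolded set_integrable_def]]
    by (intro integrable_mult_right) (simp add: abs_mult)
  have nn: "0 \<le> (LINT x|M. b * (indicat_real S x *\<^sub>R norm (g x)))"
    using assms(3) by (intro Bochner_Integration.integral_nonneg) auto
  have "norm (LINT x|M. indicat_real S x *\<^sub>R (g x * \<Psi> x)) \<le> (LINT x|M. b * (indicat_real S x *\<^sub>R norm (g x)))"
  proof (cases "integrable M (\<lambda>x. indicat_real S x *\<^sub>R (g x * \<Psi> x))")
    case True
    have "norm (LINT x|M. indicat_real S x *\<^sub>R (g x * \<Psi> x)) \<le> (LINT x|M. norm (indicat_real S x *\<^sub>R (g x * \<Psi> x)))"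
      by (rule integral_norm_bound)
    also have "\<dots> \<le> (LINT x|M. b * (indicat_real S x *\<^sub>R norm (g x)))"
    proof (rule Bochner_Integration.integral_mono[OF integrable_norm[OF True] int])
      fix x
      show "norm (indicat_real S x *\<^sub>R (g x * \<Psi> x)) \<le> b * (indicat_real S x *\<^sub>R norm (g x))"
        using mult_right_mono[OF assms(2)[of x], of "norm (g x)"]
        by (cases "x \<in> S") (auto simp: norm_mult mult.commute)
    qed
    finally show ?thesis .
  qed (use nn in \<open>simp add: not_integrable_integral_eq\<close>)
  then show ?thesis by (simp add: set_lebesgue_integral_def)
qed

lemma dominated_integral:
  fixes \<Phi> :: "'a \<Rightarrow> 'b \<Rightarrow> complex"
  assumes "dominated T X \<omega> \<Phi>" "set_integrable M S g" "S \<subseteq> X" "\<And>t. t \<in> T \<Longrightarrow> \<omega> t \<ge> 0"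
  shows "dominated T Y \<omega> (\<lambda>t _. LINT x:S|M. g x * \<Phi> t x)"
proof -
  obtain C where C: "C \<ge> 0" "\<And>t x. t \<in> T \<Longrightarrow> x \<in> X \<Longrightarrow> norm (\<Phi> t x) \<le> C * \<omega> t"
    using assms(1) by (rule dominatedE) blast
  have nn: "(LINT x:S|M. norm (g x)) \<ge> 0"
    unfolding set_lebesgue_integral_def by (intro Bochner_Integration.integral_nonneg) auto
  show ?thesis
  proof (rule dominatedI[where C = "C * (LINT x:S|M. norm (g x))"])
    fix t y assume t: "t \<in> T"
    have "norm (LINT x:S|M. g x * \<Phi> t x) \<le> (C * \<omega> t) * (LINT x:S|M. norm (g x))"
      using C t assms(3,4) by (intro norm_set_integral_mult_le[OF assms(2)]) auto
    then show "norm (LINT x:S|M. g x * \<Phi> t x) \<le> C * (LINT x:S|M. norm (g x)) * \<omega> t"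
      by (simp add: mult_ac)
  qed (use C nn in simp)
qed

text \<open>
  Functions on space depending on a parameter: Borel, bounded, and Lipschitz in the parameter with
  a constant uniform in space. The class is closed under the operations that build the PWDG
  integrands from plane waves, and under integration over sets of finite length.
\<close>

definition lip_family ::
  "('a::metric_space) set \<Rightarrow> ('b::topological_space) set \<Rightarrow> ('a \<Rightarrow> 'b \<Rightarrow> complex) \<Rightarrow> bool" where
  "lip_family T X \<Phi> \<longleftrightarrow> (\<forall>t\<in>T. \<Phi> t \<in> borel_measurable borel) \<and>
     dominated T X (\<lambda>_. 1) \<Phi> \<and>
     dominated (T \<times> T) X (\<lambda>p. dist (fst p) (snd p)) (\<lambda>p x. \<Phi> (fst p) x - \<Phi> (snd p) x)"

lemma lip_familyI:
  assumes "\<And>t. t \<in> T \<Longrightarrow> \<Phi> t \<in> borel_measurable borel"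
    and "dominated T X (\<lambda>_. 1) \<Phi>"
    and "dominated (T \<times> T) X (\<lambda>p. dist (fst p) (snd p)) (\<lambda>p x. \<Phi> (fst p) x - \<Phi> (snd p) x)"
  shows "lip_family T X \<Phi>"
  using assms unfolding lip_family_def by blast

lemma lip_family_measurable: "lip_family T X \<Phi> \<Longrightarrow> t \<in> T \<Longrightarrow> \<Phi> t \<in> borel_measurable borel"
  unfolding lip_family_def by blast

lemma lip_family_bounded: "lip_family T X \<Phi> \<Longrightarrow> dominated T X (\<lambda>_. 1) \<Phi>"
  unfolding lip_family_def by blast

lemma lip_family_increment:
  "lip_family T X \<Phi> \<Longrightarrow>
    dominated (T \<times> T) X (\<lambda>p. dist (fst p) (snd p)) (\<lambda>p x. \<Phi> (fst p) x - \<Phi> (snd p) x)"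
  unfolding lip_family_def by blast

lemma dominated_fst: "dominated T X (\<lambda>_. 1) \<Phi> \<Longrightarrow> dominated (T \<times> T) X (\<lambda>_. 1) (\<lambda>p x. \<Phi> (fst p) x)"
  and dominated_snd: "dominated T X (\<lambda>_. 1) \<Phi> \<Longrightarrow> dominated (T \<times> T) X (\<lambda>_. 1) (\<lambda>p x. \<Phi> (snd p) x)"
  unfolding dominated_def by auto

lemma lip_family_const:
  assumes "f \<in> borel_measurable borel" "\<And>x. x \<in> X \<Longrightarrow> norm (f x) \<le> B"
  shows "lip_family T X (\<lambda>t x. f x)"
  using assms by (intro lip_familyI dominated_const) (auto intro: dominated_zero)

lemma lip_family_scalar: "lip_family T X (\<lambda>t x. c)"
  by (rule lip_family_const[where B = "norm c"]) auto

lemma lip_family_add: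
  assumes "lip_family T X \<Phi>" "lip_family T X \<Psi>"
  shows "lip_family T X (\<lambda>t x. \<Phi> t x + \<Psi> t x)"
proof (intro lip_familyI)
  show "dominated (T \<times> T) X (\<lambda>p. dist (fst p) (snd p))
     (\<lambda>p x. \<Phi> (fst p) x + \<Psi> (fst p) x - (\<Phi> (snd p) x + \<Psi> (snd p) x))"
    using dominated_add[OF assms[THEN lip_family_increment]] by (simp add: algebra_simps)
qed (use assms in \<open>auto intro!: borel_measurable_add dominated_add
        intro: lip_family_measurable lip_family_bounded\<close>)

lemma lip_family_mult:
  assumes "lip_family T X \<Phi>" "lip_family T X \<Psi>"
  shows "lip_family T X (\<lambda>t x. \<Phi> t x * \<Psi> t x)"
proof (intro lip_familyI)
  show "dominated T X (\<lambda>_. 1) (\<lambda>t x. \<Phi> t x * \<Psi> t x)"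
    by (rule dominated_mult[OF assms[THEN lip_family_bounded]]) simp
  have "dominated (T \<times> T) X (\<lambda>p. dist (fst p) (snd p))
      (\<lambda>p x. \<Phi> (fst p) x * (\<Psi> (fst p) x - \<Psi> (snd p) x) + (\<Phi> (fst p) x - \<Phi> (snd p) x) * \<Psi> (snd p) x)"
    by (intro dominated_add dominated_mult[OF dominated_fst[OF lip_family_bounded[OF assms(1)]] lip_family_increment[OF assms(2)]]
        dominated_mult[OF lip_family_increment[OF assms(1)] dominated_snd[OF lip_family_bounded[OF assms(2)]]]) auto
  then show "dominated (T \<times> T) X (\<lambda>p. dist (fst p) (snd p))
     (\<lambda>p x. \<Phi> (fst p) x * \<Psi> (fst p) x - \<Phi> (snd p) x * \<Psi> (snd p) x)"
    by (simp add: algebra_simps)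
qed (use assms in \<open>auto intro!: borel_measurable_times intro: lip_family_measurable\<close>)

lemma lip_family_uminus: "lip_family T X \<Phi> \<Longrightarrow> lip_family T X (\<lambda>t x. - \<Phi> t x)"
  using lip_family_mult[OF lip_family_scalar[of T X "-1"], of \<Phi>] by simp

lemma lip_family_diff:
  "lip_family T X \<Phi> \<Longrightarrow> lip_family T X \<Psi> \<Longrightarrow> lip_family T X (\<lambda>t x. \<Phi> t x - \<Psi> t x)"
  using lip_family_add[OF _ lip_family_uminus, of T X \<Phi> \<Psi>] by simp

lemma lip_family_sum:
  "(\<And>i. i \<in> I \<Longrightarrow> lip_family T X (\<Phi> i)) \<Longrightarrow> lip_family T X (\<lambda>t x. \<Sum>i\<in>I. \<Phi> i t x)"
  by (induction I rule: infinite_finite_induct) (auto intro: lip_family_scalar lip_family_add)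

lemma lip_family_cnj:
  assumes "lip_family T X \<Phi>"
  shows "lip_family T X (\<lambda>t x. cnj (\<Phi> t x))"
proof (rule lip_familyI)
  show "dominated (T \<times> T) X (\<lambda>p. dist (fst p) (snd p)) (\<lambda>p x. cnj (\<Phi> (fst p) x) - cnj (\<Phi> (snd p) x))"
    using dominated_cnj[OF lip_family_increment[OF assms]] by simp
  show "(\<lambda>x. cnj (\<Phi> t x)) \<in> borel_measurable borel" if "t \<in> T" for t
    using lip_family_measurable[OF assms that]
    by (rule measurable_compose) (intro borel_measurable_continuous_onI continuous_intros)
qed (intro dominated_cnj lip_family_bounded[OF assms])

lemma norm_exp_diff_le:
  fixes a b :: complex
  assumes "norm a \<le> B" "norm b \<le> B"
  shows "norm (exp a - exp b) \<le> exp B * norm (a - b)"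
proof (rule field_differentiable_bound[where S = "cball 0 B" and f' = exp])
  fix z :: complex assume "z \<in> cball 0 B"
  then show "norm (exp z) \<le> exp B" using norm_exp[of z] by (simp add: order_trans)
qed (use assms in \<open>auto intro!: derivative_eq_intros\<close>)

lemma lip_family_exp:
  assumes "lip_family T X \<Phi>"
  shows "lip_family T X (\<lambda>t x. exp (\<Phi> t x))"
proof (rule lip_familyI)
  obtain B where B: "B \<ge> 0" "\<And>t x. t \<in> T \<Longrightarrow> x \<in> X \<Longrightarrow> norm (\<Phi> t x) \<le> B"
    using lip_family_bounded[OF assms] by (rule dominatedE) simp
  obtain C where C: "C \<ge> 0" "\<And>p x. p \<in> T \<times> T \<Longrightarrow> x \<in> X \<Longrightarrow> norm (\<Phi> (fst p) x - \<Phi> (snd p) x) \<le> C * dist (fst p) (snd p)"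
    using lip_family_increment[OF assms] by (rule dominatedE) simp
  show "(\<lambda>x. exp (\<Phi> t x)) \<in> borel_measurable borel" if "t \<in> T" for t
    using lip_family_measurable[OF assms that]
    by (rule measurable_compose) (intro borel_measurable_continuous_onI continuous_intros)
  show "dominated T X (\<lambda>_. 1) (\<lambda>t x. exp (\<Phi> t x))"
  proof (rule dominatedI[where C = "exp B"])
    fix t x assume "t \<in> T" "x \<in> X"
    then show "norm (exp (\<Phi> t x)) \<le> exp B * 1"
      using norm_exp[of "\<Phi> t x"] B(2)[of t x] by (simp add: order_trans)
  qed simp
  show "dominated (T \<times> T) X (\<lambda>p. dist (fst p) (snd p)) (\<lambda>p x. exp (\<Phi> (fst p) x) - exp (\<Phi> (snd p) x))"
  proof (rule dominatedI[where C = "exp B * C"])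
    fix p x assume p: "p \<in> T \<times> T" and x: "x \<in> X"
    have "norm (exp (\<Phi> (fst p) x) - exp (\<Phi> (snd p) x)) \<le> exp B * norm (\<Phi> (fst p) x - \<Phi> (snd p) x)"
      using p x B(2) by (intro norm_exp_diff_le) (auto simp: mem_Times_iff)
    also have "\<dots> \<le> exp B * (C * dist (fst p) (snd p))"
      using C(2)[OF p x] by (intro mult_left_mono) auto
    finally show "norm (exp (\<Phi> (fst p) x) - exp (\<Phi> (snd p) x)) \<le> exp B * C * dist (fst p) (snd p)"
      by simp
  qed (use C in simp)
qed

lemma lip_family_cos: "lip_family T X \<Phi> \<Longrightarrow> lip_family T X (\<lambda>t x. cos (\<Phi> t x))"
  and lip_family_sin: "lip_family T X \<Phi> \<Longrightarrow> lip_family T X (\<lambda>t x. sin (\<Phi> t x))"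
  unfolding cos_exp_eq sin_exp_eq divide_inverse
  by (intro lip_family_mult lip_family_exp lip_family_add lip_family_diff lip_family_uminus
      lip_family_scalar; assumption)+

text \<open>
  The measurability built into \<open>lip_family\<close> enters here: it makes the difference of two integrals
  the integral of the difference, which is then bounded pointwise.
\<close>

lemma lip_family_integral:
  fixes \<Phi> :: "'a::metric_space \<Rightarrow> 'b::topological_space \<Rightarrow> complex"
  assumes \<Phi>: "lip_family T X \<Phi>" and g: "set_integrable M S g" and S: "S \<subseteq> X" "sets M = sets borel"
  shows "lip_family T Y (\<lambda>t _. LINT x:S|M. g x * \<Phi> t x)"
proof (rule lip_familyI)
  show "dominated T Y (\<lambda>_. 1) (\<lambda>t _. LINT x:S|M. g x * \<Phi> t x)"
    by (rule dominated_integral[OF lip_family_bounded[OF \<Phi>] g S(1)]) simp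
  obtain B where B: "B \<ge> 0" "\<And>t x. t \<in> T \<Longrightarrow> x \<in> X \<Longrightarrow> norm (\<Phi> t x) \<le> B"
    using lip_family_bounded[OF \<Phi>] by (rule dominatedE) simp
  have int: "set_integrable M S (\<lambda>x. g x * \<Phi> t x)" if t: "t \<in> T" for t
  proof (rule set_integrable_bound)
    show "set_integrable M S (\<lambda>x. complex_of_real B * g x)"
      using g by (intro set_integrable_mult_right) simp
    have gm: "(\<lambda>x. indicat_real S x *\<^sub>R g x) \<in> borel_measurable M"
      using g unfolding set_integrable_def by (rule borel_measurable_integrable)
    have pm: "\<Phi> t \<in> borel_measurable M"
      using lip_family_measurable[OF \<Phi> t] measurable_cong_sets[OF S(2)] by blast
    show "set_borel_measurable M S (\<lambda>x. g x * \<Phi> t x)"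
      unfolding set_borel_measurable_def
      using borel_measurable_times[OF gm pm] by simp
    show "AE x in M. x \<in> S \<longrightarrow> norm (g x * \<Phi> t x) \<le> norm (complex_of_real B * g x)"
      using B t S(1)
      by (intro AE_I2) (auto simp: norm_mult mult.commute[of "norm (g _)"] intro!: mult_right_mono)
  qed
  have "dominated (T \<times> T) Y (\<lambda>p. dist (fst p) (snd p))
      (\<lambda>p _. LINT x:S|M. g x * (\<Phi> (fst p) x - \<Phi> (snd p) x))"
    by (rule dominated_integral[OF lip_family_increment[OF \<Phi>] g S(1)]) simp
  then show "dominated (T \<times> T) Y (\<lambda>p. dist (fst p) (snd p))
      (\<lambda>p _. (LINT x:S|M. g x * \<Phi> (fst p) x) - (LINT x:S|M. g x * \<Phi> (snd p) x))"
    by (subst (asm) dominated_cong[where \<Psi> = "\<lambda>p _. (LINT x:S|M. g x * \<Phi> (fst p) x) - (LINT x:S|M. g x * \<Phi> (snd p) x)"])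
      (auto simp: int right_diff_distrib set_integral_diff)
qed simp

section \<open>The PWDG forms on parameter-dependent fields\<close>

definition C1_lip_family ::
  "('a::metric_space) set \<Rightarrow> (real^2) set \<Rightarrow> ('a \<Rightarrow> real^2 \<Rightarrow> complex) \<Rightarrow> bool" where
  "C1_lip_family T X \<Phi> \<longleftrightarrow> (\<forall>t\<in>T. \<forall>x. \<Phi> t differentiable (at x)) \<and> lip_family T X \<Phi> \<and>
     (\<forall>d. lip_family T X (\<lambda>t x. frechet_derivative (\<Phi> t) (at x) (axis d 1)))"

lemma lip_family_cong:
  assumes "\<And>t x. t \<in> T \<Longrightarrow> \<Phi> t x = \<Psi> t x"
  shows "lip_family T X \<Phi> \<longleftrightarrow> lip_family T X \<Psi>"
proof -
  have "\<Phi> t = \<Psi> t" if "t \<in> T" for t using assms[OF that] by auto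
  then show ?thesis unfolding lip_family_def dominated_def by auto
qed

lemma C1_lip_familyI:
  assumes "lip_family T X \<Phi>"
    and "\<And>t x. t \<in> T \<Longrightarrow> (\<Phi> t has_derivative \<Phi>' t x) (at x)"
    and "\<And>d. lip_family T X (\<lambda>t x. \<Phi>' t x (axis d 1))"
  shows "C1_lip_family T X \<Phi>"
  unfolding C1_lip_family_def
proof (intro conjI allI ballI)
  fix d
  have "lip_family T X (\<lambda>t x. frechet_derivative (\<Phi> t) (at x) (axis d 1)) \<longleftrightarrow>
        lip_family T X (\<lambda>t x. \<Phi>' t x (axis d 1))"
    by (rule lip_family_cong) (simp add: frechet_derivative_at[OF assms(2), symmetric])
  then show "lip_family T X (\<lambda>t x. frechet_derivative (\<Phi> t) (at x) (axis d 1))"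
    using assms(3) by simp
qed (use assms in \<open>auto simp: differentiable_def\<close>)

lemma C1_lip_familyD:
  assumes "C1_lip_family T X \<Phi>"
  shows "t \<in> T \<Longrightarrow> (\<Phi> t has_derivative frechet_derivative (\<Phi> t) (at x)) (at x)"
    and "lip_family T X \<Phi>"
    and "lip_family T X (\<lambda>t x. frechet_derivative (\<Phi> t) (at x) (axis d 1))"
  using assms unfolding C1_lip_family_def by (auto simp: frechet_derivative_works[symmetric])

lemma C1_lip_family_add:
  assumes "C1_lip_family T X \<Phi>" "C1_lip_family T X \<Psi>"
  shows "C1_lip_family T X (\<lambda>t x. \<Phi> t x + \<Psi> t x)"
proof (rule C1_lip_familyI)
  show "((\<lambda>x. \<Phi> t x + \<Psi> t x) has_derivative (\<lambda>h. frechet_derivative (\<Phi> t) (at x) h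
      + frechet_derivative (\<Psi> t) (at x) h)) (at x)" if "t \<in> T" for t x
    by (intro has_derivative_add C1_lip_familyD(1)[OF assms(1) that] C1_lip_familyD(1)[OF assms(2) that])
qed (intro lip_family_add C1_lip_familyD(2,3)[OF assms(1)] C1_lip_familyD(2,3)[OF assms(2)])+

lemma C1_lip_family_scale:
  assumes c: "lip_family T X (\<lambda>t x. c t)" and \<Phi>: "C1_lip_family T X \<Phi>"
  shows "C1_lip_family T X (\<lambda>t x. c t * \<Phi> t x)"
proof (rule C1_lip_familyI)
  show "((\<lambda>x. c t * \<Phi> t x) has_derivative (\<lambda>h. c t * frechet_derivative (\<Phi> t) (at x) h)) (at x)"
    if "t \<in> T" for t x
    by (intro has_derivative_mult_right C1_lip_familyD(1)[OF \<Phi> that])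
qed (intro lip_family_mult c C1_lip_familyD(2,3)[OF \<Phi>])+

lemma C1_lip_family_zero: "C1_lip_family T X (\<lambda>t x. 0)"
  by (rule C1_lip_familyI[where \<Phi>' = "\<lambda>t x h. 0"]) (auto intro: lip_family_scalar)

lemma C1_lip_family_sum:
  "(\<And>i. i \<in> I \<Longrightarrow> C1_lip_family T X (\<Phi> i)) \<Longrightarrow> C1_lip_family T X (\<lambda>t x. \<Sum>i\<in>I. \<Phi> i t x)"
  by (induction I rule: infinite_finite_induct) (auto intro: C1_lip_family_zero C1_lip_family_add)

lemma C1_lip_family_cnj:
  assumes "C1_lip_family T X \<Phi>"
  shows "C1_lip_family T X (\<lambda>t x. cnj (\<Phi> t x))"
proof (rule C1_lip_familyI)
  show "((\<lambda>x. cnj (\<Phi> t x)) has_derivative (\<lambda>h. cnj (frechet_derivative (\<Phi> t) (at x) h))) (at x)"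
    if "t \<in> T" for t x
    by (intro bounded_linear.has_derivative[OF bounded_linear_cnj] C1_lip_familyD(1)[OF assms that])
qed (intro lip_family_cnj C1_lip_familyD(2,3)[OF assms])+

lemma lip_family_coordinate:
  assumes "f \<in> borel_measurable borel" "bounded (f ` X)"
  shows "lip_family T X (\<lambda>t x. complex_of_real (f x $ (d::2)))"
proof -
  obtain B where B: "\<And>x. x \<in> X \<Longrightarrow> norm (f x) \<le> B"
    using assms(2) unfolding bounded_iff by blast
  show ?thesis
  proof (rule lip_family_const)
    show "(\<lambda>x. complex_of_real (f x $ d)) \<in> borel_measurable borel"
      using assms(1)
      by (rule measurable_compose) (intro borel_measurable_continuous_onI continuous_intros)
    show "norm (complex_of_real (f x $ d)) \<le> B" if "x \<in> X" for x
      using B[OF that] component_le_norm_cart[of "f x" d] by simp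
  qed
qed

lemma lip_family_outer_normal:
  "lip_family T X (\<lambda>t x. complex_of_real (outer_normal S x $ d))"
  by (intro lip_family_coordinate borel_measurable_outer_normal
      bounded_subset[OF bounded_range_outer_normal]) auto

lemma plane_wave_eq:
  "plane_wave P K z = (\<lambda>x. exp (\<i> * (of_real (wavenum P K) * cos z * of_real ((x - refpt P K) $ 1)
     + of_real (wavenum P K) * sin z * of_real ((x - refpt P K) $ 2))))"
  unfolding plane_wave_def cdot_def cvec_def
  by (rule ext) (simp add: sum_2 vector_2 mult_ac)

lemma C1_lip_family_plane_wave:
  assumes Z: "lip_family T X (\<lambda>t x. Z t)" and X: "bounded X"
  shows "C1_lip_family T X (\<lambda>t. plane_wave P K (Z t))"
proof (rule C1_lip_familyI)
  have b: "bounded ((\<lambda>x. x - refpt P K) ` X)" using X by (rule bounded_translation_minus)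
  have w: "lip_family T X (\<lambda>t x. of_real ((x - refpt P K) $ d))" for d
    by (intro lip_family_coordinate b borel_measurable_continuous_onI continuous_intros)
  show pw: "lip_family T X (\<lambda>t. plane_wave P K (Z t))"
    unfolding plane_wave_eq
    by (intro lip_family_exp lip_family_mult lip_family_add lip_family_scalar lip_family_cos lip_family_sin Z w)
  let ?D = "\<lambda>t x (h::real^2). plane_wave P K (Z t) x * (\<i> * (of_real (wavenum P K) * cos (Z t) * of_real (h $ 1)
     + of_real (wavenum P K) * sin (Z t) * of_real (h $ 2)))"
  show "(plane_wave P K (Z t) has_derivative ?D t x) (at x)" for t x
    unfolding plane_wave_eq
  proof (rule has_derivative_compose[OF _ DERIV_exp[unfolded has_field_derivative_def]])
    have c: "((\<lambda>x. complex_of_real ((x - refpt P K) $ d)) has_derivative (\<lambda>h. complex_of_real (h $ d))) (at x)" for d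
      by (rule bounded_linear.has_derivative[OF bounded_linear_of_real],
          rule bounded_linear.has_derivative[OF bounded_linear_vec_nth])
        (auto intro!: derivative_eq_intros)
    show "((\<lambda>x. \<i> * (of_real (wavenum P K) * cos (Z t) * of_real ((x - refpt P K) $ 1)
        + of_real (wavenum P K) * sin (Z t) * of_real ((x - refpt P K) $ 2))) has_derivative
      (\<lambda>h. \<i> * (of_real (wavenum P K) * cos (Z t) * of_real (h $ 1)
        + of_real (wavenum P K) * sin (Z t) * of_real (h $ 2)))) (at x)"
      by (intro has_derivative_mult_right has_derivative_add c)
  qed
  show "lip_family T X (\<lambda>t x. ?D t x (axis d 1))" for d
    by (intro lip_family_exp lip_family_mult lip_family_add lip_family_scalar lip_family_cos lip_family_sin Z pw)
qed

lemma gradh_nth: "gradh v K x $ d = frechet_derivative (v K) (at x) (axis d 1)"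
  unfolding gradh_def by simp

lemma jump_nth: "jump e v x $ d = v (fst e) x * of_real (outer_normal (fst e) x $ d)
    + v (snd e) x * of_real (outer_normal (snd e) x $ d)"
  unfolding jump_def cvec_def by simp

lemma njump_eq: "njump e \<tau> x = (\<Sum>d\<in>UNIV. \<tau> (fst e) x $ d * of_real (outer_normal (fst e) x $ d))
    + (\<Sum>d\<in>UNIV. \<tau> (snd e) x $ d * of_real (outer_normal (snd e) x $ d))"
  unfolding njump_def cdot_def cvec_def by simp

lemma dnorm_eq: "dnorm P v K x = (\<Sum>d\<in>UNIV. gradh v K x $ d * of_real (outer_normal (Dom P) x $ d))"
  unfolding dnorm_def cdot_def cvec_def by simp

lemma avg_eq: "avg e u x = of_real (1/2) * (u (fst e) x + u (snd e) x)" for u :: "complex broken"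
  unfolding avg_def scaleR_conv_of_real by simp

lemma avg_nth: "avg e \<tau> x $ d = complex_of_real (1/2) * (\<tau> (fst e) x $ d + \<tau> (snd e) x $ d)" for \<tau> :: "(complex^2) broken"
  by (simp only: avg_def vector_scaleR_component vector_add_component) (simp add: scaleR_conv_of_real)

definition skeleton :: "pwdg \<Rightarrow> (real^2) set" where
  "skeleton P = (\<Union>K\<in>Mesh P. frontier K)"

lemma pwdg_setting_skeleton:
  assumes "pwdg_setting P"
  shows "bounded (skeleton P)"
    and "K \<in> Mesh P \<Longrightarrow> frontier K \<subseteq> skeleton P"
    and "K \<in> Mesh P \<Longrightarrow> emeasure hausdorff1 (frontier K) < \<infinity>"
    and "e \<in> Edges P \<Longrightarrow> fst e \<in> Mesh P \<and> snd e \<in> Mesh P"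
proof -
  have fin: "finite (Mesh P)" and lip: "\<And>K. K \<in> Mesh P \<Longrightarrow> bounded_lipschitz_domain K"
    and int: "interior_edges (Mesh P) (Edges P)"
    using assms unfolding pwdg_setting_def is_mesh_def by auto
  have "bounded K \<and> lipschitz_boundary K" if "K \<in> Mesh P" for K
    using lip[OF that] unfolding bounded_lipschitz_domain_def by blast
  then show "bounded (skeleton P)" "K \<in> Mesh P \<Longrightarrow> emeasure hausdorff1 (frontier K) < \<infinity>"
    unfolding skeleton_def using fin
    by (intro bounded_UN ballI compact_imp_bounded[OF compact_frontier_bounded]
        lipschitz_boundary_finite_length; blast)+
  show "K \<in> Mesh P \<Longrightarrow> frontier K \<subseteq> skeleton P" unfolding skeleton_def by blast
  show "e \<in> Edges P \<Longrightarrow> fst e \<in> Mesh P \<and> snd e \<in> Mesh P"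
    using int unfolding interior_edges_def by (auto simp: split_beta)
qed

lemma set_integrable_const_finite:
  assumes "S \<in> sets M" "emeasure M S < \<infinity>"
  shows "set_integrable M S (\<lambda>x. 1 :: complex)"
  using assms unfolding set_integrable_def by simp

lemma lip_family_set_integral:
  assumes "lip_family T X \<Phi>" "S \<in> sets M" "emeasure M S < \<infinity>" "S \<subseteq> X" "sets M = sets borel"
  shows "lip_family T Y (\<lambda>t _. LINT x:S|M. \<Phi> t x)"
  using lip_family_integral[OF assms(1) set_integrable_const_finite[OF assms(2,3)] assms(4,5)] by simp

lemma dominated_set_integral:
  fixes \<Phi> :: "'a \<Rightarrow> 'b \<Rightarrow> complex"
  assumes "dominated T X \<omega> \<Phi>" "S \<in> sets M" "emeasure M S < \<infinity>" "S \<subseteq> X" "\<And>t. t \<in> T \<Longrightarrow> \<omega> t \<ge> 0"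
  shows "dominated T Y \<omega> (\<lambda>t _. LINT x:S|M. \<Phi> t x)"
  using dominated_integral[OF assms(1) set_integrable_const_finite[OF assms(2,3)] assms(4,5)] by simp

lemma edge_set_properties:
  assumes "pwdg_setting P" "e \<in> Edges P"
  shows "edge_set e \<in> sets hausdorff1" "emeasure hausdorff1 (edge_set e) < \<infinity>" "edge_set e \<subseteq> skeleton P"
proof -
  have K: "fst e \<in> Mesh P" using pwdg_setting_skeleton(4)[OF assms] by blast
  have sub: "edge_set e \<subseteq> frontier (fst e)" unfolding edge_set_def by blast
  show "edge_set e \<in> sets hausdorff1" unfolding edge_set_def by (simp add: borel_closed sets.Int)
  have "emeasure hausdorff1 (edge_set e) \<le> emeasure hausdorff1 (frontier (fst e))"
    by (rule emeasure_mono[OF sub]) (simp add: borel_closed)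
  then show "emeasure hausdorff1 (edge_set e) < \<infinity>"
    using pwdg_setting_skeleton(3)[OF assms(1) K] by (rule le_less_trans)
  show "edge_set e \<subseteq> skeleton P" using sub pwdg_setting_skeleton(2)[OF assms(1) K] by blast
qed

lemma boundary_part_properties:
  assumes "pwdg_setting P" "K \<in> Mesh P" "\<Gamma> \<in> sets borel"
  shows "frontier K \<inter> \<Gamma> \<in> sets hausdorff1" "emeasure hausdorff1 (frontier K \<inter> \<Gamma>) < \<infinity>"
    "frontier K \<inter> \<Gamma> \<subseteq> skeleton P"
proof -
  show "frontier K \<inter> \<Gamma> \<in> sets hausdorff1" using assms(3) by (simp add: borel_closed sets.Int)
  have "emeasure hausdorff1 (frontier K \<inter> \<Gamma>) \<le> emeasure hausdorff1 (frontier K)"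
    by (rule emeasure_mono) (auto simp: borel_closed)
  then show "emeasure hausdorff1 (frontier K \<inter> \<Gamma>) < \<infinity>"
    using pwdg_setting_skeleton(3)[OF assms(1,2)] by (rule le_less_trans)
  show "frontier K \<inter> \<Gamma> \<subseteq> skeleton P" using pwdg_setting_skeleton(2)[OF assms(1,2)] by blast
qed

text \<open>
  Each branch is controlled on the whole skeleton; every trace in the forms is taken there.
\<close>

definition lip_field :: "('a::metric_space) set \<Rightarrow> pwdg \<Rightarrow> ('a \<Rightarrow> complex broken) \<Rightarrow> bool" where
  "lip_field T P V \<longleftrightarrow> (\<forall>K\<in>Mesh P. C1_lip_family T (skeleton P) (\<lambda>t. V t K))"

lemma lip_fieldD:
  assumes "lip_field T P V" "K \<in> Mesh P"
  shows "lip_family T (skeleton P) (\<lambda>t. V t K)"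
    and "lip_family T (skeleton P) (\<lambda>t x. gradh (V t) K x $ d)"
  using assms C1_lip_familyD unfolding lip_field_def gradh_nth by blast+

lemma lip_field_conjh: "lip_field T P V \<Longrightarrow> lip_field T P (\<lambda>t. conjh (V t))"
  unfolding lip_field_def conjh_def by (intro ballI C1_lip_family_cnj) simp

lemmas lip_family_arith =
  lip_family_mult lip_family_add lip_family_diff lip_family_uminus lip_family_sum lip_family_scalar
  lip_family_outer_normal

text \<open>
  Every integrand is a polynomial in traces, gradient traces and normal components.
\<close>

lemma lip_family_a_h:
  assumes P: "pwdg_setting P" and V: "lip_field T P V" and W: "lip_field T P W"
  shows "lip_family T Y (\<lambda>t _. a_h P (V t) (W t))"
proof -
  note W' = lip_field_conjh[OF W]
  have \<Gamma>: "GamD P \<in> sets borel" "GamR P \<in> sets borel" using P unfolding pwdg_setting_def by auto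
  show ?thesis
    unfolding a_h_def edge_int_def bdry_int_def
  proof (intro lip_family_add lip_family_sum)
    fix e assume e: "e \<in> Edges P"
    note K = pwdg_setting_skeleton(4)[OF P e, THEN conjunct1] pwdg_setting_skeleton(4)[OF P e, THEN conjunct2]
    note f = lip_fieldD[OF V K(1)] lip_fieldD[OF V K(2)] lip_fieldD[OF W' K(1)] lip_fieldD[OF W' K(2)]
    show "lip_family T Y (\<lambda>t _. LINT x:edge_set e|hausdorff1. 
        avg e (V t) x * njump e (gradh (conjh (W t))) x
      - cdot (jump e (conjh (W t)) x) (avg e (gradh (V t)) x)
      + \<i> * of_real (beta P / edge_scale P e) * njump e (gradh (V t)) x * njump e (gradh (conjh (W t))) x
      + \<i> * of_real (alpha P * edge_scale P e) * cdot (jump e (V t) x) (jump e (conjh (W t)) x))"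
      unfolding cdot_def jump_nth njump_eq avg_eq avg_nth
      by (intro lip_family_set_integral[OF _ edge_set_properties[OF P e] sets_hausdorff1]
          lip_family_arith f)
  next
    fix K assume K: "K \<in> Mesh P"
    note f = lip_fieldD[OF V K] lip_fieldD[OF W' K]
    show "lip_family T Y (\<lambda>t _. LINT x:frontier K \<inter> GamD P|hausdorff1.
      - dnorm P (V t) K x * conjh (W t) K x
      + \<i> * of_real (alpha P * wavenum P K) * V t K x * conjh (W t) K x)"
      unfolding dnorm_eq
      by (intro lip_family_set_integral[OF _ boundary_part_properties[OF P K \<Gamma>(1)] sets_hausdorff1]
          lip_family_arith f)
    show "lip_family T Y (\<lambda>t _. LINT x:frontier K \<inter> GamR P|hausdorff1.
      of_real (1 - delta P) * \<i> * of_real (wavenum P K) * V t K x * conjh (W t) K x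
      + of_real (1 - delta P) * V t K x * dnorm P (conjh (W t)) K x
      - of_real (delta P) * dnorm P (V t) K x * conjh (W t) K x
      - of_real (delta P) * inverse (\<i> * of_real (wavenum P K))
          * dnorm P (V t) K x * dnorm P (conjh (W t)) K x)"
      unfolding dnorm_eq
      by (intro lip_family_set_integral[OF _ boundary_part_properties[OF P K \<Gamma>(2)] sets_hausdorff1]
          lip_family_arith f)
  qed
qed

text \<open>
  On a set of finite length, square integrable data are integrable because \<open>t \<le> 1 + t\<^sup>2\<close>.
\<close>

lemma set_integrable_bdata:
  assumes P: "pwdg_setting P" and K: "K \<in> Mesh P"
  shows "set_integrable hausdorff1 (frontier K \<inter> GamD P) (bdata P)"
proof -
  let ?S = "frontier K \<inter> GamD P"
  have D: "GamD P \<in> sets borel" and m: "set_borel_measurable hausdorff1 (GamD P) (bdata P)"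
    and sq: "set_integrable hausdorff1 (GamD P) (\<lambda>x. (norm (bdata P x))\<^sup>2)"
    using P unfolding pwdg_setting_def by auto
  note S = boundary_part_properties[OF P K D]
  have sqS: "set_integrable hausdorff1 ?S (\<lambda>x. (norm (bdata P x))\<^sup>2)"
    by (rule set_integrable_subset[OF sq S(1)]) auto
  have one: "set_integrable hausdorff1 ?S (\<lambda>x. 1 :: real)"
    using S unfolding set_integrable_def by simp
  show ?thesis
  proof (rule set_integrable_bound[OF set_integral_add(1)[OF one sqS]])
    show "set_borel_measurable hausdorff1 ?S (bdata P)"
      by (rule set_borel_measurable_subset[OF m S(1)]) auto
    show "AE x in hausdorff1. x \<in> ?S \<longrightarrow> norm (bdata P x) \<le> norm (1 + (norm (bdata P x))\<^sup>2)"
    proof (intro AE_I2 impI)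
      fix x
      \<comment> \<open>\<open>t\<^sup>2 - t + 1/4 \<ge> 0\<close>, more than enough for \<open>t \<le> 1 + t\<^sup>2\<close>\<close>
      have "0 \<le> (norm (bdata P x) - 1/2)\<^sup>2" by simp
      then show "norm (bdata P x) \<le> norm (1 + (norm (bdata P x))\<^sup>2)"
        by (simp add: power2_eq_square algebra_simps)
    qed
  qed
qed

lemma lip_family_F_h:
  assumes P: "pwdg_setting P" and W: "lip_field T P W"
  shows "lip_family T Y (\<lambda>t _. F_h P (W t))"
  unfolding F_h_def bdry_int_def dnorm_eq
proof (rule lip_family_sum)
  note W' = lip_field_conjh[OF W]
  have D: "GamD P \<in> sets borel" using P unfolding pwdg_setting_def by auto
  fix K assume K: "K \<in> Mesh P"
  note f = lip_fieldD[OF W' K]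
  show "lip_family T Y (\<lambda>t _. LINT x:frontier K \<inter> GamD P|hausdorff1.
      bdata P x * (\<i> * of_real (alpha P * wavenum P K) * conjh (W t) K x -
        (\<Sum>d\<in>UNIV. gradh (conjh (W t)) K x $ d * of_real (outer_normal (Dom P) x $ d))))"
    by (intro lip_family_integral[OF _ set_integrable_bdata[OF P K] boundary_part_properties(3)[OF P K D] sets_hausdorff1]
          lip_family_arith f)
qed

lemma dominated_mult_bounded:
  fixes \<Phi> \<Psi> :: "'a \<Rightarrow> 'b \<Rightarrow> complex"
  assumes "dominated T X \<omega> \<Phi>" "dominated T X (\<lambda>_. 1) \<Psi>"
  shows "dominated T X \<omega> (\<lambda>t x. \<Phi> t x * \<Psi> t x)"
  by (rule dominated_mult[OF assms]) simp

lemma dominated_scale: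
  fixes \<Phi> :: "'a \<Rightarrow> 'b \<Rightarrow> complex"
  assumes "dominated T X \<omega> \<Phi>"
  shows "dominated T X \<omega> (\<lambda>t x. c * \<Phi> t x)"
  using dominated_mult_bounded[OF assms dominated_const[of X "\<lambda>_. c" "norm c"]]
  by (simp add: mult.commute)

lemma dominated_square:
  fixes \<Phi> \<Psi> :: "'a \<Rightarrow> 'b \<Rightarrow> complex"
  assumes "dominated T X \<omega> \<Phi>" "dominated T X \<omega> \<Psi>"
  shows "dominated T X (\<lambda>t. (\<omega> t)\<^sup>2) (\<lambda>t x. \<Phi> t x * cnj (\<Psi> t x))"
  by (rule dominated_mult[OF assms(1) dominated_cnj[OF assms(2)]]) (simp add: power2_eq_square)

lemma dominated_outer_normal:
  fixes \<Phi> :: "'a \<Rightarrow> real^2 \<Rightarrow> complex"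
  assumes "dominated T X \<omega> \<Phi>"
  shows "dominated T X \<omega> (\<lambda>t x. \<Phi> t x * of_real (outer_normal S x $ d))"
proof (rule dominated_mult_bounded[OF assms])
  obtain B where B: "\<And>x. norm (outer_normal S x) \<le> B"
    using bounded_range_outer_normal[of S] unfolding bounded_iff by blast
  show "dominated T X (\<lambda>_. 1) (\<lambda>t x. complex_of_real (outer_normal S x $ d))"
  proof (rule dominated_const)
    fix x show "norm (complex_of_real (outer_normal S x $ d)) \<le> B"
      using B[of x] component_le_norm_cart[of "outer_normal S x" d] by simp
  qed
qed

text \<open>
  The form is quadratic, so traces of size \<open>\<omega>\<close> give a value of size \<open>\<omega>\<^sup>2\<close>. This is used with
  \<open>\<omega>\<close> the distance of two direction states and the difference of the corresponding fields.
\<close>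

lemma dominated_G_h:
  assumes P: "pwdg_setting P"
    and V: "\<And>K. K \<in> Mesh P \<Longrightarrow> dominated T (skeleton P) \<omega> (\<lambda>t. V t K)"
    and dV: "\<And>K d. K \<in> Mesh P \<Longrightarrow> dominated T (skeleton P) \<omega> (\<lambda>t x. gradh (V t) K x $ d)"
  shows "dominated T Y (\<lambda>t. (\<omega> t)\<^sup>2) (\<lambda>t _. G_h P (V t) (V t))"
proof -
  have \<Gamma>: "GamD P \<in> sets borel" "GamR P \<in> sets borel" using P unfolding pwdg_setting_def by auto
  show ?thesis
    unfolding G_h_def edge_int_def bdry_int_def
  proof (intro dominated_add dominated_sum)
    fix e assume e: "e \<in> Edges P"
    note K = pwdg_setting_skeleton(4)[OF P e, THEN conjunct1] pwdg_setting_skeleton(4)[OF P e, THEN conjunct2]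
    note f = V[OF K(1)] V[OF K(2)] dV[OF K(1)] dV[OF K(2)]
    have j: "dominated T (skeleton P) \<omega> (\<lambda>t x. jump e (V t) x $ d)" for d
      unfolding jump_nth by (intro dominated_add dominated_outer_normal f)
    have n: "dominated T (skeleton P) \<omega> (\<lambda>t x. njump e (gradh (V t)) x)"
      unfolding njump_eq by (intro dominated_add dominated_sum dominated_outer_normal f)
    have v: "vcnj a $ d = cnj (a $ d)" for a d unfolding vcnj_def by simp
    show "dominated T Y (\<lambda>t. (\<omega> t)\<^sup>2) (\<lambda>t _. of_real (alpha P * edge_scale P e) *
        (LINT x:edge_set e|hausdorff1. cdot (jump e (V t) x) (vcnj (jump e (V t) x))))"
      unfolding cdot_def v
      by (intro dominated_scale dominated_set_integral[OF _ edge_set_properties[OF P e]]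
          dominated_sum dominated_square j) simp
    show "dominated T Y (\<lambda>t. (\<omega> t)\<^sup>2) (\<lambda>t _. of_real (beta P / edge_scale P e) *
        (LINT x:edge_set e|hausdorff1. njump e (gradh (V t)) x * cnj (njump e (gradh (V t)) x)))"
      by (intro dominated_scale dominated_set_integral[OF _ edge_set_properties[OF P e]]
          dominated_square n) simp
  next
    fix K assume K: "K \<in> Mesh P"
    have n: "dominated T (skeleton P) \<omega> (\<lambda>t x. dnorm P (V t) K x)"
      unfolding dnorm_eq by (intro dominated_sum dominated_outer_normal dV[OF K])
    show "dominated T Y (\<lambda>t. (\<omega> t)\<^sup>2) (\<lambda>t _. LINT x:frontier K \<inter> GamD P|hausdorff1.
      of_real (alpha P * wavenum P K) * V t K x * cnj (V t K x))"
      by (intro dominated_set_integral[OF _ boundary_part_properties[OF P K \<Gamma>(1)]]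
          dominated_square dominated_scale V[OF K]) simp
    show "dominated T Y (\<lambda>t. (\<omega> t)\<^sup>2) (\<lambda>t _. LINT x:frontier K \<inter> GamR P|hausdorff1.
      of_real ((1 - delta P) * wavenum P K) * V t K x * cnj (V t K x)
      + of_real (delta P / wavenum P K) * dnorm P (V t) K x * cnj (dnorm P (V t) K x))"
      by (intro dominated_set_integral[OF _ boundary_part_properties[OF P K \<Gamma>(2)]] dominated_add
          dominated_square dominated_scale V[OF K] n) simp
  qed
qed

lemma lip_family_angle:
  assumes "bounded T"
  shows "lip_family T X (\<lambda>\<rho> _. angle D \<rho> K j)"
proof -
  obtain B where B: "\<And>\<rho>. \<rho> \<in> T \<Longrightarrow> norm \<rho> \<le> B" using assms unfolding bounded_iff by blast
  have c: "lip_family T X (\<lambda>\<rho> _. complex_of_real (\<rho> $ i))" for i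
  proof (rule lip_familyI)
    show "dominated T X (\<lambda>_. 1) (\<lambda>\<rho> _. complex_of_real (\<rho> $ i))"
    proof (rule dominatedI[where C = "max B 0"])
      fix \<rho> x assume "\<rho> \<in> T"
      then show "norm (complex_of_real (\<rho> $ i)) \<le> max B 0 * 1"
        using B[of \<rho>] component_le_norm_cart[of \<rho> i] by simp
    qed simp
    show "dominated (T \<times> T) X (\<lambda>p. dist (fst p) (snd p))
      (\<lambda>p _. complex_of_real (fst p $ i) - complex_of_real (snd p $ i))"
    proof (rule dominatedI[where C = 1])
      fix p x
      show "norm (complex_of_real (fst p $ i) - complex_of_real (snd p $ i)) \<le> 1 * dist (fst p) (snd p)"
        using component_le_norm_cart[of "fst p - snd p" i]
        by (simp add: dist_norm norm_of_real flip: of_real_diff)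
    qed simp
  qed simp
  have s: "lip_family T X (\<lambda>\<rho> _. complex_of_real (slot_val D \<rho> s))" for s
    unfolding slot_val_def by (cases "s \<in> range (free D)") (auto intro: c lip_family_scalar)
  show ?thesis
    unfolding angle_def Complex_eq by (intro lip_family_arith s)
qed

lemma lip_field_active_basis:
  assumes "pwdg_setting P" "bounded T"
  shows "lip_field T P (\<lambda>\<rho>. active_basis P D \<rho> i)"
  unfolding lip_field_def active_basis_def
  by (intro ballI C1_lip_family_sum C1_lip_family_scale lip_family_scalar C1_lip_family_plane_wave
      lip_family_angle pwdg_setting_skeleton(1) assms)

section \<open>The discrete solution and the ray orbit\<close>

lemma dominated_le:
  assumes "dominated T X \<omega> \<Psi>" "M \<ge> 0"
    and "\<And>t x. t \<in> T \<Longrightarrow> x \<in> X \<Longrightarrow> norm (\<Phi> t x) \<le> M * norm (\<Psi> t x)"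
  shows "dominated T X \<omega> \<Phi>"
proof -
  obtain C where C: "C \<ge> 0" "\<And>t x. t \<in> T \<Longrightarrow> x \<in> X \<Longrightarrow> norm (\<Psi> t x) \<le> C * \<omega> t"
    using assms(1) by (rule dominatedE) blast
  show ?thesis
  proof (rule dominatedI[where C = "M * C"])
    fix t x assume tx: "t \<in> T" "x \<in> X"
    have "norm (\<Phi> t x) \<le> M * norm (\<Psi> t x)" by (rule assms(3)[OF tx])
    also have "\<dots> \<le> M * (C * \<omega> t)" using C(2)[OF tx] assms(2) by (rule mult_left_mono)
    finally show "norm (\<Phi> t x) \<le> M * C * \<omega> t" by simp
  qed (use C assms(2) in simp)
qed

lemma dominated_vec:
  fixes v :: "'a \<Rightarrow> 'b \<Rightarrow> complex^'n"
  assumes "\<And>i. dominated T X \<omega> (\<lambda>t x. v t x $ i)"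
  shows "dominated T X \<omega> v"
proof (rule dominated_le[where M = 1 and \<Psi> = "\<lambda>t x. \<Sum>i\<in>UNIV. norm (v t x $ i)"])
  show "dominated T X \<omega> (\<lambda>t x. \<Sum>i\<in>UNIV. norm (v t x $ i))"
    using assms by (intro dominated_sum) (simp add: dominated_def)
  fix t x
  have "norm (v t x) \<le> (\<Sum>i\<in>UNIV. norm (v t x $ i))"
    unfolding norm_vec_def by (rule L2_set_le_sum) simp
  then show "norm (v t x) \<le> 1 * norm (\<Sum>i\<in>UNIV. norm (v t x $ i))"
    by (simp add: sum_nonneg)
qed simp

lemma dominated_nth:
  fixes v :: "'a \<Rightarrow> 'b \<Rightarrow> complex^'n"
  assumes "dominated T X \<omega> v"
  shows "dominated T X \<omega> (\<lambda>t x. v t x $ i)"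
  by (rule dominated_le[OF assms, where M = 1]) (auto intro: Finite_Cartesian_Product.norm_nth_le)

text \<open>
  Subtracting the systems at \<open>t\<close> and \<open>s\<close> gives
  \<open>A t (c t - c s) = f t - f s - (A t - A s) (c s)\<close>, and the uniform bound on the inverse applies.
\<close>

lemma lip_family_linear_solve:
  fixes A B :: "'a::metric_space \<Rightarrow> complex^'n^'n" and c f :: "'a \<Rightarrow> complex^'n"
  assumes A: "\<And>i j. lip_family T X (\<lambda>t x. A t $ i $ j)"
    and f: "\<And>i. lip_family T X (\<lambda>t x. f t $ i)"
    and solves: "\<And>t. t \<in> T \<Longrightarrow> A t *v c t = f t"
    and M: "\<And>t y. t \<in> T \<Longrightarrow> norm y \<le> M * norm (A t *v y)" "M \<ge> 0"
  shows "lip_family T X (\<lambda>t x. c t $ i)"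
proof (rule lip_familyI)
  have "dominated T X (\<lambda>_. 1) (\<lambda>t x. f t)"
    using f by (intro dominated_vec lip_family_bounded)
  then have c: "dominated T X (\<lambda>_. 1) (\<lambda>t x. c t)"
    by (rule dominated_le[OF _ M(2)]) (use M(1) solves in metis)
  then show "dominated T X (\<lambda>_. 1) (\<lambda>t x. c t $ i)" by (rule dominated_nth)
  let ?d = "\<lambda>p. dist (fst p) (snd p)"
  let ?g = "\<lambda>p. f (fst p) - f (snd p) - (A (fst p) - A (snd p)) *v c (snd p)"
  have "dominated (T \<times> T) X ?d (\<lambda>p x. ?g p $ k)" for k
  proof -
    have "dominated (T \<times> T) X ?d (\<lambda>p x. (f (fst p) $ k - f (snd p) $ k)
        - (\<Sum>j\<in>UNIV. (A (fst p) $ k $ j - A (snd p) $ k $ j) * c (snd p) $ j))"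
      by (intro dominated_diff dominated_sum dominated_mult_bounded lip_family_increment[OF f]
          lip_family_increment[OF A] dominated_snd[OF dominated_nth[OF c]])
    then show ?thesis by (simp add: matrix_vector_mult_def)
  qed
  then have g: "dominated (T \<times> T) X ?d (\<lambda>p x. ?g p)" by (rule dominated_vec)
  have "dominated (T \<times> T) X ?d (\<lambda>p x. c (fst p) - c (snd p))"
  proof (rule dominated_le[OF g M(2)])
    fix p x assume p: "p \<in> T \<times> T"
    then have "A (fst p) *v (c (fst p) - c (snd p)) = ?g p"
      using solves[of "fst p"] solves[of "snd p"]
      by (auto simp: matrix_vector_mult_diff_distrib matrix_vector_mult_diff_rdistrib)
    then show "norm (c (fst p) - c (snd p)) \<le> M * norm (?g p)"
      using M(1)[of "fst p" "c (fst p) - c (snd p)"] p by auto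
  qed
  from dominated_nth[OF this, of i]
  show "dominated (T \<times> T) X ?d (\<lambda>p x. c (fst p) $ i - c (snd p) $ i)" by simp
qed simp

lemma matrix_inv_inverse:
  fixes A :: "'a::field^'n^'n"
  assumes "invertible A"
  shows "A ** matrix_inv A = mat 1" "matrix_inv A ** A = mat 1"
  using someI_ex[OF assms[unfolded invertible_def]] unfolding matrix_inv_def by auto

lemma norm_le_onorm_matrix_inv:
  fixes A :: "complex^'n^'n"
  assumes "invertible A"
  shows "norm y \<le> onorm ((*v) (matrix_inv A)) * norm (A *v y)"
proof -
  have "bounded_linear ((*v) (matrix_inv A))"
    by (simp add: linear_conv_bounded_linear[symmetric])
  from onorm[OF this, of "A *v y"] show ?thesis
    by (simp add: matrix_vector_mul_assoc matrix_inv_inverse[OF assms])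
qed

lemma c_PW_solves:
  assumes "invertible (A_mat P D \<rho>)"
  shows "A_mat P D \<rho> *v c_PW P D \<rho> = f_vec P D \<rho>"
  unfolding c_PW_def
proof (rule theI)
  let ?A = "A_mat P D \<rho>"
  show "?A *v (matrix_inv ?A *v f_vec P D \<rho>) = f_vec P D \<rho>"
    by (simp add: matrix_vector_mul_assoc matrix_inv_inverse[OF assms])
  fix c assume "?A *v c = f_vec P D \<rho>"
  then have "matrix_inv ?A *v (?A *v c) = matrix_inv ?A *v f_vec P D \<rho>" by simp
  then show "c = matrix_inv ?A *v f_vec P D \<rho>"
    by (simp add: matrix_vector_mul_assoc matrix_inv_inverse[OF assms])
qed

lemma lip_field_U_PW:
  assumes P: "pwdg_setting P" and T: "bounded T"
    and inv: "\<And>\<rho>. \<rho> \<in> T \<Longrightarrow> invertible (A_mat P D \<rho>)"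
    and M: "\<And>\<rho>. \<rho> \<in> T \<Longrightarrow> onorm ((*v) (matrix_inv (A_mat P D \<rho>))) \<le> M"
  shows "lip_field T P (U_PW P D)"
proof -
  note \<phi> = lip_field_active_basis[OF P T, of D]
  have c: "lip_family T (skeleton P) (\<lambda>\<rho> x. c_PW P D \<rho> $ i)" for i
  proof (rule lip_family_linear_solve[where M = "max M 0"])
    show "lip_family T (skeleton P) (\<lambda>\<rho> x. A_mat P D \<rho> $ i $ j)" for i j
      using lip_family_a_h[OF P \<phi>[of j] \<phi>[of i], of "skeleton P"] by (simp add: A_mat_def)
    show "lip_family T (skeleton P) (\<lambda>\<rho> x. f_vec P D \<rho> $ i)" for i
      using lip_family_F_h[OF P \<phi>[of i], of "skeleton P"] by (simp add: f_vec_def)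
    show "norm y \<le> max M 0 * norm (A_mat P D \<rho> *v y)" if "\<rho> \<in> T" for \<rho> and y :: "complex^'b"
      using M[OF that]
      by (intro order_trans[OF norm_le_onorm_matrix_inv[OF inv[OF that], of y] mult_right_mono]) auto
  qed (use inv c_PW_solves in auto)
  show ?thesis
    unfolding lip_field_def U_PW_def v_h_def
    using \<phi> unfolding lip_field_def by (intro ballI C1_lip_family_sum C1_lip_family_scale c) blast
qed

text \<open>
  The difference of the two fields has traces of size \<open>O(dist s t)\<close>, and the graph norm is the square
  root of a quadratic form in these traces.
\<close>

lemma graph_norm_increment_le:
  assumes P: "pwdg_setting P" and V: "lip_field T P V"
  shows "\<exists>C\<ge>0. \<forall>s\<in>T. \<forall>t\<in>T. graph_norm P (\<lambda>K x. V s K x - V t K x) \<le> C * dist s t"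
proof -
  define W where "W p K x = V (fst p) K x - V (snd p) K x" for p K x
  let ?d = "\<lambda>p. dist (fst p) (snd p)"
  have "dominated (T \<times> T) (UNIV :: unit set) (\<lambda>p. (?d p)\<^sup>2) (\<lambda>p _. G_h P (W p) (W p))"
  proof (rule dominated_G_h[OF P])
    fix K assume K: "K \<in> Mesh P"
    show "dominated (T \<times> T) (skeleton P) ?d (\<lambda>p. W p K)"
      unfolding W_def by (rule lip_family_increment[OF lip_fieldD(1)[OF V K]])
    fix d
    have C1: "C1_lip_family T (skeleton P) (\<lambda>t. V t K)" using V K unfolding lip_field_def by blast
    have g: "gradh (W p) K x $ d = gradh (V (fst p)) K x $ d - gradh (V (snd p)) K x $ d"
      if "p \<in> T \<times> T" for p x
    proof -
      have p: "fst p \<in> T" "snd p \<in> T" using that by auto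
      have "(W p K has_derivative (\<lambda>h. frechet_derivative (V (fst p) K) (at x) h
          - frechet_derivative (V (snd p) K) (at x) h)) (at x)"
        unfolding W_def
        by (intro has_derivative_diff C1_lip_familyD(1)[OF C1 p(1)] C1_lip_familyD(1)[OF C1 p(2)])
      from frechet_derivative_at[OF this, symmetric] show ?thesis by (simp add: gradh_nth)
    qed
    show "dominated (T \<times> T) (skeleton P) ?d (\<lambda>p x. gradh (W p) K x $ d)"
      using lip_family_increment[OF lip_fieldD(2)[OF V K, of d]]
      by (subst dominated_cong[OF g]) simp_all
  qed
  then obtain C where C: "C \<ge> 0" "\<And>p. p \<in> T \<times> T \<Longrightarrow> norm (G_h P (W p) (W p)) \<le> C * (?d p)\<^sup>2"
    by (rule dominatedE) blast
  have "graph_norm P (\<lambda>K x. V s K x - V t K x) \<le> sqrt C * dist s t" if "s \<in> T" "t \<in> T" for s t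
  proof -
    have "Re (G_h P (W (s, t)) (W (s, t))) \<le> C * (dist s t)\<^sup>2"
      using complex_Re_le_cmod[of "G_h P (W (s, t)) (W (s, t))"] C(2)[of "(s, t)"] that by simp
    then have "sqrt (Re (G_h P (W (s, t)) (W (s, t)))) \<le> sqrt (C * (dist s t)\<^sup>2)"
      by (rule real_sqrt_le_mono)
    then show ?thesis unfolding graph_norm_def W_def by (simp add: real_sqrt_mult)
  qed
  then show ?thesis using C(1) by (intro exI[of _ "sqrt C"]) simp
qed

text \<open>
  Each coordinate fills a slot of some angle, so a member of the orbit is determined by its
  permutations, and there are finitely many of them.
\<close>

lemma finite_ray_orbit:
  assumes P: "pwdg_setting P" and D: "directions_setting P D"
  shows "finite (ray_orbit P D \<rho>)"
proof -
  let ?F = "\<Pi>\<^sub>E K\<in>Mesh P. {p. p permutes {..<nrays P K}}"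
  have finM: "finite (Mesh P)" using P unfolding pwdg_setting_def is_mesh_def by blast
  have "finite ?F" using finM by (intro finite_PiE finite_permutations) auto
  define g where "g \<pi> = (\<chi> i. case free D i of (K, j, p) \<Rightarrow>
      (case p of Theta \<Rightarrow> Re (angle D \<rho> K (\<pi> K j)) | Eta \<Rightarrow> Im (angle D \<rho> K (\<pi> K j))))" for \<pi>
  have "ray_orbit P D \<rho> \<subseteq> g ` ?F"
  proof
    fix \<rho>' assume "\<rho>' \<in> ray_orbit P D \<rho>"
    then obtain \<pi> where \<pi>: "\<And>K. K \<in> Mesh P \<Longrightarrow> \<pi> K permutes {..<nrays P K}"
      "\<And>K j. K \<in> Mesh P \<Longrightarrow> j < nrays P K \<Longrightarrow> angle D \<rho>' K j = angle D \<rho> K (\<pi> K j)"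
      unfolding ray_orbit_def by blast
    have "\<rho>' = g (restrict \<pi> (Mesh P))"
    proof (subst vec_eq_iff, rule allI)
      fix i
      obtain K j p where f: "free D i = (K, j, p)" "K \<in> Mesh P" "j < nrays P K"
        using D unfolding directions_setting_def by blast
      have inj: "inj (free D)" using D unfolding directions_setting_def by blast
      have "slot_val D \<rho>' (free D i) = \<rho>' $ i" unfolding slot_val_def using inj by simp
      then have "\<rho>' $ i = (case p of Theta \<Rightarrow> Re (angle D \<rho>' K j) | Eta \<Rightarrow> Im (angle D \<rho>' K j))"
        unfolding f(1) by (cases p) (simp_all add: angle_def)
      then show "\<rho>' $ i = g (restrict \<pi> (Mesh P)) $ i"
        unfolding g_def using f \<pi>(2)[OF f(2,3)] by (simp cong: angle_part.case_cong)
    qed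
    moreover have "restrict \<pi> (Mesh P) \<in> ?F" using \<pi>(1) by auto
    ultimately show "\<rho>' \<in> g ` ?F" by blast
  qed
  then show ?thesis using \<open>finite ?F\<close> finite_surj by blast
qed

lemma self_in_ray_orbit: "\<rho> \<in> ray_orbit P D \<rho>"
  unfolding ray_orbit_def by (auto intro!: exI[of _ "\<lambda>_. id"] permutes_id)

lemma infdist_finite_near:
  fixes z :: "'a::metric_space"
  assumes "finite S" "z \<in> S"
  shows "\<forall>\<^sub>F x in nhds z. infdist x S = dist x z"
proof -
  obtain d where d: "d > 0" "\<And>y. y \<in> S \<Longrightarrow> y \<noteq> z \<Longrightarrow> d \<le> dist z y"
    using finite_set_avoid[OF assms(1), of z] by (metis)
  have "infdist x S = dist x z" if x: "dist x z < d / 2" for x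
  proof (rule antisym)
    show "infdist x S \<le> dist x z" by (rule infdist_le[OF assms(2)])
    have "dist x z \<le> dist x y" if "y \<in> S" for y
    proof (cases "y = z")
      case False
      then have "d \<le> dist z y" by (rule d(2)[OF that])
      also have "\<dots> \<le> dist x z + dist x y" by (metis dist_commute dist_triangle)
      finally show ?thesis using x by linarith
    qed simp
    then show "dist x z \<le> infdist x S"
      using assms(2) unfolding infdist_def by (auto intro!: cINF_greatest)
  qed
  then show ?thesis unfolding eventually_nhds_metric using d(1) by (intro exI[of _ "d/2"]) auto
qed

section \<open>Nondegenerate zeros, Gauss-Newton and Levenberg-Marquardt\<close>

lemma norm_linear_le_sum_axis:
  fixes f :: "real^'m \<Rightarrow> 'b::real_normed_vector"
  assumes "linear f"
  shows "norm (f h) \<le> (\<Sum>i\<in>UNIV. norm (f (axis i 1))) * norm h"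
proof -
  have "f h = f (\<Sum>i\<in>UNIV. (h $ i) *\<^sub>R axis i 1)"
    using basis_expansion[of h] by (simp add: scalar_mult_eq_scaleR)
  also have "\<dots> = (\<Sum>i\<in>UNIV. (h $ i) *\<^sub>R f (axis i 1))"
    using assms by (simp add: linear_sum linear_scale)
  also have "norm \<dots> \<le> (\<Sum>i\<in>UNIV. norm ((h $ i) *\<^sub>R f (axis i 1)))" by (rule norm_sum)
  also have "\<dots> \<le> (\<Sum>i\<in>UNIV. norm (f (axis i 1)) * norm h)"
    using mult_right_mono[OF component_le_norm_cart[of h]] by (intro sum_mono) (simp add: mult.commute[of "norm (f _)"])
  finally show ?thesis by (simp add: sum_distrib_right)
qed

lemma C1_locally_lipschitz:
  fixes g :: "real^'m \<Rightarrow> 'b::real_normed_vector"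
  assumes diff: "\<And>x. x \<in> cball z r \<Longrightarrow> g differentiable (at x)"
    and cont: "\<And>v. continuous_on (cball z r) (\<lambda>x. frechet_derivative g (at x) v)"
  shows "\<exists>L\<ge>0. \<forall>x\<in>cball z r. \<forall>y\<in>cball z r. norm (g x - g y) \<le> L * norm (x - y)"
proof -
  have "\<exists>B. \<forall>x\<in>cball z r. norm (frechet_derivative g (at x) v) \<le> B" for v
    using compact_imp_bounded[OF compact_continuous_image[OF cont[of v] compact_cball]]
    unfolding bounded_iff by blast
  then obtain B where B: "\<And>v x. x \<in> cball z r \<Longrightarrow> norm (frechet_derivative g (at x) v) \<le> B v"
    by metis
  define L where "L = max 0 (\<Sum>i\<in>UNIV. B (axis (i::'m) 1))"
  have der: "(g has_derivative frechet_derivative g (at x)) (at x)" if "x \<in> cball z r" for x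
    using diff[OF that] frechet_derivative_works by blast
  have on: "onorm (frechet_derivative g (at x)) \<le> L" if x: "x \<in> cball z r" for x
  proof (rule onorm_bound)
    fix h
    have "norm (frechet_derivative g (at x) h)
        \<le> (\<Sum>i\<in>UNIV. norm (frechet_derivative g (at x) (axis i 1))) * norm h"
      by (rule norm_linear_le_sum_axis[OF has_derivative_linear[OF der[OF x]]])
    also have "\<dots> \<le> L * norm h"
      unfolding L_def by (intro mult_right_mono le_max_iff_disj[THEN iffD2] disjI2 sum_mono B x) simp
    finally show "norm (frechet_derivative g (at x) h) \<le> L * norm h" .
  qed (simp add: L_def)
  have "norm (g x - g y) \<le> L * norm (x - y)" if "x \<in> cball z r" "y \<in> cball z r" for x y
    by (rule differentiable_bound[OF convex_cball has_derivative_at_withinI[OF der] on that])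
  then show ?thesis unfolding L_def by (intro exI[of _ L]) (auto simp: L_def)
qed

text \<open>
  Two orders of differentiability suffice: the columns of the Jacobian are continuously
  differentiable, hence Lipschitz on a compact ball.
\<close>

lemma smooth_on_jacobian_lipschitz:
  fixes R :: "real^'m \<Rightarrow> real^'p"
  assumes "open N" "z \<in> N" "smooth_on N R"
  shows "\<exists>r>0. \<exists>L\<ge>0. cball z r \<subseteq> N \<and>
    (\<forall>x\<in>cball z r. (R has_derivative (*v) (jacobian R (at x))) (at x)) \<and>
    (\<forall>x\<in>cball z r. \<forall>y\<in>cball z r. \<forall>h.
       norm (jacobian R (at x) *v h - jacobian R (at y) *v h) \<le> L * norm (x - y) * norm h)"
proof -
  obtain r where r: "r > 0" "cball z r \<subseteq> N" using assms(1,2) open_contains_cball by blast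
  have C2: "Ck_on (Suc (Suc 0)) N R" using assms(3) unfolding smooth_on_def by blast
  have der: "(R has_derivative (*v) (jacobian R (at x))) (at x)" if "x \<in> cball z r" for x
    using C2 that r(2) jacobian_works[of R "at x"] by auto
  define g where "g v x = frechet_derivative R (at x) v" for v x
  have g_eq: "g v x = jacobian R (at x) *v v" if "x \<in> cball z r" for v x
    unfolding g_def using frechet_derivative_at[OF der[OF that]] by simp
  have "\<exists>L\<ge>0. \<forall>x\<in>cball z r. \<forall>y\<in>cball z r. norm (g v x - g v y) \<le> L * norm (x - y)" for v
  proof (rule C1_locally_lipschitz)
    show "g v differentiable (at x)" if "x \<in> cball z r" for x
      using C2 that r(2) unfolding g_def by auto
    show "continuous_on (cball z r) (\<lambda>x. frechet_derivative (g v) (at x) w)" for w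
      using C2 unfolding g_def by (intro continuous_on_subset[OF _ r(2)]) auto
  qed
  then obtain K where K: "\<And>v. K v \<ge> 0"
    "\<And>v x y. x \<in> cball z r \<Longrightarrow> y \<in> cball z r \<Longrightarrow> norm (g v x - g v y) \<le> K v * norm (x - y)" by metis
  define L where "L = (\<Sum>i\<in>UNIV. K (axis (i::'m) 1))"
  have "norm (jacobian R (at x) *v h - jacobian R (at y) *v h) \<le> L * norm (x - y) * norm h"
    if x: "x \<in> cball z r" and y: "y \<in> cball z r" for x y h
  proof -
    let ?f = "\<lambda>h. (jacobian R (at x) - jacobian R (at y)) *v h"
    have "norm (?f h) \<le> (\<Sum>i\<in>UNIV. norm (?f (axis i 1))) * norm h"
      by (rule norm_linear_le_sum_axis) simp
    also have "\<dots> \<le> (\<Sum>i\<in>UNIV. K (axis i 1) * norm (x - y)) * norm h"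
      using K(2)[OF x y] by (intro mult_right_mono sum_mono)
        (simp_all add: matrix_vector_mult_diff_rdistrib g_eq[OF x] g_eq[OF y])
    also have "\<dots> = L * norm (x - y) * norm h" unfolding L_def by (simp add: sum_distrib_right)
    finally show ?thesis by (simp add: matrix_vector_mult_diff_rdistrib)
  qed
  moreover have "L \<ge> 0" unfolding L_def by (intro sum_nonneg K(1))
  ultimately show ?thesis using r der by blast
qed

text \<open>
  A quantitative nondegenerate zero. The smallness conditions make the linearization dominate the
  Taylor remainder, for the residual itself and in the normal equations.
\<close>

locale regular_zero =
  fixes R :: "real^'m \<Rightarrow> real^'p" and z :: "real^'m" and r \<sigma> B L :: real
  assumes r_pos: "0 < r" and \<sigma>_pos: "0 < \<sigma>" and L_nonneg: "0 \<le> L" and B_nonneg: "0 \<le> B"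
    and zero: "R z = 0"
    and jacobian_lower: "\<And>x h. x \<in> ball z r \<Longrightarrow> \<sigma> * norm h \<le> norm (jacobian R (at x) *v h)"
    and jacobian_upper: "\<And>x h. x \<in> ball z r \<Longrightarrow> norm (jacobian R (at x) *v h) \<le> B * norm h"
    and taylor: "\<And>x y. x \<in> ball z r \<Longrightarrow> y \<in> ball z r \<Longrightarrow>
      norm (R y - R x - jacobian R (at x) *v (y - x)) \<le> L * (norm (y - x))\<^sup>2"
    and small: "L * r \<le> \<sigma> / 2" "B * L * r \<le> \<sigma>\<^sup>2 / 2"

text \<open>
  Bounds for the Jacobian at \<open>z\<close> persist nearby with a factor to spare, by Lipschitz continuity; the
  remainder estimate is the mean value inequality for \<open>R\<close> minus its linearization at \<open>x\<close>.
\<close>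

lemma regular_zero_exists:
  fixes R :: "real^'m \<Rightarrow> real^'p"
  assumes N: "open N" "z \<in> N" and smooth: "smooth_on N R"
    and zero: "R z = 0" and full_rank: "rank (jacobian R (at z)) = CARD('m)"
  shows "\<exists>r \<sigma> B L. regular_zero R z r \<sigma> B L \<and> ball z r \<subseteq> N"
proof -
  obtain r0 L where r0: "r0 > 0" and L: "L \<ge> 0" and sub: "cball z r0 \<subseteq> N"
    and der: "\<And>x. x \<in> cball z r0 \<Longrightarrow> (R has_derivative (*v) (jacobian R (at x))) (at x)"
    and lip: "\<And>x y h. x \<in> cball z r0 \<Longrightarrow> y \<in> cball z r0 \<Longrightarrow>
       norm (jacobian R (at x) *v h - jacobian R (at y) *v h) \<le> L * norm (x - y) * norm h"
    using smooth_on_jacobian_lipschitz[OF N smooth] by blast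
  let ?J = "\<lambda>x. jacobian R (at x)"
  have "inj ((*v) (?J z))" using full_rank full_rank_injective by blast
  then obtain s where s: "s > 0" "\<And>h. s * norm h \<le> norm (?J z *v h)"
    using linear_inj_bounded_below_pos[OF matrix_vector_mul_linear[of "?J z"]] by metis
  obtain b where b: "b > 0" "\<And>h. norm (?J z *v h) \<le> b * norm h"
    using linear_bounded_pos[OF matrix_vector_mul_linear[of "?J z"]] by metis
  \<comment> \<open>Half of the lower bound is given away; \<open>B\<close> exceeds the upper bound by the same amount. The
    summands 1 in the denominators cover \<open>L = 0\<close>.\<close>
  define \<sigma> where "\<sigma> = s / 2"
  define B where "B = b + \<sigma>"
  define r where "r = min r0 (min (\<sigma> / (2 * (L + 1))) (\<sigma>\<^sup>2 / (2 * (B * L + 1))))"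
  have \<sigma>: "\<sigma> > 0" and B: "B > 0" using s b unfolding \<sigma>_def B_def by auto
  have BL: "B * L \<ge> 0" using B L by simp
  have r: "r > 0" "r \<le> r0" unfolding r_def using r0 \<sigma> L BL by (auto simp: zero_less_divide_iff)
  have "(L + 1) * r \<le> (L + 1) * (\<sigma> / (2 * (L + 1)))" unfolding r_def using L by (intro mult_left_mono) auto
  also have "\<dots> = \<sigma> / 2" using L by (simp add: field_simps)
  finally have Lr: "L * r \<le> \<sigma> / 2" using r(1) by (simp add: distrib_right)
  have "(B * L + 1) * r \<le> (B * L + 1) * (\<sigma>\<^sup>2 / (2 * (B * L + 1)))" unfolding r_def using BL by (intro mult_left_mono) auto
  also have "\<dots> = \<sigma>\<^sup>2 / 2" using BL by (simp add: field_simps)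
  finally have BLr: "B * L * r \<le> \<sigma>\<^sup>2 / 2" using r(1) by (simp add: distrib_right)
  have sub': "x \<in> cball z r0" if "x \<in> ball z r" for x using that r(2) by simp
  have close: "norm (?J x *v h - ?J z *v h) \<le> \<sigma> * norm h" if x: "x \<in> ball z r" for x h
  proof -
    have "norm (?J x *v h - ?J z *v h) \<le> L * norm (x - z) * norm h"
      using r0 by (intro lip sub'[OF x]) simp
    also have "\<dots> \<le> \<sigma> * norm h"
    proof (rule mult_right_mono)
      have "L * norm (x - z) \<le> L * r"
        using x L by (intro mult_left_mono) (auto simp: dist_norm norm_minus_commute)
      then show "L * norm (x - z) \<le> \<sigma>" using Lr \<sigma> by linarith
    qed simp
    finally show ?thesis .
  qed
  have "regular_zero R z r \<sigma> B L"
  proof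
    fix x h assume x: "x \<in> ball z r"
    have "2 * \<sigma> * norm h \<le> norm (?J z *v h)" using s(2)[of h] unfolding \<sigma>_def by simp
    then show "\<sigma> * norm h \<le> norm (?J x *v h)"
      using close[OF x, of h] norm_triangle_ineq2[of "?J z *v h" "?J x *v h"]
      by (simp add: norm_minus_commute)
    show "norm (?J x *v h) \<le> B * norm h"
      using close[OF x, of h] norm_triangle_ineq2[of "?J x *v h" "?J z *v h"] b(2)[of h]
      unfolding B_def by (simp add: distrib_right)
  next
    fix x y assume x: "x \<in> ball z r" and y: "y \<in> ball z r"
    define S where "S = closed_segment x y"
    have S: "S \<subseteq> cball z r0" unfolding S_def
      using closed_segment_subset[OF sub'[OF x] sub'[OF y] convex_cball] .
    have "norm (R y - R x - ?J x *v (y - x)) \<le> norm (y - x) * (L * norm (y - x))"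
    proof (rule differentiable_bound_linearization[where S = S and f' = "\<lambda>u h. ?J u *v h"])
      fix t :: real assume "t \<in> {0..1}"
      then show "x + t *\<^sub>R (y - x) \<in> S"
        unfolding S_def closed_segment_def by (auto intro!: exI[of _ t] simp: algebra_simps)
    next
      fix u assume u: "u \<in> S"
      have uc: "u \<in> cball z r0" using S u by (rule subsetD)
      show "(R has_derivative (\<lambda>h. ?J u *v h)) (at u within S)"
        by (rule has_derivative_at_withinI[OF der[OF uc]])
      show "onorm ((\<lambda>h. ?J u *v h) - (\<lambda>h. ?J x *v h)) \<le> L * norm (y - x)"
      proof (rule onorm_bound)
        fix h
        have "norm (?J u *v h - ?J x *v h) \<le> L * norm (u - x) * norm h"
          by (rule lip[OF uc sub'[OF x]])
        also have "\<dots> \<le> L * norm (y - x) * norm h"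
          using segment_bound(1)[of u x y] u L unfolding S_def
          by (intro mult_right_mono mult_left_mono) (auto simp: norm_minus_commute)
        finally show "norm (((\<lambda>h. ?J u *v h) - (\<lambda>h. ?J x *v h)) h) \<le> L * norm (y - x) * norm h" by simp
      qed (use L in simp)
    qed (simp add: S_def)
    then show "norm (R y - R x - ?J x *v (y - x)) \<le> L * (norm (y - x))\<^sup>2"
      by (simp add: power2_eq_square mult_ac)
  qed (use r \<sigma> L B zero Lr BLr in auto)
  moreover have "ball z r \<subseteq> N" using sub sub' by blast
  ultimately show ?thesis by blast
qed

lemma contraction_tendsto_zero:
  fixes a :: "nat \<Rightarrow> real"
  assumes "\<And>k. 0 \<le> a k" "\<And>k. a (Suc k) \<le> q * a k" "0 \<le> q" "q < 1"
  shows "a \<longlonglongrightarrow> 0"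
proof -
  have le: "a k \<le> q ^ k * a 0" for k
  proof (induction k)
    case (Suc k)
    have "a (Suc k) \<le> q * a k" by (rule assms(2))
    also have "\<dots> \<le> q * (q ^ k * a 0)" using Suc assms(3) by (rule mult_left_mono)
    finally show ?case by (simp add: mult.assoc)
  qed simp
  have "(\<lambda>k. q ^ k * a 0) \<longlonglongrightarrow> 0"
    using tendsto_mult_right[OF LIMSEQ_power_zero[of q], of "a 0"] assms(3,4) by simp
  from tendsto_sandwich[OF _ _ tendsto_const this, of a]
  show ?thesis using assms(1) le by simp
qed

context regular_zero
begin

lemma z_in_ball: "z \<in> ball z r" using r_pos by simp

text \<open>
  Taylor's estimate from \<open>x\<close> to the zero \<open>z\<close>.
\<close>

lemma residual_expansion:
  assumes "x \<in> ball z r"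
  shows "norm (R x - jacobian R (at x) *v (x - z)) \<le> L * (norm (x - z))\<^sup>2"
proof -
  have "R z - R x - jacobian R (at x) *v (z - x) = - (R x - jacobian R (at x) *v (x - z))"
    using zero by (simp add: matrix_vector_mult_diff_distrib)
  then show ?thesis
    using taylor[OF assms z_in_ball] by (simp only: norm_minus_cancel norm_minus_commute[of z x])
qed

lemma quadratic_term_le:
  assumes "x \<in> ball z r"
  shows "L * (norm (x - z))\<^sup>2 \<le> \<sigma> / 2 * norm (x - z)"
proof -
  have "L * norm (x - z) \<le> \<sigma> / 2"
    using mult_left_mono[of "norm (x - z)" r L] L_nonneg small(1) assms
    by (auto simp: dist_norm norm_minus_commute)
  then have "L * norm (x - z) * norm (x - z) \<le> \<sigma> / 2 * norm (x - z)" by (rule mult_right_mono) simp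
  then show ?thesis by (simp add: power2_eq_square mult.assoc)
qed

lemma residual_lower:
  assumes "x \<in> ball z r" shows "\<sigma> / 2 * norm (x - z) \<le> norm (R x)"
  using residual_expansion[OF assms] jacobian_lower[OF assms, of "x - z"] quadratic_term_le[OF assms]
    norm_triangle_ineq2[of "jacobian R (at x) *v (x - z)" "R x"]
  by (simp add: norm_minus_commute)

lemma residual_upper:
  assumes "x \<in> ball z r" shows "norm (R x) \<le> (B + \<sigma>) * norm (x - z)"
proof -
  have "norm (R x) \<le> B * norm (x - z) + \<sigma> / 2 * norm (x - z)"
    using residual_expansion[OF assms] jacobian_upper[OF assms, of "x - z"] quadratic_term_le[OF assms]
      norm_triangle_ineq2[of "R x" "jacobian R (at x) *v (x - z)"] by simp
  moreover have "\<sigma> / 2 * norm (x - z) \<le> \<sigma> * norm (x - z)"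
    using \<sigma>_pos by (intro mult_right_mono) auto
  ultimately show ?thesis by (simp only: distrib_right)
qed

lemma full_rank_near:
  assumes "x \<in> ball z r" shows "rank (jacobian R (at x)) = CARD('m)"
  unfolding full_rank_injective
proof (rule injI)
  fix a b assume "jacobian R (at x) *v a = jacobian R (at x) *v b"
  then have "jacobian R (at x) *v (a - b) = 0" by (simp add: matrix_vector_mult_diff_distrib)
  then have "\<sigma> * norm (a - b) \<le> 0" using jacobian_lower[OF assms, of "a - b"] by simp
  then show "a = b" using \<sigma>_pos by (simp add: mult_le_0_iff)
qed

lemma norm_transpose_jacobian_le:
  assumes "x \<in> ball z r"
  shows "norm (transpose (jacobian R (at x)) *v q) \<le> B * norm q"
proof -
  let ?J = "jacobian R (at x)"
  define w where "w = transpose ?J *v q"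
  have "w \<bullet> w = q \<bullet> (?J *v w)" unfolding w_def
    by (metis dot_lmul_matrix transpose_matrix_vector)
  also have "\<dots> \<le> norm q * norm (?J *v w)" by (rule norm_cauchy_schwarz)
  also have "\<dots> \<le> norm q * (B * norm w)" by (intro mult_left_mono jacobian_upper assms) simp
  finally have "norm w * norm w \<le> (B * norm q) * norm w"
    by (simp add: power2_norm_eq_inner[symmetric] power2_eq_square mult_ac)
  then show ?thesis unfolding w_def[symmetric] using B_nonneg by (cases "w = 0") auto
qed

text \<open>
  Testing with \<open>h\<close> itself gives \<open>h \<bullet> H h = norm (J h) ^ 2 + \<mu> * norm h ^ 2\<close>.
\<close>

lemma lm_matrix_lower:
  assumes "x \<in> ball z r" "\<mu> \<ge> 0"
  shows "(\<sigma>\<^sup>2 + \<mu>) * norm h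
    \<le> norm ((transpose (jacobian R (at x)) ** jacobian R (at x) + \<mu> *\<^sub>R mat 1) *v h)"
proof -
  let ?J = "jacobian R (at x)"
  let ?H = "transpose ?J ** ?J + \<mu> *\<^sub>R mat 1"
  have Hh: "?H *v h = transpose ?J *v (?J *v h) + \<mu> *\<^sub>R h"
    by (simp add: matrix_vector_mult_add_rdistrib matrix_vector_mul_assoc scaleR_matrix_vector_assoc[symmetric])
  have "h \<bullet> (transpose ?J *v (?J *v h)) = (?J *v h) \<bullet> (?J *v h)"
    by (metis dot_lmul_matrix inner_commute transpose_matrix_vector)
  then have eq: "h \<bullet> (?H *v h) = (norm (?J *v h))\<^sup>2 + \<mu> * (norm h)\<^sup>2"
    unfolding Hh by (simp add: inner_add_right power2_norm_eq_inner)
  have "(\<sigma> * norm h)\<^sup>2 \<le> (norm (?J *v h))\<^sup>2"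
    using jacobian_lower[OF assms(1), of h] \<sigma>_pos by (intro power_mono) auto
  then have "(\<sigma>\<^sup>2 + \<mu>) * (norm h)\<^sup>2 \<le> h \<bullet> (?H *v h)"
    unfolding eq by (simp add: power_mult_distrib distrib_right)
  also have "\<dots> \<le> norm h * norm (?H *v h)" by (rule norm_cauchy_schwarz)
  finally have "((\<sigma>\<^sup>2 + \<mu>) * norm h) * norm h \<le> norm (?H *v h) * norm h"
    by (simp add: power2_eq_square mult_ac)
  then show ?thesis by (cases "h = 0") auto
qed

text \<open>
  Writing \<open>e\<close> and \<open>e'\<close> for the errors before and after the step, the normal equations become
  \<open>H e' = \<mu> e - J\<^sup>T (R x - J e)\<close>, so only the Taylor remainder and the damping term remain.
\<close>

lemma lm_step_error:
  assumes x: "x \<in> ball z r" and \<mu>: "\<mu> \<ge> 0"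
  shows "(\<sigma>\<^sup>2 + \<mu>) * norm (lm_step R \<mu> x - z) \<le> \<mu> * norm (x - z) + B * L * (norm (x - z))\<^sup>2"
proof -
  let ?J = "jacobian R (at x)"
  let ?H = "transpose ?J ** ?J + \<mu> *\<^sub>R mat 1"
  let ?e = "x - z"
  have "inj ((*v) ?H)"
  proof (rule injI)
    fix a b assume "?H *v a = ?H *v b"
    then have "?H *v (a - b) = 0" by (simp add: matrix_vector_mult_diff_distrib)
    then have "(\<sigma>\<^sup>2 + \<mu>) * norm (a - b) \<le> 0" using lm_matrix_lower[OF x \<mu>, of "a - b"] by simp
    moreover have "\<sigma>\<^sup>2 + \<mu> > 0" using \<sigma>_pos \<mu> by (simp add: add_pos_nonneg)
    ultimately show "a = b" by (simp add: mult_le_0_iff)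
  qed
  then have "invertible ?H"
    using matrix_left_invertible_injective[of ?H] invertible_left_inverse by blast
  then have inv: "?H ** matrix_inv ?H = mat 1"
    using someI_ex[of "\<lambda>A'. ?H ** A' = mat 1 \<and> A' ** ?H = mat 1"]
    unfolding matrix_inv_def invertible_def by blast
  have "?H *v (lm_step R \<mu> x - z) = ?H *v ?e - transpose ?J *v R x"
    unfolding lm_step_def Let_def
    by (simp add: matrix_vector_mult_diff_distrib matrix_vector_mul_assoc inv)
  also have "\<dots> = \<mu> *\<^sub>R ?e - transpose ?J *v (R x - ?J *v ?e)"
    by (simp add: matrix_vector_mult_add_rdistrib matrix_vector_mul_assoc matrix_vector_mult_diff_distrib
        scaleR_matrix_vector_assoc[symmetric] scaleR_diff_right)
  also have "norm \<dots> \<le> \<mu> * norm ?e + B * (L * (norm ?e)\<^sup>2)"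
    using norm_transpose_jacobian_le[OF x, of "R x - ?J *v ?e"] residual_expansion[OF x] B_nonneg \<mu>
      mult_left_mono[OF residual_expansion[OF x] B_nonneg]
      norm_triangle_ineq4[of "\<mu> *\<^sub>R ?e" "transpose ?J *v (R x - ?J *v ?e)"] by simp
  finally show ?thesis using lm_matrix_lower[OF x \<mu>, of "lm_step R \<mu> x - z"] by simp
qed

text \<open>
  The factor is below 1 for every damping parameter and increases with it. Hence the ball of
  attraction does not depend on the damping, and bounded damping gives a uniform rate.
\<close>

lemma lm_step_contracts:
  assumes x: "x \<in> ball z r" and \<mu>: "\<mu> \<ge> 0" "\<mu> \<le> M"
  shows "norm (lm_step R \<mu> x - z) \<le> (M + \<sigma>\<^sup>2 / 2) / (M + \<sigma>\<^sup>2) * norm (x - z)"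
proof -
  let ?e = "norm (x - z)"
  have s2: "\<sigma>\<^sup>2 > 0" using \<sigma>_pos by simp
  have "B * L * ?e \<le> B * L * r"
    using x B_nonneg L_nonneg by (intro mult_left_mono) (auto simp: dist_norm norm_minus_commute)
  then have "B * L * ?e \<le> \<sigma>\<^sup>2 / 2" using small(2) by linarith
  then have "B * L * ?e * ?e \<le> \<sigma>\<^sup>2 / 2 * ?e" by (rule mult_right_mono) simp
  then have "(\<sigma>\<^sup>2 + \<mu>) * norm (lm_step R \<mu> x - z) \<le> (\<mu> + \<sigma>\<^sup>2 / 2) * ?e"
    using lm_step_error[OF x \<mu>(1)] by (simp add: power2_eq_square distrib_right mult.assoc)
  moreover have pos: "\<mu> + \<sigma>\<^sup>2 > 0" using s2 \<mu>(1) by linarith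
  ultimately have "norm (lm_step R \<mu> x - z) \<le> (\<mu> + \<sigma>\<^sup>2 / 2) / (\<mu> + \<sigma>\<^sup>2) * ?e"
    using pos by (simp add: pos_le_divide_eq[OF pos] ac_simps)
  also have "(\<mu> + \<sigma>\<^sup>2 / 2) / (\<mu> + \<sigma>\<^sup>2) \<le> (M + \<sigma>\<^sup>2 / 2) / (M + \<sigma>\<^sup>2)"
  proof -
    have "(\<mu> + \<sigma>\<^sup>2 / 2) * (M + \<sigma>\<^sup>2) \<le> (M + \<sigma>\<^sup>2 / 2) * (\<mu> + \<sigma>\<^sup>2)"
      using mult_right_mono[OF \<mu>(2), of "\<sigma>\<^sup>2"] by (simp add: field_simps)
    moreover have "\<mu> + \<sigma>\<^sup>2 > 0" "M + \<sigma>\<^sup>2 > 0" using s2 \<mu> by linarith+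
    ultimately show ?thesis by (simp only: pos_divide_le_eq pos_le_divide_eq times_divide_eq_left)
  qed
  finally show ?thesis by (simp add: mult_right_mono)
qed

lemma lm_step_in_ball:
  assumes x: "x \<in> ball z r" and \<mu>: "\<mu> \<ge> 0"
  shows "lm_step R \<mu> x \<in> ball z r"
proof -
  have s2: "\<sigma>\<^sup>2 > 0" using \<sigma>_pos by simp
  have "(\<mu> + \<sigma>\<^sup>2 / 2) / (\<mu> + \<sigma>\<^sup>2) \<le> 1" using s2 \<mu> by (simp add: divide_le_eq add_nonneg_pos)
  then have "norm (lm_step R \<mu> x - z) \<le> 1 * norm (x - z)"
    using lm_step_contracts[OF x \<mu> order_refl] by (meson mult_right_mono norm_ge_zero order_trans)
  then show ?thesis using x by (simp add: dist_norm norm_minus_commute)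
qed

lemma lm_run_in_ball:
  assumes "lm_run R X \<mu>" "\<And>k. \<mu> k \<ge> 0" "X 0 \<in> ball z r"
  shows "X k \<in> ball z r"
proof (induction k)
  case (Suc k)
  then show ?case using assms(1,2) lm_step_in_ball unfolding lm_run_def by metis
qed (rule assms(3))

lemma lm_run_converges:
  assumes run: "lm_run R X \<mu>" "\<And>k. \<mu> k \<ge> 0" "X 0 \<in> ball z r" and bdd: "bounded (range \<mu>)"
  shows "X \<longlonglongrightarrow> z"
proof -
  obtain M where M: "\<And>k. \<mu> k \<le> M" "M \<ge> 0"
  proof -
    obtain M where "\<And>k. norm (\<mu> k) \<le> M" using bdd unfolding bounded_iff by blast
    then show thesis using that[of M] abs_ge_self by (metis abs_ge_zero order_trans real_norm_def)
  qed
  have s2: "\<sigma>\<^sup>2 > 0" using \<sigma>_pos by simp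
  have "(\<lambda>k. norm (X k - z)) \<longlonglongrightarrow> 0"
  proof (rule contraction_tendsto_zero)
    show "norm (X (Suc k) - z) \<le> (M + \<sigma>\<^sup>2 / 2) / (M + \<sigma>\<^sup>2) * norm (X k - z)" for k
      using lm_step_contracts[OF lm_run_in_ball[OF run] run(2) M(1), of k k] run(1)
      unfolding lm_run_def by metis
    show "0 \<le> (M + \<sigma>\<^sup>2 / 2) / (M + \<sigma>\<^sup>2)" "(M + \<sigma>\<^sup>2 / 2) / (M + \<sigma>\<^sup>2) < 1"
      using s2 M(2) by (simp_all add: divide_less_eq add_nonneg_pos)
  qed simp
  then show ?thesis by (simp add: LIM_zero_iff tendsto_norm_zero_iff)
qed

lemma lm_step_quadratic:
  assumes x: "x \<in> ball z r" and \<mu>: "0 \<le> \<mu>" "\<mu> \<le> M * norm (R x)"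
  shows "norm (lm_step R \<mu> x - z) \<le> (\<bar>M\<bar> * (B + \<sigma>) + B * L) / \<sigma>\<^sup>2 * (norm (x - z))\<^sup>2"
proof -
  let ?e = "norm (x - z)"
  have s2: "\<sigma>\<^sup>2 > 0" using \<sigma>_pos by simp
  have "\<mu> \<le> \<bar>M\<bar> * norm (R x)" using \<mu>(2) mult_right_mono[OF abs_ge_self norm_ge_zero, of M "R x"] by linarith
  also have "\<dots> \<le> \<bar>M\<bar> * ((B + \<sigma>) * ?e)" using residual_upper[OF x] by (rule mult_left_mono) simp
  finally have "\<mu> * ?e \<le> \<bar>M\<bar> * ((B + \<sigma>) * ?e) * ?e" by (rule mult_right_mono) simp
  then have "(\<sigma>\<^sup>2 + \<mu>) * norm (lm_step R \<mu> x - z) \<le> (\<bar>M\<bar> * (B + \<sigma>) + B * L) * ?e\<^sup>2"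
    using lm_step_error[OF x \<mu>(1)] by (simp add: power2_eq_square algebra_simps)
  moreover have "\<sigma>\<^sup>2 * norm (lm_step R \<mu> x - z) \<le> (\<sigma>\<^sup>2 + \<mu>) * norm (lm_step R \<mu> x - z)"
    using \<mu>(1) by (intro mult_right_mono) auto
  ultimately have "\<sigma>\<^sup>2 * norm (lm_step R \<mu> x - z) \<le> (\<bar>M\<bar> * (B + \<sigma>) + B * L) * ?e\<^sup>2" by linarith
  then show ?thesis using s2 by (simp add: pos_le_divide_eq mult.commute)
qed

end

lemma gn_step_eq_lm_step: "gn_step R x = lm_step R 0 x"
  unfolding gn_step_def lm_step_def by simp

lemma gn_run_iff_lm_run: "gn_run R X \<longleftrightarrow> lm_run R X (\<lambda>_. 0)"
  unfolding gn_run_def lm_run_def gn_step_eq_lm_step ..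

section \<open>Trust-region iteration\<close>

text \<open>
  The hypothesis says that \<open>t = 1\<close> minimizes the convex function \<open>norm (a + t *\<^sub>R b)\<close> on the unit
  interval, so that its derivative at 1 is not positive.
\<close>

lemma norm_minimal_decrease:
  fixes a b :: "'a::real_inner"
  assumes "\<And>t. 0 < t \<Longrightarrow> t < 1 \<Longrightarrow> norm (a + b) \<le> norm (a + t *\<^sub>R b)"
  shows "(norm b)\<^sup>2 \<le> (norm a)\<^sup>2 - (norm (a + b))\<^sup>2"
proof -
  have expand: "(norm (a + t *\<^sub>R b))\<^sup>2 = (norm a)\<^sup>2 + 2 * t * (a \<bullet> b) + t\<^sup>2 * (norm b)\<^sup>2" for t
    unfolding power2_norm_eq_inner
    by (simp add: inner_add_left inner_add_right inner_commute power2_eq_square)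
  have "t * (norm b)\<^sup>2 \<le> - (2 * (a \<bullet> b) + (norm b)\<^sup>2)" if t: "0 < t" "t < 1" for t
  proof -
    have "(norm (a + b))\<^sup>2 \<le> (norm (a + t *\<^sub>R b))\<^sup>2" by (intro power_mono assms t) simp
    then have "(1 - t) * (2 * (a \<bullet> b) + (1 + t) * (norm b)\<^sup>2) \<le> 0"
      using expand[of 1] expand[of t] by (simp add: algebra_simps power2_eq_square)
    then have "2 * (a \<bullet> b) + (1 + t) * (norm b)\<^sup>2 \<le> 0" using t by (simp add: mult_le_0_iff)
    then show ?thesis by (simp add: distrib_right)
  qed
  then have "(norm b)\<^sup>2 \<le> - (2 * (a \<bullet> b) + (norm b)\<^sup>2)" by (rule field_le_mult_one_interval)
  then show ?thesis using expand[of 1] by simp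
qed

context regular_zero
begin

text \<open>
  A bound for the ratio of the length of a trust-region step to the error; it is of the size of the
  condition number of the Jacobian.
\<close>

definition \<kappa> :: real where "\<kappa> = (B + \<sigma>) / \<sigma>"

lemma \<kappa>_ge_1: "\<kappa> \<ge> 1"
  unfolding \<kappa>_def using B_nonneg \<sigma>_pos by simp

lemma residual_upper_\<kappa>: "x \<in> ball z r \<Longrightarrow> norm (R x) \<le> \<sigma> * \<kappa> * norm (x - z)"
  using residual_upper \<sigma>_pos unfolding \<kappa>_def by simp

text \<open>
  All shorter steps \<open>t *\<^sub>R s\<close> are admissible, so \<open>s\<close> is minimal on its own ray.
\<close>

lemma tr_solution_predicted_decrease:
  assumes "tr_solution R x \<Delta> s"
  shows "(norm (jacobian R (at x) *v s))\<^sup>2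
    \<le> (norm (R x))\<^sup>2 - (norm (R x + jacobian R (at x) *v s))\<^sup>2"
proof (rule norm_minimal_decrease)
  fix t :: real assume t: "0 < t" "t < 1"
  have s: "norm s \<le> \<Delta>" using assms unfolding tr_solution_def by blast
  have "norm (t *\<^sub>R s) \<le> norm s" using t mult_right_mono[of t 1 "norm s"] by simp
  then have "norm (R x + jacobian R (at x) *v s) \<le> norm (R x + jacobian R (at x) *v (t *\<^sub>R s))"
    using assms s order_trans unfolding tr_solution_def by blast
  then show "norm (R x + jacobian R (at x) *v s) \<le> norm (R x + t *\<^sub>R (jacobian R (at x) *v s))"
    by (simp add: matrix_vector_mult_scaleR)
qed

lemma tr_solution_step_le:
  assumes x: "x \<in> ball z r" and sol: "tr_solution R x \<Delta> s"
  shows "norm s \<le> \<kappa> * norm (x - z)"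
proof -
  have "(norm (jacobian R (at x) *v s))\<^sup>2 \<le> (norm (R x))\<^sup>2"
    using tr_solution_predicted_decrease[OF sol] zero_le_power2[of "norm (R x + jacobian R (at x) *v s)"]
    by linarith
  then have "norm (jacobian R (at x) *v s) \<le> norm (R x)" by (rule power2_le_imp_le) simp
  then have "\<sigma> * norm s \<le> \<sigma> * (\<kappa> * norm (x - z))"
    using jacobian_lower[OF x, of s] residual_upper_\<kappa>[OF x] by simp
  then show ?thesis using \<sigma>_pos by simp
qed

text \<open>
  The competitor is \<open>- t *\<^sub>R (x - z)\<close>, a fraction of the step that leads exactly to the zero.
\<close>

lemma tr_solution_model_le:
  assumes x: "x \<in> ball z r" and sol: "tr_solution R x \<Delta> s"
    and t: "0 \<le> t" "t \<le> 1" "t * norm (x - z) \<le> \<Delta>"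
  shows "norm (R x + jacobian R (at x) *v s)
    \<le> (1 - t) * norm (R x) + t * (L * (norm (x - z))\<^sup>2)"
proof -
  let ?J = "jacobian R (at x)"
  let ?e = "x - z"
  have "norm (- (t *\<^sub>R ?e)) \<le> \<Delta>" using t by simp
  then have "norm (R x + ?J *v s) \<le> norm (R x + ?J *v (- (t *\<^sub>R ?e)))"
    using sol unfolding tr_solution_def by blast
  also have "R x + ?J *v (- (t *\<^sub>R ?e)) = (1 - t) *\<^sub>R R x + t *\<^sub>R (R x - ?J *v ?e)"
    using matrix_vector_mult_scaleR[of ?J "- t" ?e] by (simp add: algebra_simps)
  also have "norm \<dots> \<le> (1 - t) * norm (R x) + t * norm (R x - ?J *v ?e)"
    using norm_triangle_ineq[of "(1 - t) *\<^sub>R R x" "t *\<^sub>R (R x - ?J *v ?e)"] t by simp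
  also have "\<dots> \<le> (1 - t) * norm (R x) + t * (L * (norm ?e)\<^sup>2)"
    using residual_expansion[OF x] t(1) by (intro add_left_mono mult_left_mono)
  finally show ?thesis .
qed

text \<open>
  Within this distance of \<open>z\<close> a step stays in \<open>ball z r\<close>, and the model error is small compared
  with the predicted reduction; 16 leaves room for a gain ratio of at least 3/4. The summand 1
  covers \<open>L = 0\<close>.
\<close>

definition tr_radius :: real where
  "tr_radius = min (r / (1 + \<kappa>)) (\<sigma> / (16 * (L * \<kappa>\<^sup>2 + 1)))"

lemma tr_radius:
  "tr_radius > 0" "(1 + \<kappa>) * tr_radius \<le> r" "L * \<kappa>\<^sup>2 * tr_radius \<le> \<sigma> / 16" "tr_radius \<le> r"
proof -
  have L\<kappa>: "L * \<kappa>\<^sup>2 \<ge> 0" using L_nonneg by simp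
  have k: "1 + \<kappa> > 0" using \<kappa>_ge_1 by simp
  show pos: "tr_radius > 0"
    unfolding tr_radius_def using r_pos \<sigma>_pos k L\<kappa> by (simp add: add_nonneg_pos)
  have "(1 + \<kappa>) * tr_radius \<le> (1 + \<kappa>) * (r / (1 + \<kappa>))"
    unfolding tr_radius_def using k by (intro mult_left_mono) auto
  then show le_r: "(1 + \<kappa>) * tr_radius \<le> r" using k by simp
  have "0 \<le> \<kappa> * tr_radius" using \<kappa>_ge_1 pos by simp
  then show "tr_radius \<le> r" using le_r by (simp add: distrib_right)
  have "(L * \<kappa>\<^sup>2 + 1) * tr_radius \<le> (L * \<kappa>\<^sup>2 + 1) * (\<sigma> / (16 * (L * \<kappa>\<^sup>2 + 1)))"
    unfolding tr_radius_def using L\<kappa> by (intro mult_left_mono) auto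
  also have "\<dots> = \<sigma> / 16"
  proof -
    have cancel: "c * (\<sigma> / (16 * c)) = \<sigma> / 16" if "c \<noteq> 0" for c using that by simp
    show ?thesis by (rule cancel) (use L\<kappa> in linarith)
  qed
  finally show "L * \<kappa>\<^sup>2 * tr_radius \<le> \<sigma> / 16" using pos by (simp add: distrib_right)
qed

lemma tr_solution_stays:
  assumes x: "x \<in> ball z tr_radius" and sol: "tr_solution R x \<Delta> s"
  shows "x \<in> ball z r" "x + s \<in> ball z r"
    and "norm (R (x + s)) \<le> norm (R x + jacobian R (at x) *v s) + L * (norm s)\<^sup>2"
proof -
  show xr: "x \<in> ball z r" using x tr_radius(4) by simp
  have e: "norm (x - z) < tr_radius" using x by (simp add: dist_norm norm_minus_commute)
  have "norm (x + s - z) \<le> norm (x - z) + norm s"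
    using norm_triangle_ineq[of "x - z" s] by (simp add: algebra_simps)
  also have "\<dots> \<le> (1 + \<kappa>) * norm (x - z)"
    using tr_solution_step_le[OF xr sol] by (simp add: distrib_right)
  also have "\<dots> < (1 + \<kappa>) * tr_radius" using e \<kappa>_ge_1 by (intro mult_strict_left_mono) auto
  finally show xs: "x + s \<in> ball z r" using tr_radius(2) by (simp add: dist_norm norm_minus_commute)
  show "norm (R (x + s)) \<le> norm (R x + jacobian R (at x) *v s) + L * (norm s)\<^sup>2"
    using taylor[OF xr xs] norm_triangle_ineq2[of "R (x + s)" "R x + jacobian R (at x) *v s"]
    by (simp add: algebra_simps)
qed

text \<open>
  The predicted reduction is at least \<open>\<sigma>\<^sup>2 * norm s ^ 2\<close>, while predicted and actual reduction
  differ by \<open>L * norm s ^ 2\<close> times a quantity of order \<open>norm (x - z)\<close>. This keeps the gain ratio close to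
  1. The decrease of the residual comes from the competitor that moves towards \<open>z\<close> as far as the
  radius allows.
\<close>

lemma tr_step_decrease:
  assumes x: "x \<in> ball z tr_radius" "x \<noteq> z" and sol: "tr_solution R x \<Delta> s" and \<Delta>: "\<Delta> > 0"
  shows "gain_ratio R x s \<ge> 3 / 4"
    and "norm (R (x + s)) \<le> (1 - 3 / 4 * min 1 (\<Delta> / norm (x - z))) * norm (R x)"
proof -
  note stay = tr_solution_stays[OF x(1) sol]
  let ?e = "norm (x - z)" and ?J = "jacobian R (at x)"
  let ?p = "norm (R x + ?J *v s)"
  have e: "?e > 0" "?e < tr_radius" using x by (simp_all add: dist_norm norm_minus_commute)
  have \<kappa>: "\<kappa> \<ge> 1" by (rule \<kappa>_ge_1)
  have "L * \<kappa>\<^sup>2 * ?e \<le> L * \<kappa>\<^sup>2 * tr_radius" using e L_nonneg by (intro mult_left_mono) auto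
  then have a: "L * \<kappa>\<^sup>2 * ?e \<le> \<sigma> / 16" using tr_radius(3) by linarith
  have "\<kappa> \<le> \<kappa>\<^sup>2" using mult_left_mono[OF \<kappa>, of \<kappa>] \<kappa> by (simp add: power2_eq_square)
  then have "L * \<kappa> * ?e \<le> L * \<kappa>\<^sup>2 * ?e"
    using L_nonneg e by (intro mult_right_mono mult_left_mono) auto
  then have b: "L * \<kappa> * ?e \<le> \<sigma> / 16" using a by linarith
  have "L * ?e * 1 \<le> L * ?e * \<kappa>" using \<kappa> L_nonneg e by (intro mult_left_mono) auto
  then have c: "L * ?e \<le> \<sigma> / 16" using b by (simp add: mult_ac)
  have Rlow: "\<sigma> / 2 * ?e \<le> norm (R x)" by (rule residual_lower[OF stay(1)])
  have "\<sigma> / 2 * ?e > 0" using e \<sigma>_pos by simp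
  then have Rpos: "norm (R x) > 0" using Rlow by linarith
  \<comment> \<open>the largest fraction of the exact step \<open>z - x\<close> inside the trust region\<close>
  define \<tau> where "\<tau> = min 1 (\<Delta> / ?e)"
  have \<tau>: "0 < \<tau>" "\<tau> \<le> 1" unfolding \<tau>_def using \<Delta> e by auto
  have \<tau>e: "\<tau> * ?e = min ?e \<Delta>" unfolding \<tau>_def using e by (simp add: min_mult_distrib_right)
  have "L * ?e\<^sup>2 \<le> norm (R x) / 8"
    using mult_right_mono[OF c, of ?e] Rlow by (simp add: power2_eq_square mult_ac)
  then have "\<tau> * (L * ?e\<^sup>2) \<le> \<tau> * (norm (R x) / 8)" using \<tau> by (intro mult_left_mono) auto
  moreover have "?p \<le> (1 - \<tau>) * norm (R x) + \<tau> * (L * ?e\<^sup>2)"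
    using \<tau> \<tau>e by (intro tr_solution_model_le[OF stay(1) sol]) auto
  moreover have "(1 - \<tau>) * norm (R x) + \<tau> * (norm (R x) / 8) = (1 - 7 / 8 * \<tau>) * norm (R x)"
    by (simp add: algebra_simps)
  ultimately have model: "?p \<le> (1 - 7 / 8 * \<tau>) * norm (R x)" by linarith
  have "s \<noteq> 0"
  proof
    assume "s = 0"
    then have "norm (R x) \<le> (1 - 7 / 8 * \<tau>) * norm (R x)" using model by simp
    then have "7 / 8 * \<tau> * norm (R x) \<le> 0" by (simp add: algebra_simps)
    moreover have "7 / 8 * \<tau> * norm (R x) > 0" using \<tau> Rpos by simp
    ultimately show False by linarith
  qed
  then have s: "norm s > 0" by simp
  have s\<kappa>: "norm s \<le> \<kappa> * ?e" by (rule tr_solution_step_le[OF stay(1) sol])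
  have "norm s \<le> \<Delta>" using sol unfolding tr_solution_def by blast
  also have "\<Delta> \<le> \<kappa> * \<Delta>" using \<kappa> \<Delta> by simp
  finally have "norm s \<le> \<kappa> * (\<tau> * ?e)" using s\<kappa> unfolding \<tau>e by (simp add: min_def)
  then have "norm s * norm s \<le> (\<kappa> * (\<tau> * ?e)) * (\<kappa> * ?e)"
    using s\<kappa> by (intro mult_mono) (auto intro: order_trans[OF norm_ge_zero])
  then have "L * (norm s)\<^sup>2 \<le> L * ((\<kappa> * (\<tau> * ?e)) * (\<kappa> * ?e))"
    using L_nonneg by (simp add: power2_eq_square mult_left_mono)
  also have "\<dots> = (L * \<kappa>\<^sup>2 * ?e) * (\<tau> * ?e)" by (simp add: power2_eq_square mult_ac)
  also have "\<dots> \<le> \<sigma> / 16 * (\<tau> * ?e)" using a \<tau> by (intro mult_right_mono) auto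
  also have "\<dots> = \<tau> / 8 * (\<sigma> / 2 * ?e)" by simp
  also have "\<dots> \<le> \<tau> / 8 * norm (R x)" using Rlow \<tau> by (intro mult_left_mono) auto
  finally have "norm (R (x + s)) \<le> (1 - 3 / 4 * \<tau>) * norm (R x)"
    using model stay(3) by (simp add: algebra_simps)
  then show "norm (R (x + s)) \<le> (1 - 3 / 4 * min 1 (\<Delta> / ?e)) * norm (R x)" unfolding \<tau>_def .

  let ?P = "(norm (R x))\<^sup>2 - ?p\<^sup>2"
  have pred: "(norm (?J *v s))\<^sup>2 \<le> ?P" by (rule tr_solution_predicted_decrease[OF sol])
  have "(\<sigma> * norm s)\<^sup>2 \<le> (norm (?J *v s))\<^sup>2"
    using jacobian_lower[OF stay(1), of s] \<sigma>_pos by (intro power_mono) auto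
  then have P: "\<sigma>\<^sup>2 * (norm s)\<^sup>2 \<le> ?P" using pred by (simp add: power_mult_distrib)
  have "\<sigma>\<^sup>2 * (norm s)\<^sup>2 > 0" using s \<sigma>_pos by simp
  then have Ppos: "?P > 0" using P by linarith
  define q where "q = L * (norm s)\<^sup>2"
  have q0: "q \<ge> 0" unfolding q_def using L_nonneg by simp
  have "?p\<^sup>2 \<le> (norm (R x))\<^sup>2" using Ppos by linarith
  then have "?p \<le> norm (R x)" by (rule power2_le_imp_le) simp
  then have p: "?p \<le> \<sigma> * \<kappa> * ?e" using residual_upper_\<kappa>[OF stay(1)] by linarith
  have "(norm s)\<^sup>2 \<le> (\<kappa> * ?e)\<^sup>2" using s\<kappa> by (intro power_mono) auto
  then have "L * q \<le> L * (L * (\<kappa> * ?e)\<^sup>2)" unfolding q_def using L_nonneg by (intro mult_left_mono)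
  also have "\<dots> = (L * \<kappa> * ?e)\<^sup>2" by (simp add: power2_eq_square mult_ac)
  also have "\<dots> \<le> (\<sigma> / 16)\<^sup>2" using b L_nonneg \<kappa> e by (intro power_mono) auto
  finally have Lq: "L * q \<le> \<sigma>\<^sup>2 / 256" by (simp add: power_divide)
  have "L * (2 * ?p) \<le> L * (2 * (\<sigma> * \<kappa> * ?e))" using p L_nonneg by (intro mult_left_mono) auto
  also have "\<dots> = 2 * \<sigma> * (L * \<kappa> * ?e)" by (simp add: mult_ac)
  also have "\<dots> \<le> 2 * \<sigma> * (\<sigma> / 16)" using b \<sigma>_pos by (intro mult_left_mono) auto
  finally have Lp: "L * (2 * ?p) \<le> \<sigma>\<^sup>2 / 8" by (simp add: power2_eq_square)
  have "L * (2 * ?p + q) \<le> \<sigma>\<^sup>2 / 4" 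
    using Lp Lq zero_le_power2[of \<sigma>] unfolding distrib_left by linarith
  then have "L * (2 * ?p + q) * (norm s)\<^sup>2 \<le> \<sigma>\<^sup>2 / 4 * (norm s)\<^sup>2" by (rule mult_right_mono) simp
  then have qq: "q * (2 * ?p + q) \<le> ?P / 4" using P unfolding q_def by (simp add: mult_ac)
  have "(norm (R (x + s)))\<^sup>2 \<le> (?p + q)\<^sup>2" using stay(3) unfolding q_def by (intro power_mono) auto
  also have "\<dots> = ?p\<^sup>2 + q * (2 * ?p + q)" by (simp add: power2_eq_square algebra_simps)
  finally have "3 / 4 * ?P \<le> (norm (R x))\<^sup>2 - (norm (R (x + s)))\<^sup>2" using qq by (simp add: field_simps)
  then show "gain_ratio R x s \<ge> 3 / 4"
    unfolding gain_ratio_def using Ppos by (simp only: pos_le_divide_eq)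
qed

text \<open>
  Once the trust region reaches \<open>z\<close>, the exact step \<open>z - x\<close> is a competitor, and its model
  value is the Taylor remainder.
\<close>

lemma tr_step_quadratic:
  assumes x: "x \<in> ball z tr_radius" and sol: "tr_solution R x \<Delta> s" and \<Delta>: "norm (x - z) \<le> \<Delta>"
  shows "norm (x + s - z) \<le> 2 * L * (1 + \<kappa>\<^sup>2) / \<sigma> * (norm (x - z))\<^sup>2"
proof -
  note stay = tr_solution_stays[OF x sol]
  let ?e = "norm (x - z)"
  have "norm (R x + jacobian R (at x) *v s) \<le> L * ?e\<^sup>2"
    using tr_solution_model_le[OF stay(1) sol, of 1] \<Delta> by simp
  moreover have "L * (norm s)\<^sup>2 \<le> L * (\<kappa> * ?e)\<^sup>2"
    using tr_solution_step_le[OF stay(1) sol] L_nonneg by (intro mult_left_mono power_mono) auto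
  ultimately have "norm (R (x + s)) \<le> L * (1 + \<kappa>\<^sup>2) * ?e\<^sup>2"
    using stay(3) by (simp add: power_mult_distrib algebra_simps)
  then have "\<sigma> / 2 * norm (x + s - z) \<le> L * (1 + \<kappa>\<^sup>2) * ?e\<^sup>2"
    using residual_lower[OF stay(2)] by linarith
  then show ?thesis using \<sigma>_pos by (simp add: pos_le_divide_eq algebra_simps)
qed

lemma tr_solution_at_zero:
  assumes "tr_solution R z \<Delta> s" shows "s = 0"
  using tr_solution_step_le[OF z_in_ball assms] by simp

text \<open>
  The residual norms decrease, which confines the iterates: a step cannot leave the region where the
  residual controls the error. Since the radius never falls below its initial value before \<open>z\<close> is
  reached, the decrease is by a fixed factor.
\<close>

lemma tr_run_converges:
  assumes run: "tr_run R \<eta> \<Delta>max X \<Delta>" and \<eta>: "\<eta> < 1 / 4"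
    and \<Delta>0: "0 < \<Delta> 0" "\<Delta> 0 \<le> \<Delta>max" and X0: "X 0 \<in> ball z (tr_radius / (2 * \<kappa>))"
  shows "X k \<in> ball z tr_radius" and "X \<longlonglongrightarrow> z"
    and "\<forall>\<^sub>F k in sequentially.
      norm (X (Suc k) - z) \<le> 2 * L * (1 + \<kappa>\<^sup>2) / \<sigma> * (norm (X k - z))\<^sup>2"
proof -
  define e where "e k = norm (X k - z)" for k
  obtain s where sol: "\<And>k. tr_solution R (X k) (\<Delta> k) (s k)"
    and X: "\<And>k. X (Suc k) = (if gain_ratio R (X k) (s k) > \<eta> then X k + s k else X k)"
    and \<Delta>: "\<And>k. \<Delta> (Suc k) = (if gain_ratio R (X k) (s k) < 1/4 then \<Delta> k / 4
         else if gain_ratio R (X k) (s k) > 3/4 \<and> norm (s k) = \<Delta> k then min (2 * \<Delta> k) \<Delta>max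
         else \<Delta> k)"
    using run unfolding tr_run_def by metis
  have \<kappa>: "\<kappa> \<ge> 1" by (rule \<kappa>_ge_1)
  have X0': "norm (R (X 0)) \<le> \<sigma> * \<kappa> * e 0" "2 * \<kappa> * e 0 < tr_radius"
  proof -
    have e0: "e 0 < tr_radius / (2 * \<kappa>)" using X0 unfolding e_def by (simp add: dist_norm norm_minus_commute)
    then show lt: "2 * \<kappa> * e 0 < tr_radius" using \<kappa> by (simp add: pos_less_divide_eq mult_ac)
    have "1 * e 0 \<le> 2 * \<kappa> * e 0" using \<kappa> by (intro mult_right_mono) (auto simp: e_def)
    then have "e 0 < r" using lt tr_radius(4) by linarith
    then show "norm (R (X 0)) \<le> \<sigma> * \<kappa> * e 0"
      unfolding e_def by (intro residual_upper_\<kappa>) (simp add: dist_norm norm_minus_commute)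
  qed
  \<comment> \<open>The radius may shrink once \<open>z\<close> is reached: all steps are 0 there, and the gain ratio is
    \<open>0 / 0 = 0\<close>. This is why the bound for the radius is claimed only away from \<open>z\<close>.\<close>
  define I where "I k \<longleftrightarrow> X k \<in> ball z tr_radius \<and> norm (R (X k)) \<le> norm (R (X 0)) \<and>
      (X k = z \<or> \<Delta> 0 \<le> \<Delta> k)" for k
  have at_z: "X (Suc k) = X k \<and> s k = 0" if "X k = z" for k
    using tr_solution_at_zero[of "\<Delta> k" "s k"] sol[of k] X[of k] that by simp
  have off_z: "X (Suc k) = X k + s k" "\<Delta> 0 \<le> \<Delta> (Suc k)"
      "norm (R (X (Suc k))) \<le> (1 - 3 / 4 * min 1 (\<Delta> k / e k)) * norm (R (X k))"
    if "I k" "X k \<noteq> z" for k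
  proof -
    have Ik: "X k \<in> ball z tr_radius" "\<Delta> 0 \<le> \<Delta> k" using that unfolding I_def by auto
    have \<Delta>k: "\<Delta> k > 0" using Ik(2) \<Delta>0 by linarith
    note dec = tr_step_decrease[OF Ik(1) that(2) sol \<Delta>k]
    show next_eq: "X (Suc k) = X k + s k" using X[of k] dec(1) \<eta> by simp
    show "\<Delta> 0 \<le> \<Delta> (Suc k)" using \<Delta>[of k] dec(1) Ik(2) \<Delta>0 by auto
    show "norm (R (X (Suc k))) \<le> (1 - 3 / 4 * min 1 (\<Delta> k / e k)) * norm (R (X k))"
      using dec(2) unfolding next_eq e_def .
  qed
  have inv: "I k" for k
  proof (induction k)
    case 0
    have "1 * e 0 \<le> 2 * \<kappa> * e 0" using \<kappa> by (intro mult_right_mono) (auto simp: e_def)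
    then have "e 0 < tr_radius" using X0'(2) by linarith
    then show ?case unfolding I_def e_def by (simp add: dist_norm norm_minus_commute)
  next
    case (Suc k)
    show ?case
    proof (cases "X k = z")
      case True
      then show ?thesis using Suc at_z[of k] unfolding I_def by simp
    next
      case False
      note off = off_z[OF Suc False]
      have Ik: "X k \<in> ball z tr_radius" "norm (R (X k)) \<le> norm (R (X 0))" "\<Delta> 0 \<le> \<Delta> k"
        using Suc False unfolding I_def by auto
      have "0 \<le> min 1 (\<Delta> k / e k)" using Ik(3) \<Delta>0 unfolding e_def by simp
      then have "(1 - 3 / 4 * min 1 (\<Delta> k / e k)) * norm (R (X k)) \<le> 1 * norm (R (X k))"
        by (intro mult_right_mono) auto
      then have R0: "norm (R (X (Suc k))) \<le> norm (R (X 0))" using off(3) Ik(2) by linarith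
      have "X (Suc k) \<in> ball z r"
        using tr_solution_stays(2)[OF Ik(1) sol] off(1) by simp
      then have "\<sigma> / 2 * e (Suc k) \<le> norm (R (X (Suc k)))"
        unfolding e_def by (rule residual_lower)
      also have "\<dots> \<le> \<sigma> / 2 * (2 * \<kappa> * e 0)" using R0 X0'(1) by simp
      finally have "e (Suc k) \<le> 2 * \<kappa> * e 0" using \<sigma>_pos by simp
      then have "X (Suc k) \<in> ball z tr_radius"
        using X0'(2) unfolding e_def by (simp add: dist_norm norm_minus_commute)
      then show ?thesis using R0 off(2) unfolding I_def by simp
    qed
  qed
  show ball: "X k \<in> ball z tr_radius" for k using inv[of k] unfolding I_def by blast
  have e_lt: "e k < tr_radius" for k using ball[of k] unfolding e_def by (simp add: dist_norm norm_minus_commute)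
  define q where "q = 1 - 3 / 4 * min 1 (\<Delta> 0 / tr_radius)"
  have \<tau>: "0 < min 1 (\<Delta> 0 / tr_radius)" using \<Delta>0 tr_radius(1) by simp
  have "(\<lambda>k. norm (R (X k))) \<longlonglongrightarrow> 0"
  proof (rule contraction_tendsto_zero)
    fix k
    show "norm (R (X (Suc k))) \<le> q * norm (R (X k))"
    proof (cases "X k = z")
      case True
      then show ?thesis using at_z[of k] zero by simp
    next
      case False
      then have ek: "0 < e k" and \<Delta>k: "\<Delta> 0 \<le> \<Delta> k" using inv[of k] unfolding e_def I_def by auto
      have "\<Delta> 0 / tr_radius \<le> \<Delta> k / e k"
        using \<Delta>k ek e_lt[of k] \<Delta>0 by (intro frac_le) auto
      then have "1 - 3 / 4 * min 1 (\<Delta> k / e k) \<le> q" unfolding q_def by (simp add: min.coboundedI2)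
      then have "(1 - 3 / 4 * min 1 (\<Delta> k / e k)) * norm (R (X k)) \<le> q * norm (R (X k))"
        by (rule mult_right_mono) simp
      then show ?thesis using off_z(3)[OF inv False] by linarith
    qed
  qed (use \<tau> in \<open>auto simp: q_def\<close>)
  then have lim: "(\<lambda>k. 2 / \<sigma> * norm (R (X k))) \<longlonglongrightarrow> 0" by (rule tendsto_mult_right_zero)
  have e_le: "e k \<le> 2 / \<sigma> * norm (R (X k))" for k
  proof -
    have "X k \<in> ball z r" using ball[of k] tr_radius(4) by simp
    then have "\<sigma> / 2 * e k \<le> norm (R (X k))" unfolding e_def by (rule residual_lower)
    then show ?thesis using \<sigma>_pos by (simp add: field_simps)
  qed
  have e0: "e \<longlonglongrightarrow> 0"
    using tendsto_sandwich[OF _ _ tendsto_const lim, of e] e_le by (simp add: e_def)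
  then show "X \<longlonglongrightarrow> z"
    unfolding e_def by (simp add: LIM_zero_iff tendsto_norm_zero_iff)
  have "\<forall>\<^sub>F k in sequentially. e k < \<Delta> 0" using order_tendstoD(2)[OF e0 \<Delta>0(1)] .
  then show "\<forall>\<^sub>F k in sequentially.
      norm (X (Suc k) - z) \<le> 2 * L * (1 + \<kappa>\<^sup>2) / \<sigma> * (norm (X k - z))\<^sup>2"
  proof (rule eventually_mono)
    fix k assume ek: "e k < \<Delta> 0"
    show "norm (X (Suc k) - z) \<le> 2 * L * (1 + \<kappa>\<^sup>2) / \<sigma> * (norm (X k - z))\<^sup>2"
    proof (cases "X k = z")
      case True
      then show ?thesis using at_z[of k] by simp
    next
      case False
      then have "e k \<le> \<Delta> k" using inv[of k] ek unfolding I_def by auto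
      then show ?thesis
        using tr_step_quadratic[OF ball sol, of k] off_z(1)[OF inv False] unfolding e_def by simp
    qed
  qed
qed

end

section \<open>Stability and local convergence\<close>

theorem theorem4p4:
  fixes P :: pwdg
    and D :: "('m::finite, 'n::finite) directions"
    and \<rho>s :: "real^'m"
    and N :: "(real^'m) set"
    and R :: "real^'m \<Rightarrow> real^'p"
  assumes setting: "pwdg_setting P" "directions_setting P D"
    and zero_residual: "J_PW P D \<rho>s = 0"
    and nbhd: "open N" "\<rho>s \<in> N"
    and const_rank: "\<exists>r. \<forall>\<rho>\<in>N. rank (G_mat P D \<rho>) = r"
    and unif_invertible: "\<exists>M. \<forall>\<rho>\<in>N. invertible (A_mat P D \<rho>) \<and>
           onorm ((*v) (matrix_inv (A_mat P D \<rho>))) \<le> M"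
    and R_smooth: "smooth_on N R"
    and R_coord: "\<forall>\<rho>\<in>N. J_PW P D \<rho> = (norm (R \<rho>))\<^sup>2"
    and full_rank: "rank (jacobian R (at \<rho>s)) = CARD('m)"
  shows "(\<exists>c0>0. \<exists>C0>0. \<exists>CU>0. \<forall>\<^sub>F \<rho> in nhds \<rho>s.
            c0 * (infdist \<rho> (ray_orbit P D \<rho>s))\<^sup>2 \<le> J_PW P D \<rho> \<and>
            J_PW P D \<rho> \<le> C0 * (infdist \<rho> (ray_orbit P D \<rho>s))\<^sup>2 \<and>
            graph_norm P (\<lambda>K x. U_PW P D \<rho> K x - U_PW P D \<rho>s K x)
              \<le> CU * infdist \<rho> (ray_orbit P D \<rho>s)) \<and>
         (\<exists>\<epsilon>>0. ball \<rho>s \<epsilon> \<subseteq> N \<and>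
            (\<forall>\<rho>\<in>ball \<rho>s \<epsilon>. rank (jacobian R (at \<rho>)) = CARD('m)) \<and>
            (\<exists>C. \<forall>X. gn_run R X \<and> X 0 \<in> ball \<rho>s \<epsilon> \<longrightarrow>
               (\<forall>k. X k \<in> ball \<rho>s \<epsilon>) \<and> X \<longlonglongrightarrow> \<rho>s \<and>
               (\<forall>k. norm (X (Suc k) - \<rho>s) \<le> C * (norm (X k - \<rho>s))\<^sup>2))) \<and>
         (\<exists>\<epsilon>>0. ball \<rho>s \<epsilon> \<subseteq> N \<and>
            (\<forall>\<rho>\<in>ball \<rho>s \<epsilon>. rank (jacobian R (at \<rho>)) = CARD('m)) \<and>
            (\<forall>X \<mu>. lm_run R X \<mu> \<and> (\<forall>k. 0 \<le> \<mu> k) \<and> bounded (range \<mu>) \<and> X 0 \<in> ball \<rho>s \<epsilon> \<longrightarrow>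
               (\<forall>k. X k \<in> ball \<rho>s \<epsilon>) \<and> X \<longlonglongrightarrow> \<rho>s) \<and>
            (\<forall>M. \<exists>C. \<forall>X \<mu>. lm_run R X \<mu> \<and> X 0 \<in> ball \<rho>s \<epsilon> \<and>
               (\<forall>k. 0 \<le> \<mu> k \<and> \<mu> k \<le> M * norm (R (X k))) \<longrightarrow>
               (\<forall>k. norm (X (Suc k) - \<rho>s) \<le> C * (norm (X k - \<rho>s))\<^sup>2))) \<and>
         (\<exists>\<epsilon>>0. ball \<rho>s \<epsilon> \<subseteq> N \<and>
            (\<exists>C. \<forall>\<eta> \<Delta>max X \<Delta>. 0 \<le> \<eta> \<and> \<eta> < 1/4 \<and> 0 < \<Delta> 0 \<and> \<Delta> 0 \<le> \<Delta>max \<and>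
               tr_run R \<eta> \<Delta>max X \<Delta> \<and> X 0 \<in> ball \<rho>s \<epsilon> \<longrightarrow>
               (\<forall>k. X k \<in> N) \<and> X \<longlonglongrightarrow> \<rho>s \<and>
               (\<forall>\<^sub>F k in sequentially.
                  norm (X (Suc k) - \<rho>s) \<le> C * (norm (X k - \<rho>s))\<^sup>2)))"
proof -
  have "R \<rho>s = 0" using R_coord nbhd(2) zero_residual by simp
  then obtain r \<sigma> B L where "regular_zero R \<rho>s r \<sigma> B L" and sub: "ball \<rho>s r \<subseteq> N"
    using regular_zero_exists[OF nbhd R_smooth _ full_rank] by blast
  then interpret regular_zero R \<rho>s r \<sigma> B L by simp
  have rank: "\<forall>\<rho>\<in>ball \<rho>s r. rank (jacobian R (at \<rho>)) = CARD('m)" using full_rank_near by blast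
  obtain M where M: "\<And>\<rho>. \<rho> \<in> N \<Longrightarrow> invertible (A_mat P D \<rho>)"
    "\<And>\<rho>. \<rho> \<in> N \<Longrightarrow> onorm ((*v) (matrix_inv (A_mat P D \<rho>))) \<le> M"
    using unif_invertible by blast

  have "lip_field (ball \<rho>s r) P (U_PW P D)"
    by (rule lip_field_U_PW[OF setting(1) bounded_ball M]) (use sub in blast)+
  from graph_norm_increment_le[OF setting(1) this]
  obtain CU where CU: "CU \<ge> 0" "\<And>\<rho>. \<rho> \<in> ball \<rho>s r \<Longrightarrow>
      graph_norm P (\<lambda>K x. U_PW P D \<rho> K x - U_PW P D \<rho>s K x) \<le> CU * dist \<rho> \<rho>s"
    using z_in_ball by blast
  have near: "\<forall>\<^sub>F \<rho> in nhds \<rho>s. \<rho> \<in> ball \<rho>s r \<and> infdist \<rho> (ray_orbit P D \<rho>s) = dist \<rho> \<rho>s"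
    using z_in_ball
    by (intro eventually_conj eventually_nhds_in_open infdist_finite_near
        finite_ray_orbit[OF setting] self_in_ray_orbit open_ball)
  have local: "(\<sigma> / 2)\<^sup>2 * d\<^sup>2 \<le> J_PW P D \<rho> \<and> J_PW P D \<rho> \<le> (B + \<sigma>)\<^sup>2 * d\<^sup>2 \<and>
      graph_norm P (\<lambda>K x. U_PW P D \<rho> K x - U_PW P D \<rho>s K x) \<le> (CU + 1) * d"
    if "\<rho> \<in> ball \<rho>s r" "d = dist \<rho> \<rho>s" for \<rho> d
  proof -
    have d: "d = norm (\<rho> - \<rho>s)" using that(2) by (simp add: dist_norm)
    have J: "J_PW P D \<rho> = (norm (R \<rho>))\<^sup>2" using R_coord sub that(1) by blast
    have "(\<sigma> / 2 * d)\<^sup>2 \<le> (norm (R \<rho>))\<^sup>2"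
      using residual_lower[OF that(1)] \<sigma>_pos unfolding d by (intro power_mono) auto
    moreover have "(norm (R \<rho>))\<^sup>2 \<le> ((B + \<sigma>) * d)\<^sup>2"
      using residual_upper[OF that(1)] unfolding d by (intro power_mono) auto
    moreover have "CU * d \<le> (CU + 1) * d" unfolding d by (intro mult_right_mono) auto
    ultimately show ?thesis
      using CU(2)[OF that(1), folded that(2)] unfolding J power_mult_distrib
      by (intro conjI) linarith+
  qed
  have two_sided: "\<exists>c0>0. \<exists>C0>0. \<exists>CU>0. \<forall>\<^sub>F \<rho> in nhds \<rho>s.
      c0 * (infdist \<rho> (ray_orbit P D \<rho>s))\<^sup>2 \<le> J_PW P D \<rho> \<and>
      J_PW P D \<rho> \<le> C0 * (infdist \<rho> (ray_orbit P D \<rho>s))\<^sup>2 \<and>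
      graph_norm P (\<lambda>K x. U_PW P D \<rho> K x - U_PW P D \<rho>s K x)
        \<le> CU * infdist \<rho> (ray_orbit P D \<rho>s)"
  proof (intro exI conjI)
    show "(\<sigma> / 2)\<^sup>2 > 0" "(B + \<sigma>)\<^sup>2 > 0" "CU + 1 > 0" using \<sigma>_pos B_nonneg CU(1) by auto
    show "\<forall>\<^sub>F \<rho> in nhds \<rho>s.
      (\<sigma> / 2)\<^sup>2 * (infdist \<rho> (ray_orbit P D \<rho>s))\<^sup>2 \<le> J_PW P D \<rho> \<and>
      J_PW P D \<rho> \<le> (B + \<sigma>)\<^sup>2 * (infdist \<rho> (ray_orbit P D \<rho>s))\<^sup>2 \<and>
      graph_norm P (\<lambda>K x. U_PW P D \<rho> K x - U_PW P D \<rho>s K x)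
        \<le> (CU + 1) * infdist \<rho> (ray_orbit P D \<rho>s)"
      using near by (rule eventually_mono) (rule local; blast)
  qed

  have gauss_newton: "\<exists>C. \<forall>X. gn_run R X \<and> X 0 \<in> ball \<rho>s r \<longrightarrow>
      (\<forall>k. X k \<in> ball \<rho>s r) \<and> X \<longlonglongrightarrow> \<rho>s \<and>
      (\<forall>k. norm (X (Suc k) - \<rho>s) \<le> C * (norm (X k - \<rho>s))\<^sup>2)"
  proof (intro exI allI impI conjI)
    fix X k assume X: "gn_run R X \<and> X 0 \<in> ball \<rho>s r"
    then have run: "lm_run R X (\<lambda>_. 0)" "X 0 \<in> ball \<rho>s r" by (simp_all add: gn_run_iff_lm_run)
    show in_ball: "X k \<in> ball \<rho>s r" for k by (rule lm_run_in_ball[OF run(1) _ run(2)]) simp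
    show "X \<longlonglongrightarrow> \<rho>s" by (rule lm_run_converges[OF run(1) _ run(2)]) auto
    show "norm (X (Suc k) - \<rho>s) \<le> (\<bar>0\<bar> * (B + \<sigma>) + B * L) / \<sigma>\<^sup>2 * (norm (X k - \<rho>s))\<^sup>2"
      using lm_step_quadratic[OF in_ball, of 0 0 k] run(1) unfolding lm_run_def by simp
  qed
  have levenberg_marquardt: "\<forall>X \<mu>. lm_run R X \<mu> \<and> (\<forall>k. 0 \<le> \<mu> k) \<and> bounded (range \<mu>) \<and> X 0 \<in> ball \<rho>s r \<longrightarrow>
      (\<forall>k. X k \<in> ball \<rho>s r) \<and> X \<longlonglongrightarrow> \<rho>s"
  proof (intro allI impI conjI; elim conjE)
    fix X \<mu>
    assume X: "lm_run R X \<mu>" "\<forall>k. 0 \<le> \<mu> k" "bounded (range \<mu>)" "X 0 \<in> ball \<rho>s r"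
    show "X k \<in> ball \<rho>s r" for k using lm_run_in_ball[of X \<mu>] X by simp
    show "X \<longlonglongrightarrow> \<rho>s" using lm_run_converges[of X \<mu>] X by simp
  qed
  have lm_quadratic: "\<forall>M. \<exists>C. \<forall>X \<mu>. lm_run R X \<mu> \<and> X 0 \<in> ball \<rho>s r \<and>
      (\<forall>k. 0 \<le> \<mu> k \<and> \<mu> k \<le> M * norm (R (X k))) \<longrightarrow>
      (\<forall>k. norm (X (Suc k) - \<rho>s) \<le> C * (norm (X k - \<rho>s))\<^sup>2)"
  proof (rule allI, rule exI, intro allI impI)
    fix M X \<mu> k
    assume X: "lm_run R X \<mu> \<and> X 0 \<in> ball \<rho>s r \<and> (\<forall>k. 0 \<le> \<mu> k \<and> \<mu> k \<le> M * norm (R (X k)))"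
    then have run: "lm_run R X \<mu>" "X 0 \<in> ball \<rho>s r" and \<mu>: "\<And>k. 0 \<le> \<mu> k" "\<mu> k \<le> M * norm (R (X k))"
      by (iprover)+
    have "X (Suc k) = lm_step R (\<mu> k) (X k)" using run(1) unfolding lm_run_def by (rule spec)
    then show "norm (X (Suc k) - \<rho>s) \<le> (\<bar>M\<bar> * (B + \<sigma>) + B * L) / \<sigma>\<^sup>2 * (norm (X k - \<rho>s))\<^sup>2"
      using lm_step_quadratic[OF lm_run_in_ball[OF run(1) \<mu>(1) run(2)] \<mu>] by simp
  qed
  define \<epsilon> where "\<epsilon> = tr_radius / (2 * \<kappa>)"
  have \<epsilon>: "\<epsilon> > 0" "ball \<rho>s \<epsilon> \<subseteq> N" "ball \<rho>s tr_radius \<subseteq> N"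
  proof -
    have tr: "ball \<rho>s tr_radius \<subseteq> ball \<rho>s r" by (rule subset_ball[OF tr_radius(4)])
    then show "ball \<rho>s tr_radius \<subseteq> N" using sub by blast
    show "\<epsilon> > 0" unfolding \<epsilon>_def using tr_radius(1) \<kappa>_ge_1 by simp
    have "\<epsilon> \<le> tr_radius" unfolding \<epsilon>_def
      using tr_radius(1) \<kappa>_ge_1 by (simp add: pos_divide_le_eq)
    then show "ball \<rho>s \<epsilon> \<subseteq> N" using \<open>ball \<rho>s tr_radius \<subseteq> N\<close> subset_ball by blast
  qed
  have trust_region: "\<exists>C. \<forall>\<eta> \<Delta>max X \<Delta>. 0 \<le> \<eta> \<and> \<eta> < 1/4 \<and> 0 < \<Delta> 0 \<and> \<Delta> 0 \<le> \<Delta>max \<and>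
      tr_run R \<eta> \<Delta>max X \<Delta> \<and> X 0 \<in> ball \<rho>s \<epsilon> \<longrightarrow>
      (\<forall>k. X k \<in> N) \<and> X \<longlonglongrightarrow> \<rho>s \<and>
      (\<forall>\<^sub>F k in sequentially. norm (X (Suc k) - \<rho>s) \<le> C * (norm (X k - \<rho>s))\<^sup>2)"
  proof (rule exI, intro allI impI, elim conjE)
    fix \<eta> \<Delta>max X \<Delta>
    assume "\<eta> < 1/4" "0 < \<Delta> 0" "\<Delta> 0 \<le> \<Delta>max" "tr_run R \<eta> \<Delta>max X \<Delta>" "X 0 \<in> ball \<rho>s \<epsilon>"
    note run = tr_run_converges[OF this(4,1,2,3,5)[unfolded \<epsilon>_def]]
    show "(\<forall>k. X k \<in> N) \<and> X \<longlonglongrightarrow> \<rho>s \<and> (\<forall>\<^sub>F k in sequentially.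
        norm (X (Suc k) - \<rho>s) \<le> 2 * L * (1 + \<kappa>\<^sup>2) / \<sigma> * (norm (X k - \<rho>s))\<^sup>2)"
      using run(1) \<epsilon>(3) by (intro conjI allI run(2,3)) (rule subsetD)
  qed
  show ?thesis
    by (rule conjI[OF two_sided conjI[OF exI[of _ r] conjI[OF exI[of _ r] exI[of _ \<epsilon>]]]])
      (intro conjI r_pos sub rank gauss_newton levenberg_marquardt lm_quadratic \<epsilon>(1,2) trust_region)+
qed

end
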